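(* Let $G$ be a second countable locally compact group and $\mathcal U\subseteq\mathcal B(L^2(G))$ a weak* closed jointly invariant subspace. Then \[\mathrm{supp}_\omega(\mathcal U)\cong(\mathrm{supp}_G(\mathcal U))^*.\] In particular, the $\omega$-support of a jointly invariant subspace is marginally equivalent to a topologically closed set.
   Context: $G$ carries left Haar measure. A set $\Omega\subseteq G\times G$ is marginally null if $\Omega\subseteq(X\times G)\cup(G\times X)$ for a null set $X$; $\Omega_1\cong\Omega_2$ (marginal equivalence) means the symmetric difference is marginally null. $\Omega$ is $\omega$-open if it is marginally equivalent to a countable union of Borel rectangles, $\omega$-closed if its complement is $\omega$-open. For $\Omega\subseteq G\times G$, $\mathfrak M_{\max}(\Omega)$ is the set of $T\in\mathcal B(L^2(G))$ with $M_{\chi_B}TM_{\chi_A}=0$ whenever $A\times B$ is a Borel rectangle disjoint from $\Omega$. The $\omega$-support $\mathrm{supp}_\omega(\mathcal U)$ is the smallest (up to marginal equivalence) $\omega$-closed $\Omega$ with $\mathcal U\subseteq\mathfrak M_{\max}(\Omega)$. For $E\subseteq G$, $E^*=\{(s,t)\in G\times G:ts^{-1}\in E\}$. $A(G)$ is the Fourier algebra; $T(G)$ is the predual of $\mathcal B(L^2(G))$, identified with functions $h(x,y)=\sum f_i(x)\overline{g_i(y)}$ with $\langle T,h\rangle=\sum\langle Tf_i,g_i\rangle$; for a Schur multiplier $w$ (measurable $w$ with $wT(G)\subseteq T(G)$), $\langle S_w(T),h\rangle=\langle T,wh\rangle$; $N(u)(s,t)=u(ts^{-1})$. $\mathrm{supp}_G(\mathcal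 U)=\{x\in G:u(x)=0\ \forall u\in I_{\mathcal U}\}$ where $I_{\mathcal U}=\{u\in A(G):S_{N(u)}(T)=0\ \forall T\in\mathcal U\}$. With $\rho$ the right regular representation, $\mathcal U$ is jointly invariant if $M_fTM_g\in\mathcal U$ ($f,g\in L^\infty(G)$) and $\rho_rT\rho_r^*\in\mathcal U$ ($r\in G$) whenever $T\in\mathcal U$. *)

theory Defs
  imports "HOL-Analysis.Analysis"
begin

text \<open>The group G is a type 'g (Hausdorff, second countable via type classes) with
  multiplication m and inversion iv.\<close>

definition lc_group :: "('g::topological_space \<Rightarrow> 'g \<Rightarrow> 'g) \<Rightarrow> ('g \<Rightarrow> 'g) \<Rightarrow> bool" where
  "lc_group m iv \<longleftrightarrow>
     (\<forall>x y z. m (m x y) z = m x (m y z)) \<and>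
     (\<exists>e. \<forall>x. m e x = x \<and> m x e = x \<and> m (iv x) x = e \<and> m x (iv x) = e) \<and>
     continuous_on UNIV (\<lambda>p. m (fst p) (snd p)) \<and> continuous_on UNIV iv \<and>
     locally_compact_space (euclidean :: 'g topology)"

definition left_haar :: "('g::topological_space \<Rightarrow> 'g \<Rightarrow> 'g) \<Rightarrow> 'g measure \<Rightarrow> bool" where
  "left_haar m \<mu> \<longleftrightarrow>
     sets \<mu> = sets borel \<and>
     (\<forall>x A. A \<in> sets borel \<longrightarrow> emeasure \<mu> (m x ` A) = emeasure \<mu> A) \<and>
     (\<forall>K. compact K \<longrightarrow> emeasure \<mu> K < \<infinity>) \<and>
     (\<forall>V. open V \<and> V \<noteq> {} \<longrightarrow> 0 < emeasure \<mu> V) \<and>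
     (\<forall>A\<in>sets borel. emeasure \<mu> A = (INF V\<in>{V. open V \<and> A \<subseteq> V}. emeasure \<mu> V)) \<and>
     (\<forall>V. open V \<longrightarrow> emeasure \<mu> V = (SUP K\<in>{K. compact K \<and> K \<subseteq> V}. emeasure \<mu> K))"

definition L2 :: "'g measure \<Rightarrow> ('g \<Rightarrow> complex) set" where
  "L2 \<mu> = {f. f \<in> borel_measurable \<mu> \<and> integrable \<mu> (\<lambda>x. (cmod (f x))\<^sup>2)}"

definition l2norm :: "'g measure \<Rightarrow> ('g \<Rightarrow> complex) \<Rightarrow> real" where
  "l2norm \<mu> f = sqrt (\<integral>x. (cmod (f x))\<^sup>2 \<partial>\<mu>)"

definition ip :: "'g measure \<Rightarrow> ('g \<Rightarrow> complex) \<Rightarrow> ('g \<Rightarrow> complex) \<Rightarrow> complex" where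
  "ip \<mu> f g = (\<integral>x. f x * cnj (g x) \<partial>\<mu>)"

definition Linf :: "'g measure \<Rightarrow> ('g \<Rightarrow> complex) set" where
  "Linf \<mu> = {f. f \<in> borel_measurable \<mu> \<and> (\<exists>C. AE x in \<mu>. cmod (f x) \<le> C)}"

text \<open>Bounded operators on L^2(G), represented by maps on functions that respect
  a.e. equality, are a.e. linear and bounded; two such are identified if they agree a.e.
  on every element of L^2.\<close>

type_synonym 'g op = "('g \<Rightarrow> complex) \<Rightarrow> ('g \<Rightarrow> complex)"

definition bop :: "'g measure \<Rightarrow> 'g op \<Rightarrow> bool" where
  "bop \<mu> T \<longleftrightarrow>
     (\<forall>f\<in>L2 \<mu>. T f \<in> L2 \<mu>) \<and>
     (\<forall>f\<in>L2 \<mu>. \<forall>g\<in>L2 \<mu>. \<forall>a b. AE x in \<mu>. T (\<lambda>y. a * f y + b * g y) x = a * T f x + b * T g x) \<and>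
     (\<forall>f\<in>L2 \<mu>. \<forall>g\<in>L2 \<mu>. (AE x in \<mu>. f x = g x) \<longrightarrow> (AE x in \<mu>. T f x = T g x)) \<and>
     (\<exists>C. \<forall>f\<in>L2 \<mu>. l2norm \<mu> (T f) \<le> C * l2norm \<mu> f)"

definition op_eq :: "'g measure \<Rightarrow> 'g op \<Rightarrow> 'g op \<Rightarrow> bool" where
  "op_eq \<mu> T S \<longleftrightarrow> (\<forall>f\<in>L2 \<mu>. AE x in \<mu>. T f x = S f x)"

definition op_subspace :: "'g measure \<Rightarrow> 'g op set \<Rightarrow> bool" where
  "op_subspace \<mu> U \<longleftrightarrow>
     U \<subseteq> {T. bop \<mu> T} \<and>
     (\<forall>T\<in>U. \<forall>S. bop \<mu> S \<and> op_eq \<mu> T S \<longrightarrow> S \<in> U) \<and>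
     (\<lambda>f x. 0) \<in> U \<and>
     (\<forall>T\<in>U. \<forall>S\<in>U. (\<lambda>f x. T f x + S f x) \<in> U) \<and>
     (\<forall>c. \<forall>T\<in>U. (\<lambda>f x. c * T f x) \<in> U)"

text \<open>Elements of T(G): h = sum_i f_i (x) conj(g_i(y)), with sum ||f_i||^2, sum ||g_i||^2 finite.\<close>

definition tc_rep :: "'g measure \<Rightarrow> (nat \<Rightarrow> 'g \<Rightarrow> complex) \<Rightarrow> (nat \<Rightarrow> 'g \<Rightarrow> complex) \<Rightarrow> bool" where
  "tc_rep \<mu> f g \<longleftrightarrow> (\<forall>i. f i \<in> L2 \<mu> \<and> g i \<in> L2 \<mu>) \<and>
     summable (\<lambda>i. (l2norm \<mu> (f i))\<^sup>2) \<and> summable (\<lambda>i. (l2norm \<mu> (g i))\<^sup>2)"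

definition tc_fun :: "(nat \<Rightarrow> 'g \<Rightarrow> complex) \<Rightarrow> (nat \<Rightarrow> 'g \<Rightarrow> complex) \<Rightarrow> 'g \<times> 'g \<Rightarrow> complex" where
  "tc_fun f g = (\<lambda>(x, y). \<Sum>i. f i x * cnj (g i y))"

definition tc_pair :: "'g measure \<Rightarrow> 'g op \<Rightarrow> (nat \<Rightarrow> 'g \<Rightarrow> complex) \<Rightarrow> (nat \<Rightarrow> 'g \<Rightarrow> complex) \<Rightarrow> complex" where
  "tc_pair \<mu> T f g = (\<Sum>i. ip \<mu> (T (f i)) (g i))"

definition wstar_closed :: "'g measure \<Rightarrow> 'g op set \<Rightarrow> bool" where
  "wstar_closed \<mu> U \<longleftrightarrow>
     (\<forall>T. bop \<mu> T \<and> T \<notin> U \<longrightarrow>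
        (\<exists>F \<epsilon>. finite F \<and> (\<forall>(f, g)\<in>F. tc_rep \<mu> f g) \<and> \<epsilon> > 0 \<and>
           (\<forall>S\<in>U. \<exists>(f, g)\<in>F. \<epsilon> \<le> cmod (tc_pair \<mu> S f g - tc_pair \<mu> T f g))))"

text \<open>Joint invariance. rho_r T rho_r^* equals (up to op_eq) the operator below,
  the modular function factors cancelling by linearity.\<close>

definition jointly_invariant :: "('g \<Rightarrow> 'g \<Rightarrow> 'g) \<Rightarrow> ('g \<Rightarrow> 'g) \<Rightarrow> 'g measure \<Rightarrow> 'g op set \<Rightarrow> bool" where
  "jointly_invariant m iv \<mu> U \<longleftrightarrow>
     (\<forall>T\<in>U. \<forall>a\<in>Linf \<mu>. \<forall>b\<in>Linf \<mu>. (\<lambda>\<xi> x. a x * T (\<lambda>y. b y * \<xi> y) x) \<in> U) \<and>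
     (\<forall>T\<in>U. \<forall>r. (\<lambda>\<xi> x. T (\<lambda>y. \<xi> (m y (iv r))) (m x r)) \<in> U)"

definition marg_null :: "'g measure \<Rightarrow> ('g \<times> 'g) set \<Rightarrow> bool" where
  "marg_null \<mu> \<Omega> \<longleftrightarrow> (\<exists>X\<in>null_sets \<mu>. \<Omega> \<subseteq> (X \<times> UNIV) \<union> (UNIV \<times> X))"

definition marg_equiv :: "'g measure \<Rightarrow> ('g \<times> 'g) set \<Rightarrow> ('g \<times> 'g) set \<Rightarrow> bool" where
  "marg_equiv \<mu> A B \<longleftrightarrow> marg_null \<mu> ((A - B) \<union> (B - A))"

definition omega_open :: "'g measure \<Rightarrow> ('g::topological_space \<times> 'g) set \<Rightarrow> bool" where
  "omega_open \<mu> \<Omega> \<longleftrightarrow> (\<exists>A B :: nat \<Rightarrow> 'g set.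
     (\<forall>n. A n \<in> sets borel \<and> B n \<in> sets borel) \<and> marg_equiv \<mu> \<Omega> (\<Union>n. A n \<times> B n))"

definition omega_closed :: "'g measure \<Rightarrow> ('g::topological_space \<times> 'g) set \<Rightarrow> bool" where
  "omega_closed \<mu> \<Omega> \<longleftrightarrow> omega_open \<mu> (- \<Omega>)"

definition Mmax :: "'g measure \<Rightarrow> ('g::topological_space \<times> 'g) set \<Rightarrow> 'g op set" where
  "Mmax \<mu> \<Omega> = {T. bop \<mu> T \<and>
     (\<forall>A B. A \<in> sets borel \<and> B \<in> sets borel \<and> (A \<times> B) \<inter> \<Omega> = {} \<longrightarrow>
        (\<forall>\<xi>\<in>L2 \<mu>. AE x in \<mu>. indicator B x * T (\<lambda>y. indicator A y * \<xi> y) x = 0))}"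

definition omega_support :: "'g measure \<Rightarrow> 'g op set \<Rightarrow> ('g::topological_space \<times> 'g) set \<Rightarrow> bool" where
  "omega_support \<mu> U \<Omega> \<longleftrightarrow> omega_closed \<mu> \<Omega> \<and> U \<subseteq> Mmax \<mu> \<Omega> \<and>
     (\<forall>\<Omega>'. omega_closed \<mu> \<Omega>' \<and> U \<subseteq> Mmax \<mu> \<Omega>' \<longrightarrow> marg_null \<mu> (\<Omega> - \<Omega>'))"

text \<open>Fourier algebra: coefficients x \<mapsto> <lambda_x xi, eta> of the left regular representation.\<close>

definition fourier_alg :: "('g \<Rightarrow> 'g \<Rightarrow> 'g) \<Rightarrow> ('g \<Rightarrow> 'g) \<Rightarrow> 'g measure \<Rightarrow> ('g \<Rightarrow> complex) set" where
  "fourier_alg m iv \<mu> = {u. \<exists>\<xi>\<in>L2 \<mu>. \<exists>\<eta>\<in>L2 \<mu>. \<forall>x. u x = ip \<mu> (\<lambda>y. \<xi> (m (iv x) y)) \<eta>}"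

definition Nmap :: "('g \<Rightarrow> 'g \<Rightarrow> 'g) \<Rightarrow> ('g \<Rightarrow> 'g) \<Rightarrow> ('g \<Rightarrow> complex) \<Rightarrow> 'g \<times> 'g \<Rightarrow> complex" where
  "Nmap m iv u = (\<lambda>(s, t). u (m t (iv s)))"

text \<open>S_w(T) = 0, i.e. <T, w h> = 0 for every h in T(G).\<close>

definition schur_zero :: "'g measure \<Rightarrow> ('g \<times> 'g \<Rightarrow> complex) \<Rightarrow> 'g op \<Rightarrow> bool" where
  "schur_zero \<mu> w T \<longleftrightarrow>
     (\<forall>f g f' g'. tc_rep \<mu> f g \<and> tc_rep \<mu> f' g' \<and>
        marg_null \<mu> {p. w p * tc_fun f g p \<noteq> tc_fun f' g' p} \<longrightarrow> tc_pair \<mu> T f' g' = 0)"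

definition I_U :: "('g \<Rightarrow> 'g \<Rightarrow> 'g) \<Rightarrow> ('g \<Rightarrow> 'g) \<Rightarrow> 'g measure \<Rightarrow> 'g op set \<Rightarrow> ('g \<Rightarrow> complex) set" where
  "I_U m iv \<mu> U = {u \<in> fourier_alg m iv \<mu>. \<forall>T\<in>U. schur_zero \<mu> (Nmap m iv u) T}"

definition supp_G :: "('g \<Rightarrow> 'g \<Rightarrow> 'g) \<Rightarrow> ('g \<Rightarrow> 'g) \<Rightarrow> 'g measure \<Rightarrow> 'g op set \<Rightarrow> 'g set" where
  "supp_G m iv \<mu> U = {x. \<forall>u\<in>I_U m iv \<mu> U. u x = 0}"

definition estar :: "('g \<Rightarrow> 'g \<Rightarrow> 'g) \<Rightarrow> ('g \<Rightarrow> 'g) \<Rightarrow> 'g set \<Rightarrow> ('g \<times> 'g) set" where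
  "estar m iv E = {(s, t). m t (iv s) \<in> E}"

end

theory Submission
  imports Defs
begin

text \<open>
  Let \<open>E = supp\<^sub>G U\<close>. Since \<open>E\<^sup>*\<close> is closed, and the \<open>\<omega>\<close>-support is unique up to marginal
  equivalence, it suffices that \<open>E\<^sup>*\<close> is an \<open>\<omega>\<close>-support.

  \<open>U \<subseteq> M\<^sub>m\<^sub>a\<^sub>x(E\<^sup>*)\<close>: writing \<open>N(u)(s, t) = \<langle>\<xi>(s \<cdot>), \<eta>(t \<cdot>)\<rangle>\<close>, continuity of translation in \<open>L\<^sup>2\<close> makes \<open>N(u)\<close>
  an invertible Schur multiplier near every point where it does not vanish, so \<open>S\<^bsub>N(u)\<^esub>(T) = 0\<close> forces \<open>T\<close> to
  vanish on a small open rectangle there. Compactness and inner regularity pass to Borel rectangles.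

  Minimality: if \<open>U\<close> vanishes on a compact rectangle \<open>K \<times> L\<close>, it vanishes by invariance on all
  \<open>K y\<^sup>-\<^sup>1 \<times> L y\<^sup>-\<^sup>1\<close>. Integrating over \<open>y\<close> gives \<open>u \<in> I\<^sub>U\<close> for \<open>u(x) = \<mu>(x K \<inter> L)\<close>, hence \<open>u = 0\<close> on \<open>E\<close>. By a
  Lebesgue density argument \<open>u(t s\<^sup>-\<^sup>1) > 0\<close> for marginally almost all \<open>(s, t) \<in> K \<times> L\<close>, so
  \<open>E\<^sup>* \<inter> (K \<times> L)\<close> is marginally null.
\<close>

section \<open>Square-integrable functions\<close>

text \<open>Several obstacles shape the proof. Elements of L^2 and operators are represented by
  functions rather than by classes, so linearity and vanishing of \<open>T\<close> hold only almost
  everywhere. They are therefore tested through \<open>ip\<close>, where they become exact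
  equations. Joint invariance moves rectangles by right translations, but \<open>\<mu>\<close> is
  only left invariant. Of right translations the proof uses only that they preserve null sets; every
  other change of variables is arranged as a left translation, so the modular function never
  appears. Differentiation along arbitrary neighbourhoods of \<open>e\<close> is avoided by choosing
  a sequence of neighbourhoods whose exceptional sets have summable measure. Second countability
  supplies two tools: \<sigma>-compactness, which upgrades the regularity of \<open>\<mu>\<close> to
  inner regularity on all Borel sets, and a complete orthonormal sequence, which expands
  \<open>N(u)\<close> into products of functions of one variable and approximates \<open>T\<close>
  by finite rank operators.\<close>

lemma L2_measurable [measurable_dest]: "f \<in> L2 M \<Longrightarrow> f \<in> borel_measurable M"
  by (simp add: L2_def)

lemma L2_integrable: "f \<in> L2 M \<Longrightarrow> integrable M (\<lambda>x. (cmod (f x))\<^sup>2)"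
  by (simp add: L2_def)

lemma L2_bound:
  assumes "f \<in> borel_measurable M" "integrable M g" "\<And>x. (cmod (f x))\<^sup>2 \<le> g x"
  shows "f \<in> L2 M"
  using assms unfolding L2_def
  by (auto intro!: Bochner_Integration.integrable_bound[of M g] AE_I2 order_trans[OF assms(3) abs_ge_self])

lemma L2_add:
  assumes "f \<in> L2 M" "g \<in> L2 M"
  shows "(\<lambda>x. f x + g x) \<in> L2 M"
proof (rule L2_bound)
  show "integrable M (\<lambda>x. 2 * (cmod (f x))\<^sup>2 + 2 * (cmod (g x))\<^sup>2)"
    using assms by (simp add: L2_integrable)
  fix x
  have "(cmod (f x + g x))\<^sup>2 \<le> (cmod (f x) + cmod (g x))\<^sup>2"
    by (simp add: norm_triangle_ineq power_mono)
  also have "\<dots> \<le> 2 * (cmod (f x))\<^sup>2 + 2 * (cmod (g x))\<^sup>2"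
    using sum_squares_bound[of "cmod (f x)" "cmod (g x)"] by (simp add: power2_sum)
  finally show "(cmod (f x + g x))\<^sup>2 \<le> 2 * (cmod (f x))\<^sup>2 + 2 * (cmod (g x))\<^sup>2" .
qed (use assms in measurable)

lemma L2_mult_bounded:
  assumes "f \<in> L2 M" "a \<in> borel_measurable M" "\<And>x. cmod (a x) \<le> C"
  shows "(\<lambda>x. a x * f x) \<in> L2 M"
proof (rule L2_bound)
  show "integrable M (\<lambda>x. C\<^sup>2 * (cmod (f x))\<^sup>2)"
    using assms by (simp add: L2_integrable)
  show "(cmod (a x * f x))\<^sup>2 \<le> C\<^sup>2 * (cmod (f x))\<^sup>2" for x
    using assms(3)[of x] by (simp add: norm_mult power_mult_distrib mult_right_mono power_mono)
qed (use assms in measurable)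

lemma L2_scale: "f \<in> L2 M \<Longrightarrow> (\<lambda>x. c * f x) \<in> L2 M"
  by (rule L2_mult_bounded[where C = "cmod c"]) auto

lemma L2_zero: "(\<lambda>x. 0) \<in> L2 M"
  by (simp add: L2_def)

lemma L2_diff: "f \<in> L2 M \<Longrightarrow> g \<in> L2 M \<Longrightarrow> (\<lambda>x. f x - g x) \<in> L2 M"
  using L2_add[of f M "\<lambda>x. (-1) * g x"] L2_scale[of g M "-1"] by simp

lemma L2_sum: "(\<And>i. i \<in> I \<Longrightarrow> f i \<in> L2 M) \<Longrightarrow> (\<lambda>x. \<Sum>i\<in>I. f i x) \<in> L2 M"
  by (induction I rule: infinite_finite_induct) (auto simp: L2_zero L2_add)

lemma L2_indicator_mult:
  "f \<in> L2 M \<Longrightarrow> A \<in> sets M \<Longrightarrow> (\<lambda>x. indicator A x * f x) \<in> L2 M"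
  by (rule L2_mult_bounded[where C = 1]) (auto simp: indicator_def)

lemma L2_indicator:
  assumes "A \<in> sets M" "emeasure M A < \<infinity>"
  shows "(indicator A :: 'a \<Rightarrow> complex) \<in> L2 M"
proof (rule L2_bound)
  show "integrable M (indicator A :: 'a \<Rightarrow> real)"
    using assms by simp
qed (use assms in \<open>auto simp: indicator_def\<close>)

lemma borel_measurable_cnj [measurable]: "cnj \<in> borel_measurable borel"
  by (intro borel_measurable_continuous_onI continuous_intros)

section \<open>Inner products and the Cauchy-Schwarz inequality\<close>

lemma integrable_ip:
  assumes "f \<in> L2 M" "g \<in> L2 M"
  shows "integrable M (\<lambda>x. f x * cnj (g x))"
proof (rule Bochner_Integration.integrable_bound)
  show "integrable M (\<lambda>x. (cmod (f x))\<^sup>2 + (cmod (g x))\<^sup>2)"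
    using assms by (simp add: L2_integrable)
  show "AE x in M. norm (f x * cnj (g x)) \<le> norm ((cmod (f x))\<^sup>2 + (cmod (g x))\<^sup>2)"
  proof (rule AE_I2)
    fix x
    show "norm (f x * cnj (g x)) \<le> norm ((cmod (f x))\<^sup>2 + (cmod (g x))\<^sup>2)"
      using sum_squares_bound[of "cmod (f x)" "cmod (g x)"] mult_nonneg_nonneg[of "cmod (f x)" "cmod (g x)"]
      unfolding norm_mult complex_mod_cnj real_norm_def by linarith
  qed
qed (use assms in measurable)

lemma ip_add_left:
  "f \<in> L2 M \<Longrightarrow> g \<in> L2 M \<Longrightarrow> h \<in> L2 M \<Longrightarrow> ip M (\<lambda>x. f x + g x) h = ip M f h + ip M g h"
  unfolding ip_def by (simp add: distrib_right integrable_ip)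

lemma ip_scale_left: "ip M (\<lambda>x. c * f x) h = c * ip M f h"
  unfolding ip_def by (simp add: mult.assoc)

lemma ip_cnj: "cnj (ip M f g) = ip M g f"
  using Bochner_Integration.integral_cnj[of M "\<lambda>x. f x * cnj (g x)"] by (simp add: ip_def mult.commute)

lemma ip_scale_right: "ip M f (\<lambda>x. c * h x) = cnj c * ip M f h"
  by (subst (1 2) ip_cnj[symmetric]) (simp add: ip_scale_left)

lemma ip_add_right:
  "f \<in> L2 M \<Longrightarrow> g \<in> L2 M \<Longrightarrow> h \<in> L2 M \<Longrightarrow> ip M h (\<lambda>x. f x + g x) = ip M h f + ip M h g"
  by (subst (1 2 3) ip_cnj[symmetric]) (simp add: ip_add_left)

lemma ip_diff_left:
  "f \<in> L2 M \<Longrightarrow> g \<in> L2 M \<Longrightarrow> h \<in> L2 M \<Longrightarrow> ip M (\<lambda>x. f x - g x) h = ip M f h - ip M g h"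
  unfolding ip_def by (simp add: left_diff_distrib integrable_ip)

lemma ip_diff_right:
  "f \<in> L2 M \<Longrightarrow> g \<in> L2 M \<Longrightarrow> h \<in> L2 M \<Longrightarrow> ip M h (\<lambda>x. f x - g x) = ip M h f - ip M h g"
  by (subst (1 2 3) ip_cnj[symmetric]) (simp add: ip_diff_left)

lemma ip_sum_left:
  "(\<And>i. i \<in> I \<Longrightarrow> f i \<in> L2 M) \<Longrightarrow> h \<in> L2 M \<Longrightarrow>
    ip M (\<lambda>x. \<Sum>i\<in>I. f i x) h = (\<Sum>i\<in>I. ip M (f i) h)"
proof (induction I rule: infinite_finite_induct)
  case (insert i I)
  then show ?case by (simp add: ip_add_left L2_sum)
qed (simp_all add: ip_def)

lemma ip_zero_left [simp]: "ip M (\<lambda>x. 0) h = 0"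
  and ip_zero_right [simp]: "ip M h (\<lambda>x. 0) = 0"
  by (simp_all add: ip_def)

lemma ip_cong_AE:
  assumes "AE x in M. f x = f' x" "AE x in M. g x = g' x"
    and "f \<in> borel_measurable M" "g \<in> borel_measurable M"
    and "f' \<in> borel_measurable M" "g' \<in> borel_measurable M"
  shows "ip M f g = ip M f' g'"
  unfolding ip_def
proof (rule integral_cong_AE)
  show "AE x in M. f x * cnj (g x) = f' x * cnj (g' x)"
    using assms(1,2) by eventually_elim simp
qed (use assms(3-6) in measurable)

lemma l2norm_nonneg [simp]: "0 \<le> l2norm M f"
  by (simp add: l2norm_def)

lemma l2norm_power2: "(l2norm M f)\<^sup>2 = (\<integral>x. (cmod (f x))\<^sup>2 \<partial>M)"
  by (simp add: l2norm_def)

lemma ip_self: "ip M f f = of_real ((l2norm M f)\<^sup>2)"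
  unfolding ip_def l2norm_power2
  by (simp add: complex_norm_square[symmetric] integral_complex_of_real[symmetric]
      del: integral_complex_of_real of_real_power)

lemma l2norm_eq_0_iff: "f \<in> L2 M \<Longrightarrow> l2norm M f = 0 \<longleftrightarrow> (AE x in M. f x = 0)"
  by (simp add: l2norm_def integral_nonneg_eq_0_iff_AE L2_integrable)

lemma l2norm_scale: "l2norm M (\<lambda>x. c * f x) = cmod c * l2norm M f"
  by (simp add: l2norm_def norm_mult power_mult_distrib real_sqrt_mult)

text \<open>The version with absolute values inside the integral is kept because product kernels are
  later estimated in L^1.\<close>

lemma Cauchy_Schwarz_integral:
  assumes f: "f \<in> L2 M" and g: "g \<in> L2 M"
  shows "integrable M (\<lambda>x. cmod (f x) * cmod (g x))"
    and "(\<integral>x. cmod (f x) * cmod (g x) \<partial>M) \<le> l2norm M f * l2norm M g"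
proof -
  show int: "integrable M (\<lambda>x. cmod (f x) * cmod (g x))"
    using integrable_norm[OF integrable_ip[OF f g]] by (simp add: norm_mult)
  define a where "a = l2norm M f"
  define b where "b = l2norm M g"
  show "(\<integral>x. cmod (f x) * cmod (g x) \<partial>M) \<le> l2norm M f * l2norm M g"
  proof (cases "a = 0 \<or> b = 0")
    case True
    then have "AE x in M. cmod (f x) * cmod (g x) = 0"
      using l2norm_eq_0_iff[OF f] l2norm_eq_0_iff[OF g] by (auto simp: a_def b_def)
    then have "(\<integral>x. cmod (f x) * cmod (g x) \<partial>M) = 0"
      by (rule integral_eq_zero_AE)
    then show ?thesis by simp
  next
    case False
    then have ab: "a > 0" "b > 0"
      by (auto simp: a_def b_def less_le)
    \<comment> \<open>The weights \<open>b / a\<close> and \<open>a / b\<close> balance the two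
      squares, so that the integrated arithmetic-geometric inequality gives exactly
      \<open>a * b\<close>.\<close>
    have "(\<integral>x. cmod (f x) * cmod (g x) \<partial>M)
        \<le> (\<integral>x. (b / a * (cmod (f x))\<^sup>2 + a / b * (cmod (g x))\<^sup>2) / 2 \<partial>M)"
    proof (rule integral_mono[OF int])
      show "integrable M (\<lambda>x. (b / a * (cmod (f x))\<^sup>2 + a / b * (cmod (g x))\<^sup>2) / 2)"
        using f g by (simp add: L2_integrable)
      fix x
      have "0 \<le> (b * cmod (f x) - a * cmod (g x))\<^sup>2 / (2 * a * b)"
        using ab by simp
      also have "\<dots> = (b / a * (cmod (f x))\<^sup>2 + a / b * (cmod (g x))\<^sup>2) / 2 - cmod (f x) * cmod (g x)"
        using ab by (simp add: field_simps power2_eq_square)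
      finally show "cmod (f x) * cmod (g x) \<le> (b / a * (cmod (f x))\<^sup>2 + a / b * (cmod (g x))\<^sup>2) / 2"
        by simp
    qed
    also have "\<dots> = (b / a * a\<^sup>2 + a / b * b\<^sup>2) / 2"
      using f g by (simp add: L2_integrable a_def b_def l2norm_power2)
    also have "\<dots> = a * b"
      using ab by (simp add: power2_eq_square)
    finally show ?thesis
      by (simp add: a_def b_def)
  qed
qed

lemma Cauchy_Schwarz_ip:
  assumes "f \<in> L2 M" "g \<in> L2 M"
  shows "cmod (ip M f g) \<le> l2norm M f * l2norm M g"
proof -
  have "cmod (ip M f g) \<le> (\<integral>x. cmod (f x * cnj (g x)) \<partial>M)"
    unfolding ip_def by (rule integral_norm_bound)
  with Cauchy_Schwarz_integral(2)[OF assms] show ?thesis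
    by (simp add: norm_mult)
qed

lemma l2norm_add_power2:
  assumes "f \<in> L2 M" "g \<in> L2 M"
  shows "(l2norm M (\<lambda>x. f x + g x))\<^sup>2 = (l2norm M f)\<^sup>2 + 2 * Re (ip M f g) + (l2norm M g)\<^sup>2"
proof -
  have "complex_of_real ((l2norm M (\<lambda>x. f x + g x))\<^sup>2)
      = of_real ((l2norm M f)\<^sup>2) + (ip M f g + cnj (ip M f g)) + of_real ((l2norm M g)\<^sup>2)"
    using assms by (simp add: ip_self[symmetric] ip_add_left ip_add_right L2_add ip_cnj del: of_real_power)
  also have "ip M f g + cnj (ip M f g) = of_real (2 * Re (ip M f g))"
    by (rule complex_add_cnj)
  finally show ?thesis
    by (simp only: of_real_add[symmetric] of_real_eq_iff)
qed

lemma l2norm_triangle: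
  assumes "f \<in> L2 M" "g \<in> L2 M"
  shows "l2norm M (\<lambda>x. f x + g x) \<le> l2norm M f + l2norm M g"
proof (rule power2_le_imp_le)
  have "Re (ip M f g) \<le> l2norm M f * l2norm M g"
    using Cauchy_Schwarz_ip[OF assms] complex_Re_le_cmod order_trans by blast
  then show "(l2norm M (\<lambda>x. f x + g x))\<^sup>2 \<le> (l2norm M f + l2norm M g)\<^sup>2"
    unfolding l2norm_add_power2[OF assms] power2_sum by simp
qed simp

lemma l2norm_triangle_diff:
  assumes "f \<in> L2 M" "g \<in> L2 M" "h \<in> L2 M"
  shows "l2norm M (\<lambda>x. f x - h x) \<le> l2norm M (\<lambda>x. f x - g x) + l2norm M (\<lambda>x. g x - h x)"
  using l2norm_triangle[OF L2_diff[OF assms(1,2)] L2_diff[OF assms(2,3)]] by simp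

lemma l2norm_minus_commute: "l2norm M (\<lambda>x. f x - g x) = l2norm M (\<lambda>x. g x - f x)"
  by (simp add: l2norm_def norm_minus_commute)

lemma L2_dominated_convergence:
  assumes f: "f \<in> L2 M" and w: "integrable M w"
    and s: "\<And>n. s n \<in> L2 M" "\<And>n x. (cmod (s n x - f x))\<^sup>2 \<le> w x"
    and lim: "AE x in M. (\<lambda>n. s n x) \<longlonglongrightarrow> f x"
  shows "(\<lambda>n. l2norm M (\<lambda>x. s n x - f x)) \<longlonglongrightarrow> 0"
proof -
  have [measurable]: "f \<in> borel_measurable M" "s n \<in> borel_measurable M" for n
    using f s(1) by measurable
  have "(\<lambda>n. \<integral>x. (cmod (s n x - f x))\<^sup>2 \<partial>M) \<longlonglongrightarrow> (\<integral>x. 0 \<partial>M)"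
  proof (rule integral_dominated_convergence[where w = w])
    show "AE x in M. (\<lambda>n. (cmod (s n x - f x))\<^sup>2) \<longlonglongrightarrow> 0"
      using lim
    proof eventually_elim
      case (elim x)
      then have "(\<lambda>n. cmod (s n x - f x)) \<longlonglongrightarrow> 0"
        by (simp add: LIM_zero_iff tendsto_norm_zero)
      then show ?case
        using tendsto_power[of _ 0 sequentially 2] by simp
    qed
  qed (use w s in auto)
  then show ?thesis
    unfolding l2norm_def using tendsto_real_sqrt by force
qed

text \<open>Simple functions dominated by \<open>2 * cmod (f x)\<close> converge to \<open>f\<close>
  in norm. The closure case \<open>approx\<close> takes the place of a topology on L^2, so the rule
  applies to functions rather than to classes.\<close>

lemma L2_induct_indicator:
  assumes space: "space M = UNIV"
    and f: "f \<in> L2 M"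
    and ind: "\<And>A. A \<in> sets M \<Longrightarrow> emeasure M A < \<infinity> \<Longrightarrow> P (indicator A)"
    and add: "\<And>f g. f \<in> L2 M \<Longrightarrow> g \<in> L2 M \<Longrightarrow> P f \<Longrightarrow> P g \<Longrightarrow> P (\<lambda>x. f x + g x)"
    and scale: "\<And>f c. f \<in> L2 M \<Longrightarrow> P f \<Longrightarrow> P (\<lambda>x. c * f x)"
    and approx: "\<And>f. f \<in> L2 M \<Longrightarrow>
      (\<And>\<epsilon>. \<epsilon> > 0 \<Longrightarrow> \<exists>g\<in>L2 M. P g \<and> l2norm M (\<lambda>x. g x - f x) < \<epsilon>) \<Longrightarrow> P f"
  shows "P f"
proof -
  have [measurable]: "f \<in> borel_measurable M"
    using f by (rule L2_measurable)
  obtain s where s: "\<And>i. simple_function M (s i)"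
      "\<And>x. (\<lambda>i. s i x) \<longlonglongrightarrow> f x" "\<And>i x. cmod (s i x) \<le> 2 * cmod (f x)"
    using borel_measurable_implies_sequence_metric[of f M 0] space by auto
  have s_L2: "s i \<in> L2 M" for i
  proof (rule L2_bound)
    show "s i \<in> borel_measurable M"
      using s(1) by (rule borel_measurable_simple_function)
    show "integrable M (\<lambda>x. 4 * (cmod (f x))\<^sup>2)"
      using f by (simp add: L2_integrable)
    show "(cmod (s i x))\<^sup>2 \<le> 4 * (cmod (f x))\<^sup>2" for x
      using power_mono[OF s(3)[of i x], of 2] by (simp add: power_mult_distrib)
  qed
  have P0: "P (\<lambda>x. 0)"
    using scale[of "indicator {}" 0] ind[of "{}"] L2_indicator[of "{}" M] by simp
  have P_s: "P (s i)" for i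
  proof -
    define B where "B c = s i -` {c}" for c
    have B: "B c \<in> sets M" for c
      using simple_functionD(2)[OF s(1), of i "{c}"] space by (simp add: B_def)
    have level: "(\<lambda>x. c * indicator (B c) x) \<in> L2 M \<and> P (\<lambda>x. c * indicator (B c) x)" for c
    proof (cases "c = 0")
      case True
      then show ?thesis using P0 L2_zero by simp
    next
      case False
      \<comment> \<open>A level set of a nonzero value has finite measure, because its indicator is
        a scaled restriction of the square-integrable \<open>s i\<close>.\<close>
      have "(\<lambda>x. (1 / c) * (indicator (B c) x * s i x)) \<in> L2 M"
        by (intro L2_scale L2_indicator_mult s_L2 B)
      also have "(\<lambda>x. (1 / c) * (indicator (B c) x * s i x)) = indicator (B c)"
        using False by (auto simp: B_def indicator_def)
      finally have "integrable M (\<lambda>x. (cmod (indicator (B c) x))\<^sup>2)"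
        by (rule L2_integrable)
      also have "(\<lambda>x. (cmod (indicator (B c) x))\<^sup>2) = (indicator (B c) :: 'a \<Rightarrow> real)"
        by (auto simp: indicator_def)
      finally have "emeasure M (B c) < \<infinity>"
        using B by (simp add: integrable_indicator_iff space)
      then show ?thesis
        using scale[OF L2_indicator ind, of "B c" c] L2_scale[OF L2_indicator, of "B c" M c] B by auto
    qed
    have "(\<lambda>x. \<Sum>c\<in>C. c * indicator (B c) x) \<in> L2 M \<and> P (\<lambda>x. \<Sum>c\<in>C. c * indicator (B c) x)"
      if "finite C" for C
      using that
    proof induction
      case empty
      then show ?case using P0 L2_zero by simp
    next
      case (insert c C)
      have "(\<lambda>x. \<Sum>c\<in>insert c C. c * indicator (B c) x)
          = (\<lambda>x. c * indicator (B c) x + (\<Sum>c\<in>C. c * indicator (B c) x))"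
        using insert.hyps by (intro ext sum.insert)
      then show ?case
        using insert.IH level[of c] by (simp only: L2_add add simp_thms)
    qed
    moreover have "finite (range (s i))"
      using simple_functionD(1)[OF s(1), of i] space by simp
    moreover have "s i = (\<lambda>x. \<Sum>c\<in>range (s i). c * indicator (B c) x)"
    proof
      fix x
      have "(\<Sum>c\<in>range (s i). c * indicator (B c) x) = (\<Sum>c\<in>range (s i). if c = s i x then s i x else 0)"
        by (rule sum.cong) (auto simp: B_def indicator_def)
      with \<open>finite (range (s i))\<close> show "s i x = (\<Sum>c\<in>range (s i). c * indicator (B c) x)"
        by simp
    qed
    ultimately show ?thesis by metis
  qed
  have lim: "(\<lambda>n. l2norm M (\<lambda>x. s n x - f x)) \<longlonglongrightarrow> 0"
  proof (rule L2_dominated_convergence[OF f])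
    \<comment> \<open>The factor 9 is the square of 3: \<open>s n\<close> is bounded by twice
      \<open>f\<close>, so the difference is bounded by three times \<open>f\<close>.\<close>
    show "integrable M (\<lambda>x. 9 * (cmod (f x))\<^sup>2)"
      using f by (simp add: L2_integrable)
    show "(cmod (s n x - f x))\<^sup>2 \<le> 9 * (cmod (f x))\<^sup>2" for n x
    proof -
      have "cmod (s n x - f x) \<le> 3 * cmod (f x)"
        using s(3)[of n x] norm_triangle_ineq4[of "s n x" "f x"] by linarith
      from power_mono[OF this, of 2] show ?thesis by (simp add: power_mult_distrib)
    qed
  qed (use s_L2 s(2) in auto)
  show ?thesis
  proof (rule approx[OF f])
    fix \<epsilon> :: real assume "\<epsilon> > 0"
    from order_tendstoD(2)[OF lim this] show "\<exists>g\<in>L2 M. P g \<and> l2norm M (\<lambda>x. g x - f x) < \<epsilon>"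
      using s_L2 P_s by (auto simp: eventually_sequentially)
  qed
qed

section \<open>Orthonormal expansions and bounded operators\<close>

definition orthonormal_upto :: "'a measure \<Rightarrow> (nat \<Rightarrow> 'a \<Rightarrow> complex) \<Rightarrow> nat \<Rightarrow> bool" where
  "orthonormal_upto M e n \<longleftrightarrow> (\<forall>i<n. e i \<in> L2 M \<and> l2norm M (e i) \<in> {0, 1}) \<and>
     (\<forall>i<n. \<forall>j<n. i \<noteq> j \<longrightarrow> ip M (e i) (e j) = 0)"

definition residual :: "'a measure \<Rightarrow> (nat \<Rightarrow> 'a \<Rightarrow> complex) \<Rightarrow> nat \<Rightarrow> ('a \<Rightarrow> complex) \<Rightarrow> 'a \<Rightarrow> complex" where
  "residual M e n f = (\<lambda>x. f x - (\<Sum>i<n. ip M f (e i) * e i x))"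

lemma orthonormal_upto_mono: "orthonormal_upto M e n \<Longrightarrow> k \<le> n \<Longrightarrow> orthonormal_upto M e k"
  unfolding orthonormal_upto_def by auto

lemma residual_L2: "orthonormal_upto M e n \<Longrightarrow> f \<in> L2 M \<Longrightarrow> residual M e n f \<in> L2 M"
  unfolding residual_def orthonormal_upto_def by (intro L2_diff L2_sum L2_scale) auto

text \<open>For a null vector the factor \<open>ip M (e i) (e i)\<close> is 0 rather than 1, but
  then Cauchy-Schwarz makes the coefficient vanish as well. This is why the usual expansion formulas
  survive null entries.\<close>

lemma ip_mult_self_orthonormal:
  assumes "orthonormal_upto M e n" "i < n" "f \<in> L2 M"
  shows "ip M f (e i) * ip M (e i) (e i) = ip M f (e i)"
proof (cases "l2norm M (e i) = 0")
  case True
  then show ?thesis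
    using Cauchy_Schwarz_ip[OF assms(3), of "e i"] assms unfolding orthonormal_upto_def by auto
next
  case False
  then show ?thesis
    using assms unfolding ip_self orthonormal_upto_def by auto
qed

lemma ip_residual_left:
  assumes e: "orthonormal_upto M e n" and f: "f \<in> L2 M" and g: "g \<in> L2 M"
  shows "ip M (residual M e n f) g = ip M f g - (\<Sum>i<n. ip M f (e i) * ip M (e i) g)"
proof -
  have "(\<lambda>x. ip M f (e i) * e i x) \<in> L2 M" if "i < n" for i
    using e that unfolding orthonormal_upto_def by (auto intro: L2_scale)
  then show ?thesis
    using ip_diff_left[OF f L2_sum g, of "{..<n}" "\<lambda>i x. ip M f (e i) * e i x"]
      ip_sum_left[of "{..<n}" "\<lambda>i x. ip M f (e i) * e i x" M g] g
    unfolding residual_def by (simp add: ip_scale_left)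
qed

lemma ip_residual_basis:
  assumes e: "orthonormal_upto M e n" and f: "f \<in> L2 M" and j: "j < n"
  shows "ip M (residual M e n f) (e j) = 0"
proof -
  have "e j \<in> L2 M"
    using e j by (simp add: orthonormal_upto_def)
  moreover have "(\<Sum>i<n. ip M f (e i) * ip M (e i) (e j)) = (\<Sum>i<n. if i = j then ip M f (e j) else 0)"
  proof (rule sum.cong)
    fix i assume "i \<in> {..<n}"
    then show "ip M f (e i) * ip M (e i) (e j) = (if i = j then ip M f (e j) else 0)"
      using ip_mult_self_orthonormal[OF e j f] e j by (auto simp: orthonormal_upto_def)
  qed simp
  ultimately show ?thesis
    using j by (simp add: ip_residual_left[OF e f])
qed

lemma l2norm_residual_power2:
  assumes e: "orthonormal_upto M e n" and f: "f \<in> L2 M"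
  shows "(l2norm M (residual M e n f))\<^sup>2 = (l2norm M f)\<^sup>2 - (\<Sum>i<n. (cmod (ip M f (e i)))\<^sup>2)"
proof -
  let ?r = "residual M e n f"
  have r: "?r \<in> L2 M"
    by (rule residual_L2[OF e f])
  have eL: "e i \<in> L2 M" if "i < n" for i
    using e that by (simp add: orthonormal_upto_def)
  have "ip M ?r ?r = cnj (ip M f ?r - (\<Sum>i<n. ip M f (e i) * ip M (e i) ?r))"
    by (subst ip_cnj[symmetric], subst ip_residual_left[OF e f r]) (rule refl)
  also have "(\<Sum>i<n. ip M f (e i) * ip M (e i) ?r) = 0"
  proof (rule sum.neutral, safe)
    fix i assume "i < n"
    from ip_residual_basis[OF e f this] have "ip M (e i) ?r = 0"
      by (metis ip_cnj complex_cnj_zero)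
    then show "ip M f (e i) * ip M (e i) ?r = 0" by simp
  qed
  finally have "ip M ?r ?r = ip M ?r f"
    by (simp add: ip_cnj)
  also have "\<dots> = ip M f f - (\<Sum>i<n. ip M f (e i) * cnj (ip M f (e i)))"
    unfolding ip_residual_left[OF e f f] ip_cnj ..
  also have "\<dots> = of_real ((l2norm M f)\<^sup>2 - (\<Sum>i<n. (cmod (ip M f (e i)))\<^sup>2))"
    unfolding ip_self complex_norm_square[symmetric] by simp
  finally show ?thesis
    unfolding ip_self of_real_eq_iff .
qed

lemma Bessel_inequality:
  "orthonormal_upto M e n \<Longrightarrow> f \<in> L2 M \<Longrightarrow> (\<Sum>i<n. (cmod (ip M f (e i)))\<^sup>2) \<le> (l2norm M f)\<^sup>2"
  using l2norm_residual_power2[of M e n f] zero_le_power2[of "l2norm M (residual M e n f)"] by linarith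

lemma l2norm_residual_le:
  assumes "orthonormal_upto M e n" "f \<in> L2 M"
  shows "l2norm M (residual M e n f) \<le> l2norm M f"
proof (rule power2_le_imp_le)
  have "0 \<le> (\<Sum>i<n. (cmod (ip M f (e i)))\<^sup>2)"
    by (simp add: sum_nonneg)
  then show "(l2norm M (residual M e n f))\<^sup>2 \<le> (l2norm M f)\<^sup>2"
    using l2norm_residual_power2[OF assms] by linarith
qed simp

lemma l2norm_residual_antimono:
  assumes "orthonormal_upto M e n" "f \<in> L2 M" "k \<le> n"
  shows "l2norm M (residual M e n f) \<le> l2norm M (residual M e k f)"
proof (rule power2_le_imp_le)
  have "(\<Sum>i<k. (cmod (ip M f (e i)))\<^sup>2) \<le> (\<Sum>i<n. (cmod (ip M f (e i)))\<^sup>2)"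
    using assms(3) by (intro sum_mono2) auto
  then show "(l2norm M (residual M e n f))\<^sup>2 \<le> (l2norm M (residual M e k f))\<^sup>2"
    using l2norm_residual_power2[OF assms(1,2)] 
      l2norm_residual_power2[OF orthonormal_upto_mono[OF assms(1,3)] assms(2)] by linarith
qed simp

lemma residual_add:
  assumes "orthonormal_upto M e n" "f \<in> L2 M" "g \<in> L2 M"
  shows "residual M e n (\<lambda>x. f x + g x) = (\<lambda>x. residual M e n f x + residual M e n g x)"
proof -
  have "(\<Sum>i<n. ip M (\<lambda>x. f x + g x) (e i) * e i x)
      = (\<Sum>i<n. ip M f (e i) * e i x) + (\<Sum>i<n. ip M g (e i) * e i x)" for x
    unfolding sum.distrib[symmetric] using assms
    by (intro sum.cong) (auto simp: orthonormal_upto_def ip_add_left distrib_right)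
  then show ?thesis
    by (simp add: residual_def algebra_simps)
qed

lemma residual_scale: "residual M e n (\<lambda>x. c * f x) = (\<lambda>x. c * residual M e n f x)"
  by (simp add: residual_def ip_scale_left right_diff_distrib sum_distrib_left mult.assoc)

text \<open>Linearly dependent entries become (almost everywhere) zero because \<^term>\<open>inverse 0 = 0\<close>.\<close>

fun gram_schmidt :: "'a measure \<Rightarrow> (nat \<Rightarrow> 'a \<Rightarrow> complex) \<Rightarrow> nat \<Rightarrow> 'a \<Rightarrow> complex" where
  "gram_schmidt M d n =
    (let r = (\<lambda>x. d n x - (\<Sum>i<n. ip M (d n) (gram_schmidt M d i) * gram_schmidt M d i x))
     in (\<lambda>x. of_real (inverse (l2norm M r)) * r x))"

declare gram_schmidt.simps [simp del]

lemma gram_schmidt_eq: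
  "gram_schmidt M d n =
    (\<lambda>x. of_real (inverse (l2norm M (residual M (gram_schmidt M d) n (d n))))
       * residual M (gram_schmidt M d) n (d n) x)"
  by (subst gram_schmidt.simps) (simp add: residual_def Let_def)

lemma orthonormal_gram_schmidt:
  assumes d: "\<And>n. d n \<in> L2 M"
  shows "orthonormal_upto M (gram_schmidt M d) n"
proof (induction n)
  case 0
  then show ?case by (simp add: orthonormal_upto_def)
next
  case (Suc n)
  let ?e = "gram_schmidt M d"
  let ?r = "residual M ?e n (d n)"
  have r: "?r \<in> L2 M"
    using residual_L2[OF Suc d] .
  have en: "?e n \<in> L2 M"
    unfolding gram_schmidt_eq[of M d n] by (rule L2_scale[OF r])
  have norm: "l2norm M (?e n) \<in> {0, 1}"
    unfolding gram_schmidt_eq[of M d n] l2norm_scale by (cases "l2norm M ?r = 0") (auto simp: norm_inverse)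
  have orth: "ip M (?e n) (?e i) = 0" if "i < n" for i
    unfolding gram_schmidt_eq[of M d n] ip_scale_left using ip_residual_basis[OF Suc d that] by simp
  then have orth': "ip M (?e i) (?e n) = 0" if "i < n" for i
    using that by (metis ip_cnj complex_cnj_zero)
  show ?case
    using Suc en norm orth orth' unfolding orthonormal_upto_def by (auto simp: less_Suc_eq)
qed

text \<open>If the residual \<open>r\<close> of \<open>d n\<close> has norm
  \<open>\<rho> \<noteq> 0\<close>, the new vector is \<open>r / \<rho>\<close> and the coefficient
  of \<open>d n\<close> along it is \<open>\<rho>\<close>, so subtracting that term removes
  \<open>r\<close> completely. If \<open>\<rho> = 0\<close>, the residual was null already.\<close>

lemma residual_gram_schmidt:
  assumes d: "\<And>n. d n \<in> L2 M"
  shows "l2norm M (residual M (gram_schmidt M d) (Suc n) (d n)) = 0"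
proof -
  let ?e = "gram_schmidt M d"
  let ?r = "residual M ?e n (d n)"
  note on = orthonormal_gram_schmidt[OF d]
  have r: "?r \<in> L2 M"
    using residual_L2[OF on d] .
  define \<rho> where "\<rho> = l2norm M ?r"
  have en: "?e n = (\<lambda>x. of_real (inverse \<rho>) * ?r x)"
    using gram_schmidt_eq[of M d n] by (simp add: \<rho>_def)
  have orth: "ip M (?e i) (?e n) = 0" if "i < n" for i
    using on[where n = "Suc n"] that by (auto simp: orthonormal_upto_def)
  have enL: "?e n \<in> L2 M"
    using on[where n = "Suc n"] by (auto simp: orthonormal_upto_def)
  have "ip M ?r (?e n) = ip M (d n) (?e n)"
    unfolding ip_residual_left[OF on d enL] using orth by simp
  moreover have "ip M ?r (?e n) = of_real (inverse \<rho> * \<rho>\<^sup>2)"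
    unfolding en ip_scale_right ip_self \<rho>_def by simp
  moreover have "inverse \<rho> * \<rho>\<^sup>2 = \<rho>"
    by (cases "\<rho> = 0") (simp_all add: power2_eq_square)
  ultimately have c: "ip M (d n) (?e n) = of_real \<rho>"
    by simp
  have "residual M ?e (Suc n) (d n) = (\<lambda>x. ?r x - of_real \<rho> * ?e n x)"
    by (simp add: residual_def c[symmetric] algebra_simps)
  also have "\<dots> = (\<lambda>x. of_real (1 - \<rho> * inverse \<rho>) * ?r x)"
    unfolding en by (simp add: algebra_simps)
  finally show ?thesis
    by (cases "\<rho> = 0") (simp_all add: l2norm_scale \<rho>_def[symmetric], simp_all add: l2norm_def)
qed

text \<open>A Hilbert basis possibly interspersed with null vectors. Completeness is stated as
  convergence of the partial expansions, the form from which Parseval's identity and the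
  approximation by finite rank operators are read off.\<close>

definition complete_orthonormal :: "'a measure \<Rightarrow> (nat \<Rightarrow> 'a \<Rightarrow> complex) \<Rightarrow> bool" where
  "complete_orthonormal M e \<longleftrightarrow> (\<forall>n. orthonormal_upto M e n) \<and>
     (\<forall>f\<in>L2 M. (\<lambda>n. l2norm M (residual M e n f)) \<longlonglongrightarrow> 0)"

text \<open>Taking residuals is linear and does not increase norms, so the functions with convergent
  expansion form a closed set.\<close>

lemma residual_tendsto_approx:
  assumes e: "\<And>n. orthonormal_upto M e n" and f: "f \<in> L2 M"
    and approx: "\<And>\<epsilon>. \<epsilon> > 0 \<Longrightarrow> \<exists>g\<in>L2 M. (\<lambda>n. l2norm M (residual M e n g)) \<longlonglongrightarrow> 0 \<and> l2norm M (\<lambda>x. g x - f x) < \<epsilon>"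
  shows "(\<lambda>n. l2norm M (residual M e n f)) \<longlonglongrightarrow> 0"
proof (rule tendstoI)
  fix \<epsilon> :: real assume "\<epsilon> > 0"
  then obtain g where g: "g \<in> L2 M" "(\<lambda>n. l2norm M (residual M e n g)) \<longlonglongrightarrow> 0"
      "l2norm M (\<lambda>x. g x - f x) < \<epsilon> / 2"
    using approx[of "\<epsilon> / 2"] by auto
  have "eventually (\<lambda>n. l2norm M (residual M e n g) < \<epsilon> / 2) sequentially"
    by (intro order_tendstoD(2)[OF g(2)]) (use \<open>\<epsilon> > 0\<close> in simp)
  then show "eventually (\<lambda>n. dist (l2norm M (residual M e n f)) 0 < \<epsilon>) sequentially"
  proof eventually_elim
    case (elim n)
    have fg: "(\<lambda>x. f x - g x) \<in> L2 M"
      using f g(1) by (rule L2_diff)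
    have "residual M e n f = (\<lambda>x. residual M e n g x + residual M e n (\<lambda>x. f x - g x) x)"
      using residual_add[OF e g(1) fg, of n] by simp
    then have "l2norm M (residual M e n f)
        \<le> l2norm M (residual M e n g) + l2norm M (residual M e n (\<lambda>x. f x - g x))"
      using l2norm_triangle[OF residual_L2[OF e g(1)] residual_L2[OF e fg], of n n] by simp
    also have "l2norm M (residual M e n (\<lambda>x. f x - g x)) \<le> l2norm M (\<lambda>x. f x - g x)"
      by (rule l2norm_residual_le[OF e fg])
    finally show ?case
      using elim g(3) by (simp add: l2norm_minus_commute[of M f g])
  qed
qed

lemma residual_tendsto_add:
  assumes e: "\<And>n. orthonormal_upto M e n" and fg: "f \<in> L2 M" "g \<in> L2 M"
    and lim: "(\<lambda>n. l2norm M (residual M e n f)) \<longlonglongrightarrow> 0" "(\<lambda>n. l2norm M (residual M e n g)) \<longlonglongrightarrow> 0"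
  shows "(\<lambda>n. l2norm M (residual M e n (\<lambda>x. f x + g x))) \<longlonglongrightarrow> 0"
proof (rule tendsto_sandwich[OF _ _ tendsto_const])
  show "(\<lambda>n. l2norm M (residual M e n f) + l2norm M (residual M e n g)) \<longlonglongrightarrow> 0"
    using tendsto_add[OF lim] by simp
  show "\<forall>\<^sub>F n in sequentially. l2norm M (residual M e n (\<lambda>x. f x + g x))
      \<le> l2norm M (residual M e n f) + l2norm M (residual M e n g)"
    using residual_add[OF e fg] l2norm_triangle[OF residual_L2[OF e fg(1)] residual_L2[OF e fg(2)]] by simp
qed auto

lemma residual_tendsto_scale:
  assumes "(\<lambda>n. l2norm M (residual M e n f)) \<longlonglongrightarrow> 0"
  shows "(\<lambda>n. l2norm M (residual M e n (\<lambda>x. c * f x))) \<longlonglongrightarrow> 0"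
  unfolding residual_scale l2norm_scale by (rule tendsto_mult_right_zero[OF assms])

lemma residual_gram_schmidt_tendsto:
  assumes d: "\<And>n. d n \<in> L2 M"
  shows "(\<lambda>n. l2norm M (residual M (gram_schmidt M d) n (d k))) \<longlonglongrightarrow> 0"
proof (rule tendsto_eventually)
  show "\<forall>\<^sub>F n in sequentially. l2norm M (residual M (gram_schmidt M d) n (d k)) = 0"
    unfolding eventually_sequentially
  proof (intro exI allI impI)
    fix n assume "Suc k \<le> n"
    then have "l2norm M (residual M (gram_schmidt M d) n (d k))
        \<le> l2norm M (residual M (gram_schmidt M d) (Suc k) (d k))"
      by (intro l2norm_residual_antimono orthonormal_gram_schmidt d)
    then show "l2norm M (residual M (gram_schmidt M d) n (d k)) = 0"
      using residual_gram_schmidt[where d = d and n = k, OF d]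
        l2norm_nonneg[of M "residual M (gram_schmidt M d) n (d k)"] by linarith
  qed
qed

lemma complete_orthonormal_L2: "complete_orthonormal M e \<Longrightarrow> e i \<in> L2 M"
  using lessI unfolding complete_orthonormal_def orthonormal_upto_def by blast

lemma complete_orthonormal_upto: "complete_orthonormal M e \<Longrightarrow> orthonormal_upto M e n"
  unfolding complete_orthonormal_def by blast

lemma Parseval_sums:
  assumes e: "complete_orthonormal M e" and f: "f \<in> L2 M" and g: "g \<in> L2 M"
  shows "(\<lambda>i. ip M f (e i) * cnj (ip M g (e i))) sums ip M f g"
proof -
  have on: "orthonormal_upto M e n" for n
    using e by (rule complete_orthonormal_upto)
  have lim: "(\<lambda>n. ip M (residual M e n f) g) \<longlonglongrightarrow> 0"
  proof (rule Lim_null_comparison)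
    show "\<forall>\<^sub>F n in sequentially. norm (ip M (residual M e n f) g) \<le> l2norm M (residual M e n f) * l2norm M g"
      using Cauchy_Schwarz_ip[OF residual_L2[OF on f] g] by simp
    show "(\<lambda>n. l2norm M (residual M e n f) * l2norm M g) \<longlonglongrightarrow> 0"
      using e f unfolding complete_orthonormal_def by (intro tendsto_mult_left_zero) auto
  qed
  have "(\<lambda>n. \<Sum>i<n. ip M f (e i) * cnj (ip M g (e i))) = (\<lambda>n. ip M f g - ip M (residual M e n f) g)"
    unfolding ip_residual_left[OF on f g] ip_cnj by simp
  then show ?thesis
    using tendsto_diff[OF tendsto_const lim, of "ip M f g"] by (simp add: sums_def)
qed

section \<open>Bounded operators tested through inner products\<close>

lemma bop_L2: "bop M T \<Longrightarrow> f \<in> L2 M \<Longrightarrow> T f \<in> L2 M"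
  by (simp add: bop_def)

lemma bop_bounded:
  assumes "bop M T"
  obtains C where "C \<ge> 0" "\<And>f. f \<in> L2 M \<Longrightarrow> l2norm M (T f) \<le> C * l2norm M f"
proof -
  obtain C where C: "\<forall>f\<in>L2 M. l2norm M (T f) \<le> C * l2norm M f"
    using assms by (auto simp: bop_def)
  show thesis
  proof (rule that[of "\<bar>C\<bar>"])
    fix f assume "f \<in> L2 M"
    then have "l2norm M (T f) \<le> C * l2norm M f"
      using C by blast
    also have "\<dots> \<le> \<bar>C\<bar> * l2norm M f"
      by (intro mult_right_mono) auto
    finally show "l2norm M (T f) \<le> \<bar>C\<bar> * l2norm M f" .
  qed simp
qed

text \<open>The exceptional null set in the linearity of \<open>T\<close> depends on the functions
  and scalars; pairing with \<open>h\<close> absorbs it.\<close>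

lemma ip_bop_lincomb:
  assumes T: "bop M T" and "f \<in> L2 M" "g \<in> L2 M" "h \<in> L2 M"
  shows "ip M (T (\<lambda>x. a * f x + b * g x)) h = a * ip M (T f) h + b * ip M (T g) h"
proof -
  have [measurable]: "T f \<in> borel_measurable M" "T g \<in> borel_measurable M"
      "T (\<lambda>x. a * f x + b * g x) \<in> borel_measurable M" "h \<in> borel_measurable M"
    using assms by (simp_all add: L2_measurable bop_L2 L2_add L2_scale)
  have "AE x in M. T (\<lambda>x. a * f x + b * g x) x = a * T f x + b * T g x"
    using assms unfolding bop_def by blast
  then have "ip M (T (\<lambda>x. a * f x + b * g x)) h = ip M (\<lambda>x. a * T f x + b * T g x) h"
    by (intro ip_cong_AE) auto
  then show ?thesis
    using assms by (simp add: ip_add_left ip_scale_left L2_scale bop_L2)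
qed

lemma ip_bop_add:
  "bop M T \<Longrightarrow> f \<in> L2 M \<Longrightarrow> g \<in> L2 M \<Longrightarrow> h \<in> L2 M \<Longrightarrow>
    ip M (T (\<lambda>x. f x + g x)) h = ip M (T f) h + ip M (T g) h"
  using ip_bop_lincomb[of M T f g h 1 1] by simp

lemma ip_bop_diff:
  "bop M T \<Longrightarrow> f \<in> L2 M \<Longrightarrow> g \<in> L2 M \<Longrightarrow> h \<in> L2 M \<Longrightarrow>
    ip M (T (\<lambda>x. f x - g x)) h = ip M (T f) h - ip M (T g) h"
  using ip_bop_lincomb[of M T f g h 1 "-1"] by simp

lemma ip_bop_scale:
  "bop M T \<Longrightarrow> f \<in> L2 M \<Longrightarrow> h \<in> L2 M \<Longrightarrow> ip M (T (\<lambda>x. c * f x)) h = c * ip M (T f) h"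
  using ip_bop_lincomb[of M T f f h c 0] by simp

lemma ip_bop_zero: "bop M T \<Longrightarrow> h \<in> L2 M \<Longrightarrow> ip M (T (\<lambda>x. 0)) h = 0"
  using ip_bop_scale[of M T "\<lambda>x. 0" h 0] by (simp add: L2_zero)

lemma ip_bop_sum:
  assumes "bop M T" "\<And>i. i \<in> I \<Longrightarrow> f i \<in> L2 M" "h \<in> L2 M"
  shows "ip M (T (\<lambda>x. \<Sum>i\<in>I. f i x)) h = (\<Sum>i\<in>I. ip M (T (f i)) h)"
  using assms(2)
  by (induction I rule: infinite_finite_induct) 
    (simp_all add: ip_bop_zero ip_bop_add[OF assms(1)] L2_sum assms(1,3))

lemma ip_bop_bound:
  assumes "bop M T" "\<And>f. f \<in> L2 M \<Longrightarrow> l2norm M (T f) \<le> C * l2norm M f" "f \<in> L2 M" "g \<in> L2 M"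
  shows "cmod (ip M (T f) g) \<le> C * l2norm M f * l2norm M g"
  using Cauchy_Schwarz_ip[OF bop_L2[OF assms(1,3)] assms(4)] assms(2)[OF assms(3)]
  by (meson l2norm_nonneg mult_right_mono order_trans)

lemma ip_bop_tendsto_left:
  assumes T: "bop M T" and L: "\<And>n. s n \<in> L2 M" "f \<in> L2 M" "g \<in> L2 M"
    and lim: "(\<lambda>n. l2norm M (\<lambda>x. s n x - f x)) \<longlonglongrightarrow> 0"
  shows "(\<lambda>n. ip M (T (s n)) g) \<longlonglongrightarrow> ip M (T f) g"
proof -
  obtain C where C: "C \<ge> 0" "\<And>f. f \<in> L2 M \<Longrightarrow> l2norm M (T f) \<le> C * l2norm M f"
    using bop_bounded[OF T] by blast
  have "(\<lambda>n. ip M (T (s n)) g - ip M (T f) g) \<longlonglongrightarrow> 0"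
  proof (rule Lim_null_comparison)
    show "\<forall>\<^sub>F n in sequentially. norm (ip M (T (s n)) g - ip M (T f) g)
        \<le> C * l2norm M (\<lambda>x. s n x - f x) * l2norm M g"
      using ip_bop_bound[OF T C(2) L2_diff[OF L(1,2)] L(3)] ip_bop_diff[OF T L(1,2,3)] by simp
    show "(\<lambda>n. C * l2norm M (\<lambda>x. s n x - f x) * l2norm M g) \<longlonglongrightarrow> 0"
      by (intro tendsto_mult_left_zero tendsto_mult_right_zero lim)
  qed
  then show ?thesis
    by (rule LIM_zero_cancel)
qed

lemma ip_tendsto_right:
  assumes L: "\<And>n. s n \<in> L2 M" "g \<in> L2 M" "f \<in> L2 M"
    and lim: "(\<lambda>n. l2norm M (\<lambda>x. s n x - g x)) \<longlonglongrightarrow> 0"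
  shows "(\<lambda>n. ip M f (s n)) \<longlonglongrightarrow> ip M f g"
proof -
  have "(\<lambda>n. ip M f (s n) - ip M f g) \<longlonglongrightarrow> 0"
  proof (rule Lim_null_comparison)
    show "\<forall>\<^sub>F n in sequentially. norm (ip M f (s n) - ip M f g) \<le> l2norm M f * l2norm M (\<lambda>x. s n x - g x)"
      using Cauchy_Schwarz_ip[OF L(3) L2_diff[OF L(1,2)]] ip_diff_right[OF L(1,2,3)] by simp
    show "(\<lambda>n. l2norm M f * l2norm M (\<lambda>x. s n x - g x)) \<longlonglongrightarrow> 0"
      by (intro tendsto_mult_right_zero lim)
  qed
  then show ?thesis
    by (rule LIM_zero_cancel)
qed

text \<open>The weak form of \<open>M_B T M_A = 0\<close>. It is free of almost-everywhere
  statements, so finite unions and limits can be handled by plain algebra.\<close>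

definition vanishes_on :: "'a measure \<Rightarrow> 'a op \<Rightarrow> 'a set \<Rightarrow> 'a set \<Rightarrow> bool" where
  "vanishes_on M T A B \<longleftrightarrow>
     (\<forall>f\<in>L2 M. \<forall>g\<in>L2 M. ip M (T (\<lambda>x. indicator A x * f x)) (\<lambda>x. indicator B x * g x) = 0)"

lemma vanishes_on_iff_AE:
  assumes T: "bop M T" and A: "A \<in> sets M" and B: "B \<in> sets M"
  shows "vanishes_on M T A B \<longleftrightarrow>
    (\<forall>f\<in>L2 M. AE x in M. indicator B x * T (\<lambda>y. indicator A y * f y) x = 0)"
proof safe
  fix f assume v: "vanishes_on M T A B" and f: "f \<in> L2 M"
  let ?h = "T (\<lambda>y. indicator A y * f y)"
  have h: "?h \<in> L2 M"
    using f A T by (simp add: bop_L2 L2_indicator_mult)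
  \<comment> \<open>The image \<open>?h\<close> itself serves as the second test function, which
    turns the weak condition into a vanishing norm.\<close>
  have "ip M (\<lambda>x. indicator B x * ?h x) (\<lambda>x. indicator B x * ?h x) = ip M ?h (\<lambda>x. indicator B x * ?h x)"
    unfolding ip_def by (intro Bochner_Integration.integral_cong) (auto simp: indicator_def)
  also have "\<dots> = 0"
    using v f h by (simp add: vanishes_on_def)
  finally have "l2norm M (\<lambda>x. indicator B x * ?h x) = 0"
    by (simp add: ip_self)
  then show "AE x in M. indicator B x * ?h x = 0"
    using l2norm_eq_0_iff[OF L2_indicator_mult[OF h B]] by blast
next
  assume v: "\<forall>f\<in>L2 M. AE x in M. indicator B x * T (\<lambda>y. indicator A y * f y) x = 0"
  show "vanishes_on M T A B"
    unfolding vanishes_on_def ip_def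
  proof safe
    fix f g assume "f \<in> L2 M" "g \<in> L2 M"
    have "AE x in M. indicator B x * T (\<lambda>y. indicator A y * f y) x = 0"
      using v \<open>f \<in> L2 M\<close> by blast
    then have "AE x in M. T (\<lambda>y. indicator A y * f y) x * cnj (indicator B x * g x) = 0"
      by eventually_elim (auto simp: indicator_def split: if_splits)
    then show "(\<integral>x. T (\<lambda>y. indicator A y * f y) x * cnj (indicator B x * g x) \<partial>M) = 0"
      by (rule integral_eq_zero_AE)
  qed
qed

lemma vanishes_on_mono:
  assumes v: "vanishes_on M T A B" and sub: "A' \<subseteq> A" "B' \<subseteq> B" and s: "A' \<in> sets M" "B' \<in> sets M"
  shows "vanishes_on M T A' B'"
  unfolding vanishes_on_def
proof safe
  fix f g assume fg: "f \<in> L2 M" "g \<in> L2 M"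
  have "(\<lambda>x. indicator A' x * f x) = (\<lambda>x. indicator A x * (indicator A' x * f x))"
    and "(\<lambda>x. indicator B' x * g x) = (\<lambda>x. indicator B x * (indicator B' x * g x))"
    using sub by (auto simp: indicator_def fun_eq_iff)
  moreover have "ip M (T (\<lambda>x. indicator A x * (indicator A' x * f x)))
      (\<lambda>x. indicator B x * (indicator B' x * g x)) = 0"
    using v[unfolded vanishes_on_def, rule_format, OF L2_indicator_mult[OF fg(1) s(1)]
        L2_indicator_mult[OF fg(2) s(2)]] .
  ultimately show "ip M (T (\<lambda>x. indicator A' x * f x)) (\<lambda>x. indicator B' x * g x) = 0"
    by (simp only:)
qed

lemma vanishes_on_Un_left:
  assumes T: "bop M T" and v: "vanishes_on M T A1 B" "vanishes_on M T A2 B"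
    and s: "A1 \<in> sets M" "A2 \<in> sets M" "B \<in> sets M"
  shows "vanishes_on M T (A1 \<union> A2) B"
proof -
  have v': "vanishes_on M T (A2 - A1) B"
    by (rule vanishes_on_mono[OF v(2)]) (use s in auto)
  show ?thesis
    unfolding vanishes_on_def
  proof safe
    fix f g assume fg: "f \<in> L2 M" "g \<in> L2 M"
    have "(\<lambda>x. indicator (A1 \<union> A2) x * f x) = (\<lambda>x. indicator A1 x * f x + indicator (A2 - A1) x * f x)"
      by (auto simp: indicator_def)
    then show "ip M (T (\<lambda>x. indicator (A1 \<union> A2) x * f x)) (\<lambda>x. indicator B x * g x) = 0"
      using v(1) v' fg s by (simp add: ip_bop_add[OF T] L2_indicator_mult sets.Diff vanishes_on_def)
  qed
qed

lemma vanishes_on_Un_right: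
  assumes T: "bop M T" and v: "vanishes_on M T A B1" "vanishes_on M T A B2"
    and s: "A \<in> sets M" "B1 \<in> sets M" "B2 \<in> sets M"
  shows "vanishes_on M T A (B1 \<union> B2)"
proof -
  have v': "vanishes_on M T A (B2 - B1)"
    by (rule vanishes_on_mono[OF v(2)]) (use s in auto)
  show ?thesis
    unfolding vanishes_on_def
  proof safe
    fix f g assume fg: "f \<in> L2 M" "g \<in> L2 M"
    have "(\<lambda>x. indicator (B1 \<union> B2) x * g x) = (\<lambda>x. indicator B1 x * g x + indicator (B2 - B1) x * g x)"
      by (auto simp: indicator_def)
    then show "ip M (T (\<lambda>x. indicator A x * f x)) (\<lambda>x. indicator (B1 \<union> B2) x * g x) = 0"
      using v(1) v' fg s T by (simp add: ip_add_right bop_L2 L2_indicator_mult sets.Diff vanishes_on_def)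
  qed
qed

lemma vanishes_on_empty: "bop M T \<Longrightarrow> vanishes_on M T {} B" "vanishes_on M T A {}"
proof -
  show "vanishes_on M T A {}"
    by (simp add: vanishes_on_def)
  assume T: "bop M T"
  show "vanishes_on M T {} B"
    unfolding vanishes_on_def
  proof safe
    fix f g :: "'a \<Rightarrow> complex"
    have "\<forall>f\<in>L2 M. \<forall>g\<in>L2 M. \<forall>a b. AE x in M. T (\<lambda>y. a * f y + b * g y) x = a * T f x + b * T g x"
      using T by (simp add: bop_def)
    from this[rule_format, OF L2_zero L2_zero, of 0 0] have "AE x in M. T (\<lambda>x. 0) x = 0"
      by simp
    then have "AE x in M. T (\<lambda>x. 0) x * cnj (indicator B x * g x) = 0"
      by eventually_elim simp
    then have "(\<integral>x. T (\<lambda>x. 0) x * cnj (indicator B x * g x) \<partial>M) = 0"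
      by (rule integral_eq_zero_AE)
    then show "ip M (T (\<lambda>x. indicator {} x * f x)) (\<lambda>x. indicator B x * g x) = 0"
      by (simp add: ip_def)
  qed
qed

lemma vanishes_on_UN_left:
  assumes "bop M T" "finite I" "\<And>i. i \<in> I \<Longrightarrow> A i \<in> sets M \<and> vanishes_on M T (A i) B" "B \<in> sets M"
  shows "vanishes_on M T (\<Union>i\<in>I. A i) B"
  using assms(2,3)
  by induction (simp_all add: vanishes_on_empty vanishes_on_Un_left sets.finite_UN assms(1,4))

lemma vanishes_on_UN_right:
  assumes "bop M T" "finite I" "\<And>i. i \<in> I \<Longrightarrow> B i \<in> sets M \<and> vanishes_on M T A (B i)" "A \<in> sets M"
  shows "vanishes_on M T A (\<Union>i\<in>I. B i)"
  using assms(2,3)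
  by induction (simp_all add: vanishes_on_empty vanishes_on_Un_right sets.finite_UN assms(1,4))

lemma L2_indicator_tendsto:
  assumes f: "f \<in> L2 M" and A: "\<And>n. A n \<in> sets M" "A' \<in> sets M" "incseq A"
    and sub: "\<And>n. A n \<subseteq> A'" and null: "A' - (\<Union>n. A n) \<in> null_sets M"
  shows "(\<lambda>n. l2norm M (\<lambda>x. indicator (A n) x * f x - indicator A' x * f x)) \<longlonglongrightarrow> 0"
proof (rule L2_dominated_convergence)
  show "integrable M (\<lambda>x. (cmod (f x))\<^sup>2)"
    using f by (rule L2_integrable)
  show "(cmod (indicator (A n) x * f x - indicator A' x * f x))\<^sup>2 \<le> (cmod (f x))\<^sup>2" for n x
    using sub[of n] by (auto simp: indicator_def)
  show "AE x in M. (\<lambda>n. indicator (A n) x * f x) \<longlonglongrightarrow> indicator A' x * f x"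
    using AE_not_in[OF null]
  proof eventually_elim
    case (elim x)
    have "(\<lambda>n. indicator (A n) x :: complex) \<longlonglongrightarrow> indicator (\<Union>n. A n) x"
      by (rule LIMSEQ_indicator_incseq[OF A(3)])
    moreover have "(indicator (\<Union>n. A n) x :: complex) = indicator A' x"
      using elim sub by (auto simp: indicator_def)
    ultimately show ?case
      by (intro tendsto_mult) auto
  qed
qed (use f A in \<open>auto intro: L2_indicator_mult\<close>)

text \<open>The limit is taken first in the argument of \<open>T\<close> with the test set
  \<open>B k\<close> fixed, then in the test set. Exhaustion up to null sets suffices, which is what
  inner regularity provides.\<close>

lemma vanishes_on_incseq:
  assumes T: "bop M T"
    and A: "\<And>n. A n \<in> sets M" "A' \<in> sets M" "incseq A" "\<And>n. A n \<subseteq> A'" "A' - (\<Union>n. A n) \<in> null_sets M"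
    and B: "\<And>n. B n \<in> sets M" "B' \<in> sets M" "incseq B" "\<And>n. B n \<subseteq> B'" "B' - (\<Union>n. B n) \<in> null_sets M"
    and v: "\<And>n k. vanishes_on M T (A n) (B k)"
  shows "vanishes_on M T A' B'"
  unfolding vanishes_on_def
proof safe
  fix f g assume f: "f \<in> L2 M" and g: "g \<in> L2 M"
  note f' = L2_indicator_mult[OF f A(1)] L2_indicator_mult[OF f A(2)]
  note g' = L2_indicator_mult[OF g B(1)] L2_indicator_mult[OF g B(2)]
  have "ip M (T (\<lambda>x. indicator A' x * f x)) (\<lambda>x. indicator (B k) x * g x) = 0" for k
  proof (rule LIMSEQ_unique)
    show "(\<lambda>n. ip M (T (\<lambda>x. indicator (A n) x * f x)) (\<lambda>x. indicator (B k) x * g x))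
        \<longlonglongrightarrow> ip M (T (\<lambda>x. indicator A' x * f x)) (\<lambda>x. indicator (B k) x * g x)"
      by (rule ip_bop_tendsto_left[OF T f'(1) f'(2) g'(1) L2_indicator_tendsto[OF f A]])
  qed (use v f g in \<open>simp add: vanishes_on_def\<close>)
  moreover have "(\<lambda>n. ip M (T (\<lambda>x. indicator A' x * f x)) (\<lambda>x. indicator (B n) x * g x))
      \<longlonglongrightarrow> ip M (T (\<lambda>x. indicator A' x * f x)) (\<lambda>x. indicator B' x * g x)"
    by (rule ip_tendsto_right[OF g'(1) g'(2) bop_L2[OF T f'(2)] L2_indicator_tendsto[OF g B]])
  ultimately show "ip M (T (\<lambda>x. indicator A' x * f x)) (\<lambda>x. indicator B' x * g x) = 0"
    by (simp add: LIMSEQ_const_iff)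
qed

section \<open>Series of inner products and trace-class pairings\<close>

lemma l2norm_diff_power2:
  assumes "f \<in> L2 M" "g \<in> L2 M"
  shows "(l2norm M (\<lambda>x. f x - g x))\<^sup>2 = (l2norm M f)\<^sup>2 - 2 * Re (ip M f g) + (l2norm M g)\<^sup>2"
  using l2norm_add_power2[OF assms(1) L2_scale[OF assms(2), of "-1"]]
    ip_scale_right[of M f "-1" g] l2norm_scale[of M "-1" g] by simp

lemma ip_tendsto_left:
  assumes "\<And>n. s n \<in> L2 M" "g \<in> L2 M" "f \<in> L2 M"
    and "(\<lambda>n. l2norm M (\<lambda>x. s n x - g x)) \<longlonglongrightarrow> 0"
  shows "(\<lambda>n. ip M (s n) f) \<longlonglongrightarrow> ip M g f"
  using tendsto_cnj[OF ip_tendsto_right[OF assms]] by (simp add: ip_cnj)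

text \<open>Summing under the integral sign uses only the l^2 length of the vector of all
  \<open>a i x\<close>. The bound is required only where \<open>f\<close> is nonzero, so estimates
  that hold on a small neighbourhood apply to functions supported there.\<close>

lemma sum_l2norm_mult_le:
  fixes n :: nat
  assumes af: "\<And>i. (\<lambda>x. a i x * f x) \<in> L2 M" and f: "f \<in> L2 M"
    and le: "\<And>x. f x \<noteq> 0 \<Longrightarrow> (\<Sum>i<n. (cmod (a i x))\<^sup>2) \<le> D\<^sup>2"
  shows "(\<Sum>i<n. (l2norm M (\<lambda>x. a i x * f x))\<^sup>2) \<le> (D * l2norm M f)\<^sup>2"
proof -
  have int: "integrable M (\<lambda>x. (cmod (a i x * f x))\<^sup>2)" for i
    using af by (rule L2_integrable)
  have "(\<Sum>i<n. (l2norm M (\<lambda>x. a i x * f x))\<^sup>2) = (\<integral>x. (\<Sum>i<n. (cmod (a i x * f x))\<^sup>2) \<partial>M)"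
    unfolding l2norm_power2 using int by (simp add: Bochner_Integration.integral_sum)
  also have "\<dots> \<le> (\<integral>x. D\<^sup>2 * (cmod (f x))\<^sup>2 \<partial>M)"
  proof (rule integral_mono)
    show "(\<Sum>i<n. (cmod (a i x * f x))\<^sup>2) \<le> D\<^sup>2 * (cmod (f x))\<^sup>2" for x
      using mult_right_mono[OF le[of x], of "(cmod (f x))\<^sup>2"]
      by (cases "f x = 0") (simp_all add: norm_mult power_mult_distrib sum_distrib_right)
  qed (use int f in \<open>simp_all add: L2_integrable\<close>)
  finally show ?thesis
    by (simp add: l2norm_power2 power_mult_distrib)
qed

lemma Cauchy_Schwarz_sum_le:
  fixes x y :: "nat \<Rightarrow> real"
  assumes "(\<Sum>i<n. (x i)\<^sup>2) \<le> X\<^sup>2" "(\<Sum>i<n. (y i)\<^sup>2) \<le> Y\<^sup>2" "0 \<le> X" "0 \<le> Y"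
  shows "(\<Sum>i<n. x i * y i) \<le> X * Y"
proof (rule power2_le_imp_le)
  have "(\<Sum>i<n. x i * y i)\<^sup>2 \<le> (\<Sum>i<n. (x i)\<^sup>2) * (\<Sum>i<n. (y i)\<^sup>2)"
    by (rule Cauchy_Schwarz_ineq_sum)
  also have "\<dots> \<le> X\<^sup>2 * Y\<^sup>2"
    using assms by (intro mult_mono) (auto intro: sum_nonneg)
  finally show "(\<Sum>i<n. x i * y i)\<^sup>2 \<le> (X * Y)\<^sup>2"
    by (simp add: power_mult_distrib)
qed (use assms in simp)

text \<open>\<open>tc_pair\<close> is a \<open>suminf\<close>, so an equation for its value says
  something about partial sums only together with summability.\<close>

lemma summable_ip_bop:
  assumes T: "bop M T" and fg: "tc_rep M f g"
  shows "summable (\<lambda>i. ip M (T (f i)) (g i))"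
proof -
  obtain C where C: "C \<ge> 0" "\<And>f. f \<in> L2 M \<Longrightarrow> l2norm M (T f) \<le> C * l2norm M f"
    using bop_bounded[OF T] by blast
  have L: "f i \<in> L2 M" "g i \<in> L2 M" for i
    using fg by (auto simp: tc_rep_def)
  show ?thesis
  proof (rule summable_comparison_test)
    show "summable (\<lambda>i. C * ((l2norm M (f i))\<^sup>2 + (l2norm M (g i))\<^sup>2))"
      using fg by (intro summable_mult summable_add) (auto simp: tc_rep_def)
    have "cmod (ip M (T (f i)) (g i)) \<le> C * ((l2norm M (f i))\<^sup>2 + (l2norm M (g i))\<^sup>2)" for i
    proof -
      have "cmod (ip M (T (f i)) (g i)) \<le> C * (l2norm M (f i) * l2norm M (g i))"
        using ip_bop_bound[OF T C(2) L] by (simp add: mult.assoc)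
      also have "l2norm M (f i) * l2norm M (g i) \<le> (l2norm M (f i))\<^sup>2 + (l2norm M (g i))\<^sup>2"
        using sum_squares_bound[of "l2norm M (f i)" "l2norm M (g i)"]
          mult_nonneg_nonneg[OF l2norm_nonneg[of M "f i"] l2norm_nonneg[of M "g i"]] by linarith
      finally show ?thesis
        using C(1) by (simp add: mult_left_mono)
    qed
    then show "\<exists>N. \<forall>n\<ge>N. norm (ip M (T (f n)) (g n)) \<le> C * ((l2norm M (f n))\<^sup>2 + (l2norm M (g n))\<^sup>2)"
      by auto
  qed
qed

text \<open>Unlike the library's \<open>sums_integral\<close>, no pointwise summability is assumed: it follows from
  summability of the \<open>L\<^sup>1\<close> norms.\<close>

lemma AE_summable_norm:
  fixes F :: "nat \<Rightarrow> 'a \<Rightarrow> complex"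
  assumes int: "\<And>i. integrable M (F i)" and sum: "summable (\<lambda>i. \<integral>x. norm (F i x) \<partial>M)"
  shows "AE x in M. summable (\<lambda>i. norm (F i x))"
proof -
  have [measurable]: "F i \<in> borel_measurable M" for i
    using int by auto
  have "(\<integral>\<^sup>+x. (\<Sum>i. ennreal (norm (F i x))) \<partial>M) = (\<Sum>i. \<integral>\<^sup>+x. ennreal (norm (F i x)) \<partial>M)"
    by (rule nn_integral_suminf) measurable
  also have "\<dots> = (\<Sum>i. ennreal (\<integral>x. norm (F i x) \<partial>M))"
    using int by (intro suminf_cong nn_integral_eq_integral) auto
  also have "\<dots> \<noteq> \<infinity>"
    using sum by (intro ennreal_suminf_neq_top[unfolded infinity_ennreal_def[symmetric]]) auto
  finally have "AE x in M. (\<Sum>i. ennreal (norm (F i x))) \<noteq> \<infinity>"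
    by (intro nn_integral_PInf_AE) measurable
  then show ?thesis
    by eventually_elim (auto intro!: summable_suminf_not_top)
qed

lemma suminf_dominated_tendsto:
  fixes a :: "nat \<Rightarrow> nat \<Rightarrow> complex"
  assumes "\<And>i. (\<lambda>n. a i n) \<longlonglongrightarrow> b i" "\<And>i n. norm (a i n) \<le> w i" "summable w"
  shows "(\<lambda>n. \<Sum>i. a i n) \<longlonglongrightarrow> (\<Sum>i. b i)"
  using tannerys_theorem[of a b sequentially w] assms by (simp add: always_eventually)

lemma tc_rep_product_bound:
  assumes "tc_rep M f g"
  shows "summable (\<lambda>i. l2norm M (f i) * l2norm M (g i))"
proof (rule summable_comparison_test')
  show "summable (\<lambda>i. (l2norm M (f i))\<^sup>2 + (l2norm M (g i))\<^sup>2)"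
    using assms by (intro summable_add) (auto simp: tc_rep_def)
  show "norm (l2norm M (f i) * l2norm M (g i)) \<le> (l2norm M (f i))\<^sup>2 + (l2norm M (g i))\<^sup>2" for i
    using sum_squares_bound[of "l2norm M (f i)" "l2norm M (g i)"]
      mult_nonneg_nonneg[OF l2norm_nonneg[of M "f i"] l2norm_nonneg[of M "g i"]]
    by (simp del: mult_nonneg_nonneg zero_le_mult_iff)
qed

lemma ip_bop_projection:
  fixes n :: nat
  assumes T: "bop M T" and b: "\<And>j. b j \<in> L2 M" and g: "g \<in> L2 M"
  shows "ip M (T (\<lambda>x. \<Sum>j<n. ip M f (b j) * b j x)) g = (\<Sum>j<n. ip M f (b j) * ip M (T (b j)) g)"
  using ip_bop_sum[OF T, of "{..<n}" "\<lambda>j x. ip M f (b j) * b j x" g] b g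
  by (simp add: L2_scale ip_bop_scale[OF T])

lemma projection_L2:
  fixes n :: nat
  assumes "\<And>j. b j \<in> L2 M"
  shows "(\<lambda>x. \<Sum>j<n. ip M f (b j) * b j x) \<in> L2 M"
  using assms by (intro L2_sum L2_scale)

lemma projection_tendsto:
  assumes "complete_orthonormal M b" "f \<in> L2 M"
  shows "(\<lambda>n. l2norm M (\<lambda>x. (\<Sum>j<n. ip M f (b j) * b j x) - f x)) \<longlonglongrightarrow> 0"
  using assms unfolding complete_orthonormal_def residual_def
  by (subst l2norm_minus_commute) blast

text \<open>The factor 2 comes from writing the projection as \<open>f\<close> minus its residual;
  what matters is that the bound is uniform in \<open>n\<close>.\<close>

lemma l2norm_projection_le:
  assumes "complete_orthonormal M b" "f \<in> L2 M"
  shows "l2norm M (\<lambda>x. \<Sum>j<n. ip M f (b j) * b j x) \<le> 2 * l2norm M f"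
proof -
  note on = complete_orthonormal_upto[OF assms(1), of n]
  have "(\<lambda>x. \<Sum>j<n. ip M f (b j) * b j x) = (\<lambda>x. f x + (-1) * residual M b n f x)"
    by (simp add: residual_def)
  then have "l2norm M (\<lambda>x. \<Sum>j<n. ip M f (b j) * b j x) \<le> l2norm M f + l2norm M (\<lambda>x. (-1) * residual M b n f x)"
    using l2norm_triangle[OF assms(2) L2_scale[OF residual_L2[OF on assms(2)], of "-1"]] by simp
  also have "l2norm M (\<lambda>x. (-1) * residual M b n f x) \<le> l2norm M f"
    unfolding l2norm_scale using l2norm_residual_le[OF on assms(2)] by simp
  finally show ?thesis by simp
qed

section \<open>Marginally null sets\<close>

lemma marg_null_subset: "marg_null M B \<Longrightarrow> A \<subseteq> B \<Longrightarrow> marg_null M A"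
  unfolding marg_null_def by blast

lemma marg_null_UN:
  assumes "countable I" "\<And>i. i \<in> I \<Longrightarrow> marg_null M (A i)"
  shows "marg_null M (\<Union>i\<in>I. A i)"
proof -
  obtain X where X: "\<And>i. i \<in> I \<Longrightarrow> X i \<in> null_sets M \<and> A i \<subseteq> (X i \<times> UNIV) \<union> (UNIV \<times> X i)"
    using assms(2) unfolding marg_null_def by metis
  have "(\<Union>i\<in>I. X i) \<in> null_sets M"
    using X by (intro null_sets_UN' assms(1)) blast
  moreover have "(\<Union>i\<in>I. A i) \<subseteq> ((\<Union>i\<in>I. X i) \<times> UNIV) \<union> (UNIV \<times> (\<Union>i\<in>I. X i))"
    using X by blast
  ultimately show ?thesis
    unfolding marg_null_def by blast
qed

lemma marg_null_Un: "marg_null M A \<Longrightarrow> marg_null M B \<Longrightarrow> marg_null M (A \<union> B)"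
  using marg_null_UN[of "{True, False}" M "\<lambda>b. if b then A else B"] by (simp add: Un_commute)

lemma open_prod_eq_UN_rectangles:
  fixes O1 :: "('a::second_countable_topology \<times> 'b::second_countable_topology) set"
  assumes "open O1"
  shows "\<exists>A B. (\<forall>n::nat. open (A n) \<and> open (B n)) \<and> O1 = (\<Union>n. A n \<times> B n)"
proof -
  obtain \<A> :: "'a set set" where \<A>: "countable \<A>" "topological_basis \<A>"
    using ex_countable_basis by blast
  obtain \<B> :: "'b set set" where \<B>: "countable \<B>" "topological_basis \<B>"
    using ex_countable_basis by blast
  \<comment> \<open>The empty rectangle keeps \<open>D\<close> nonempty, as the enumeration by
    \<open>from_nat_into\<close> requires.\<close>
  define D where "D = insert ({}, {}) {(A, B). A \<in> \<A> \<and> B \<in> \<B> \<and> A \<times> B \<subseteq> O1}"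
  have "countable (\<A> \<times> \<B>)"
    using \<A>(1) \<B>(1) by simp
  then have cD: "countable D"
    unfolding D_def by (intro countable_insert) (rule countable_subset, auto)
  have ne: "D \<noteq> {}"
    by (simp add: D_def)
  have D_open: "open (fst q) \<and> open (snd q) \<and> fst q \<times> snd q \<subseteq> O1" if "q \<in> D" for q
    using that \<A>(2) \<B>(2) by (auto simp: D_def topological_basis_open)
  note mem = D_open[OF from_nat_into[OF ne]]
  show ?thesis
  proof (intro exI conjI allI)
    show "open (fst (from_nat_into D n))" "open (snd (from_nat_into D n))" for n
      using mem by blast+
    show "O1 = (\<Union>n. fst (from_nat_into D n) \<times> snd (from_nat_into D n))"
    proof
      show "O1 \<subseteq> (\<Union>n. fst (from_nat_into D n) \<times> snd (from_nat_into D n))"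
      proof
        fix p assume "p \<in> O1"
        with assms obtain A B where AB: "open A" "open B" "p \<in> A \<times> B" "A \<times> B \<subseteq> O1"
          by (rule open_prod_elim)
        have p: "fst p \<in> A" "snd p \<in> B"
          using AB(3) by auto
        obtain A' where A': "A' \<in> \<A>" "fst p \<in> A'" "A' \<subseteq> A"
          by (rule topological_basisE[OF \<A>(2) AB(1) p(1)])
        obtain B' where B': "B' \<in> \<B>" "snd p \<in> B'" "B' \<subseteq> B"
          by (rule topological_basisE[OF \<B>(2) AB(2) p(2)])
        have "(A', B') \<in> D"
          using A' B' AB(4) by (auto simp: D_def)
        then obtain n where "from_nat_into D n = (A', B')"
          using from_nat_into_surj[OF cD] by blast
        then show "p \<in> (\<Union>n. fst (from_nat_into D n) \<times> snd (from_nat_into D n))"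
          using A' B' by (intro UN_I[of n]) (auto simp: mem_Times_iff)
      qed
    qed (use mem in blast)
  qed
qed

lemma omega_closed_closed:
  fixes \<Omega> :: "('a::second_countable_topology \<times> 'a) set"
  assumes "closed \<Omega>"
  shows "omega_closed M \<Omega>"
proof -
  have "open (- \<Omega>)"
    using assms unfolding closed_def .
  then obtain A B :: "nat \<Rightarrow> 'a set" where AB: "\<And>n. open (A n)" "\<And>n. open (B n)" "- \<Omega> = (\<Union>n. A n \<times> B n)"
    using open_prod_eq_UN_rectangles[of "- \<Omega>"] by metis
  have "marg_equiv M (- \<Omega>) (\<Union>n. A n \<times> B n)"
    unfolding AB(3) marg_equiv_def marg_null_def by (intro bexI[of _ "{}"]) auto
  then show ?thesis
    unfolding omega_closed_def omega_open_def using AB(1,2) by (intro exI[of _ A] exI[of _ B]) simp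
qed

lemma omega_support_unique:
  "omega_support M U \<Omega> \<Longrightarrow> omega_support M U \<Omega>' \<Longrightarrow> marg_equiv M \<Omega> \<Omega>'"
  unfolding marg_equiv_def omega_support_def by (intro marg_null_Un) blast+

section \<open>Haar measure\<close>

text \<open>The unit, whose existence \<open>lc_group\<close> asserts, becomes a parameter so that
  it can be named.\<close>

locale haar_group =
  fixes m :: "'g::{t2_space, second_countable_topology} \<Rightarrow> 'g \<Rightarrow> 'g" (infixl "\<odot>" 70)
    and iv :: "'g \<Rightarrow> 'g" and e :: 'g and \<mu> :: "'g measure"
  assumes assoc: "(x \<odot> y) \<odot> z = x \<odot> (y \<odot> z)"
    and left_unit [simp]: "e \<odot> x = x" and right_unit [simp]: "x \<odot> e = x"
    and left_inv [simp]: "iv x \<odot> x = e" and right_inv [simp]: "x \<odot> iv x = e"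
    and continuous_mult_pair: "continuous_on UNIV (\<lambda>p. fst p \<odot> snd p)"
    and continuous_iv: "continuous_on UNIV iv"
    and locally_compact: "locally_compact_space (euclidean :: 'g topology)"
    and haar: "left_haar (\<odot>) \<mu>"
begin

lemma inv_cancel_left [simp]: "iv x \<odot> (x \<odot> y) = y" "x \<odot> (iv x \<odot> y) = y"
  by (simp_all add: assoc[symmetric])

lemma mult_eq_iff: "x \<odot> y = z \<longleftrightarrow> y = iv x \<odot> z"
  by auto

lemma inv_mult: "iv (x \<odot> y) = iv y \<odot> iv x"
proof -
  have "(x \<odot> y) \<odot> (iv y \<odot> iv x) = e"
    by (simp add: assoc)
  then show ?thesis
    unfolding mult_eq_iff by simp
qed

lemma inv_inv [simp]: "iv (iv x) = x"
  using mult_eq_iff[of "iv x" x e] by simp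

lemma continuous_on_mult [continuous_intros]:
  "continuous_on S f \<Longrightarrow> continuous_on S g \<Longrightarrow> continuous_on S (\<lambda>x. f x \<odot> g x)"
  using continuous_on_compose2[OF continuous_mult_pair, of S "\<lambda>x. (f x, g x)"]
  by (simp add: continuous_on_Pair)

lemma continuous_on_inv [continuous_intros]:
  "continuous_on S f \<Longrightarrow> continuous_on S (\<lambda>x. iv (f x))"
  using continuous_on_compose2[OF continuous_iv, of S f] by simp

lemma sets_haar [measurable_cong]: "sets \<mu> = sets borel"
  using haar by (simp add: left_haar_def)

lemma space_haar [simp]: "space \<mu> = UNIV"
  using sets_eq_imp_space_eq[OF sets_haar] by simp

lemma measurable_mult [measurable (raw)]:
  "f \<in> borel_measurable M \<Longrightarrow> g \<in> borel_measurable M \<Longrightarrow> (\<lambda>x. f x \<odot> g x) \<in> borel_measurable M"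
  by (rule borel_measurable_continuous_Pair[OF _ _ continuous_mult_pair])

lemma measurable_inv [measurable]: "iv \<in> borel_measurable borel"
  by (rule borel_measurable_continuous_onI[OF continuous_iv])

lemma emeasure_compact_finite: "compact K \<Longrightarrow> emeasure \<mu> K < \<infinity>"
  using haar by (simp add: left_haar_def)

lemma emeasure_open_pos: "open V \<Longrightarrow> x \<in> V \<Longrightarrow> 0 < emeasure \<mu> V"
  using haar unfolding left_haar_def by blast

lemma distr_left_translation: "distr \<mu> \<mu> (\<lambda>x. a \<odot> x) = \<mu>"
proof (rule measure_eqI)
  fix A assume "A \<in> sets (distr \<mu> \<mu> (\<lambda>x. a \<odot> x))"
  then have A: "A \<in> sets borel"
    by (simp add: sets_haar)
  have "(\<lambda>x. a \<odot> x) -` A = (\<lambda>x. iv a \<odot> x) ` A"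
  proof safe
    fix x assume "a \<odot> x \<in> A"
    then show "x \<in> (\<lambda>x. iv a \<odot> x) ` A"
      by (intro image_eqI[of _ _ "a \<odot> x"]) auto
  qed simp
  then have "emeasure (distr \<mu> \<mu> (\<lambda>x. a \<odot> x)) A = emeasure \<mu> ((\<lambda>x. iv a \<odot> x) ` A)"
    using A by (subst emeasure_distr) (auto simp: sets_haar)
  also have "\<dots> = emeasure \<mu> A"
    using haar A by (simp add: left_haar_def)
  finally show "emeasure (distr \<mu> \<mu> (\<lambda>x. a \<odot> x)) A = emeasure \<mu> A" .
qed simp

lemma nn_integral_left_translation:
  assumes [measurable]: "f \<in> borel_measurable borel"
  shows "(\<integral>\<^sup>+x. f (a \<odot> x) \<partial>\<mu>) = (\<integral>\<^sup>+x. f x \<partial>\<mu>)"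
  by (subst (2) distr_left_translation[of a, symmetric], subst nn_integral_distr) measurable

lemma integral_left_translation:
  fixes f :: "'g \<Rightarrow> 'b::{banach, second_countable_topology}"
  assumes [measurable]: "f \<in> borel_measurable borel"
  shows "(\<integral>x. f (a \<odot> x) \<partial>\<mu>) = (\<integral>x. f x \<partial>\<mu>)"
  by (subst (2) distr_left_translation[of a, symmetric], subst integral_distr) measurable

lemma integrable_left_translation:
  fixes f :: "'g \<Rightarrow> 'b::{banach, second_countable_topology}"
  assumes "integrable \<mu> f"
  shows "integrable \<mu> (\<lambda>x. f (a \<odot> x))"
proof -
  have "integrable (distr \<mu> \<mu> (\<lambda>x. a \<odot> x)) f"
    using assms by (simp add: distr_left_translation)
  then show ?thesis
    by (rule integrable_distr[rotated]) measurable
qed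

lemma compact_neighbourhood: obtains W K where "open W" "compact K" "(x :: 'g) \<in> W" "W \<subseteq> K"
proof -
  have "\<exists>W K. open W \<and> compact K \<and> x \<in> W \<and> W \<subseteq> K"
    using locally_compact unfolding locally_compact_space_def by simp
  with that show thesis by blast
qed

lemma sigma_compact: obtains C :: "nat \<Rightarrow> 'g set" where "\<And>n. compact (C n)" "(\<Union>n. C n) = UNIV"
proof -
  define F where "F = {W :: 'g set. open W \<and> (\<exists>K. compact K \<and> W \<subseteq> K)}"
  have "\<Union>F = UNIV"
  proof (rule UNIV_eq_I[symmetric])
    fix x :: 'g
    obtain W K :: "'g set" where "open W" "compact K" "x \<in> W" "W \<subseteq> K"
      by (rule compact_neighbourhood)
    then show "x \<in> \<Union>F"
      unfolding F_def by blast
  qed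
  moreover have "open W" if "W \<in> F" for W
    using that by (simp add: F_def)
  ultimately obtain F' where F': "F' \<subseteq> F" "countable F'" "\<Union>F' = UNIV"
    using Lindelof[of F] by metis
  have ne: "F' \<noteq> {}"
    using F'(3) by auto
  have "\<exists>K. compact K \<and> from_nat_into F' n \<subseteq> K" for n
  proof -
    have "from_nat_into F' n \<in> F"
      using from_nat_into[OF ne] F'(1) by blast
    then show ?thesis by (simp add: F_def)
  qed
  then obtain C where C: "\<And>n. compact (C n) \<and> from_nat_into F' n \<subseteq> C n"
    by metis
  have "(\<Union>n. C n) = UNIV"
  proof (rule UNIV_eq_I[symmetric])
    fix x :: 'g
    have "x \<in> \<Union>F'"
      using F'(3) by simp
    then obtain W where "W \<in> F'" "x \<in> W"
      by blast
    then show "x \<in> (\<Union>n. C n)"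
      using C from_nat_into_surj[OF F'(2), of W] by blast
  qed
  with C show thesis
    using that by blast
qed

lemma compact_in_sets: "compact K \<Longrightarrow> K \<in> sets \<mu>"
  by (simp add: sets_haar borel_compact)

sublocale sigma_finite_measure \<mu>
proof
  obtain C :: "nat \<Rightarrow> 'g set" where C: "\<And>n. compact (C n)" "(\<Union>n. C n) = UNIV"
    using sigma_compact by blast
  show "\<exists>A. countable A \<and> A \<subseteq> sets \<mu> \<and> \<Union> A = space \<mu> \<and> (\<forall>a\<in>A. emeasure \<mu> a \<noteq> \<infinity>)"
    using C emeasure_compact_finite[OF C(1)]
    by (intro exI[of _ "range C"]) (auto simp: compact_in_sets less_le)
qed

sublocale pair_sigma_finite \<mu> \<mu> ..

section \<open>Regularity and null sets\<close>

lemma outer_regular: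
  assumes A: "A \<in> sets borel" and fin: "emeasure \<mu> A < \<infinity>" and \<epsilon>: "0 < \<epsilon>"
  obtains V where "open V" "A \<subseteq> V" "emeasure \<mu> (V - A) < \<epsilon>"
proof -
  have "emeasure \<mu> A = (INF V\<in>{V. open V \<and> A \<subseteq> V}. emeasure \<mu> V)"
    using haar A by (simp add: left_haar_def)
  moreover have "emeasure \<mu> A < emeasure \<mu> A + \<epsilon>"
    using fin \<epsilon> by (metis add.right_neutral ennreal_add_left_cancel_less infinity_ennreal_def less_irrefl)
  ultimately obtain V where V: "open V" "A \<subseteq> V" "emeasure \<mu> V < emeasure \<mu> A + \<epsilon>"
    by (auto simp: INF_less_iff)
  have "emeasure \<mu> A + emeasure \<mu> (V - A) = emeasure \<mu> V"
    using V A by (subst plus_emeasure) (auto simp: sets_haar intro!: arg_cong[where f = "emeasure \<mu>"])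
  with V(3) have "emeasure \<mu> (V - A) < \<epsilon>"
    by (metis ennreal_add_left_cancel_less)
  with V that show thesis by blast
qed

text \<open>The definition of \<open>left_haar\<close> gives approximation from inside only for open
  sets. For Borel \<open>A\<close> one complements within compact pieces: an open \<open>V\<close>
  slightly larger than \<open>C n - A\<close> leaves the compact set \<open>C n - V\<close> inside
  \<open>A\<close>, with small loss on \<open>C n\<close>. Finite unions over both indices produce
  one increasing sequence.\<close>

lemma inner_regular:
  assumes A: "A \<in> sets borel"
  obtains K where "\<And>n::nat. compact (K n)" "incseq K" "\<And>n. K n \<subseteq> A" "A - (\<Union>n. K n) \<in> null_sets \<mu>"
proof -
  obtain C :: "nat \<Rightarrow> 'g set" where C: "\<And>n. compact (C n)" "(\<Union>n. C n) = UNIV"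
    using sigma_compact by blast
  have Cb: "C n \<in> sets borel" for n
    using C(1) by (rule borel_compact)
  have "\<exists>V. open V \<and> C n - A \<subseteq> V \<and> emeasure \<mu> (V - (C n - A)) < ennreal (1 / Suc k)" for n k
  proof -
    have "emeasure \<mu> (C n - A) \<le> emeasure \<mu> (C n)"
      using Cb by (intro emeasure_mono) (auto simp: sets_haar)
    also have "\<dots> < \<infinity>"
      using C(1) by (rule emeasure_compact_finite)
    finally show ?thesis
      using outer_regular[of "C n - A" "ennreal (1 / Suc k)"] A Cb by (metis sets.Diff zero_less_divide_1_iff of_nat_0_less_iff ennreal_less_zero_iff zero_less_Suc)
  qed
  then obtain V where V: "\<And>n k. open (V n k)" "\<And>n k. C n - A \<subseteq> V n k"
      "\<And>n k. emeasure \<mu> (V n k - (C n - A)) < ennreal (1 / Suc k)"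
    by metis
  have Vb: "V n k \<in> sets borel" for n k
    using V(1) by (rule borel_open)
  define K where "K N = (\<Union>n\<le>N. \<Union>k\<le>N. C n - V n k)" for N :: nat
  have sub: "C n - V n k \<subseteq> K (max n k)" for n k
    unfolding K_def by (intro subsetI UN_I[of n] UN_I[of k]) auto
  have null: "A \<inter> C n - (\<Union>N. K N) \<in> null_sets \<mu>" for n
  proof (rule null_setsI)
    let ?D = "A \<inter> C n - (\<Union>N. K N)"
    have Kb: "K N \<in> sets borel" for N
      unfolding K_def using Cb Vb by auto
    show D: "?D \<in> sets \<mu>"
      using A Cb Kb by (auto simp: sets_haar)
    have "emeasure \<mu> ?D \<le> ennreal (1 / Suc k)" for k
    proof -
      have "?D \<subseteq> V n k - (C n - A)"
        using sub[of n k] by blast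
      then have "emeasure \<mu> ?D \<le> emeasure \<mu> (V n k - (C n - A))"
        using A Cb Vb by (intro emeasure_mono) (auto simp: sets_haar)
      with V(3)[of n k] show ?thesis by simp
    qed
    moreover have "(\<lambda>k. ennreal (1 / Suc k)) \<longlonglongrightarrow> ennreal 0"
      using LIMSEQ_inverse_real_of_nat by (intro tendsto_ennrealI) (simp add: inverse_eq_divide)
    ultimately have "emeasure \<mu> ?D \<le> ennreal 0"
      by (intro LIMSEQ_le_const) auto
    then show "emeasure \<mu> ?D = 0" by simp
  qed
  show thesis
  proof (rule that)
    show "compact (K n)" for n
      unfolding K_def using C V by (intro compact_UN finite_atMost) (auto intro: compact_diff)
    show "incseq K"
      unfolding K_def incseq_def by fastforce
    show "K n \<subseteq> A" for n
      unfolding K_def using V(2) by blast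
    have "A - (\<Union>N. K N) = (\<Union>n. A \<inter> C n - (\<Union>N. K N))"
      using C(2) by blast
    then show "A - (\<Union>N. K N) \<in> null_sets \<mu>"
      using null by (metis null_sets_UN)
  qed
qed

text \<open>Tonelli on \<open>{(x, y). (y r)\<^sup>-\<^sup>1 x \<in> N}\<close>, whose \<open>x\<close>-sections are null by left invariance.\<close>

lemma null_sets_inverse_mult:
  assumes N: "N \<in> null_sets \<mu>"
  shows "{y. iv (y \<odot> r) \<in> N} \<in> null_sets \<mu>"
proof -
  have [measurable]: "N \<in> sets borel"
    using N by (auto simp: sets_haar)
  have "(\<integral>\<^sup>+x. \<integral>\<^sup>+y. indicator N (iv (y \<odot> r) \<odot> x) \<partial>\<mu> \<partial>\<mu>)
      = (\<integral>\<^sup>+y. \<integral>\<^sup>+x. indicator N (iv (y \<odot> r) \<odot> x) \<partial>\<mu> \<partial>\<mu>)"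
    by (rule Fubini') measurable
  also have "\<dots> = (\<integral>\<^sup>+y. \<integral>\<^sup>+x. indicator N x \<partial>\<mu> \<partial>\<mu>)"
    by (intro nn_integral_cong nn_integral_left_translation) measurable
  also have "\<dots> = 0"
    using N by (simp add: sets_haar null_setsD1)
  finally have "AE x in \<mu>. (\<integral>\<^sup>+y. indicator N (iv (y \<odot> r) \<odot> x) \<partial>\<mu>) = 0"
    by (subst (asm) nn_integral_0_iff_AE) measurable
  moreover have "\<not> (AE x in \<mu>. False)"
    using emeasure_open_pos[of UNIV e] by (simp add: AE_iff_measurable[OF _ refl] sets_haar)
  \<comment> \<open>A single \<open>x\<close> suffices: replacing \<open>y\<close> by
    \<open>x \<odot> y\<close> turns \<open>iv (y \<odot> r) \<odot> x\<close> into
    \<open>iv (y \<odot> r)\<close>.\<close>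
  ultimately obtain x where x: "(\<integral>\<^sup>+y. indicator N (iv (y \<odot> r) \<odot> x) \<partial>\<mu>) = 0"
    using eventually_mono[of _ "ae_filter \<mu>" "\<lambda>_. False"] by blast
  have "(\<integral>\<^sup>+y. indicator N (iv (y \<odot> r) \<odot> x) \<partial>\<mu>)
      = (\<integral>\<^sup>+y. indicator N (iv (x \<odot> y \<odot> r) \<odot> x) \<partial>\<mu>)"
    by (rule nn_integral_left_translation[symmetric]) measurable
  also have "\<dots> = (\<integral>\<^sup>+y. indicator {y. iv (y \<odot> r) \<in> N} y \<partial>\<mu>)"
    by (intro nn_integral_cong) (simp add: indicator_def inv_mult assoc)
  also have "\<dots> = emeasure \<mu> {y. iv (y \<odot> r) \<in> N}"
    by (rule nn_integral_indicator) measurable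
  finally show ?thesis
    using x by (intro null_setsI) measurable
qed

text \<open>Two inversions make a right translation, so quasi-invariance follows without computing
  how the measure scales.\<close>

lemma null_sets_right_translation:
  assumes "N \<in> null_sets \<mu>"
  shows "{y. y \<odot> r \<in> N} \<in> null_sets \<mu>"
  using null_sets_inverse_mult[OF null_sets_inverse_mult[OF assms, of e], of r] by simp

lemma AE_right_translation:
  assumes "AE x in \<mu>. P x"
  shows "AE x in \<mu>. P (x \<odot> r)"
proof -
  obtain N where "{x. \<not> P x} \<subseteq> N" "N \<in> null_sets \<mu>"
    using assms by (auto elim!: AE_E simp: null_sets_def)
  then show ?thesis
    using null_sets_right_translation[of N r] by (intro AE_I'[of "{y. y \<odot> r \<in> N}"]) auto
qed

text \<open>Outer regularity reduces indicators of Borel sets to those of open sets, for which a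
  point stays in the set under small perturbations and a countable base is available.\<close>

lemma L2_induct_open:
  assumes f: "f \<in> L2 \<mu>"
    and opn: "\<And>V. open V \<Longrightarrow> emeasure \<mu> V < \<infinity> \<Longrightarrow> P (indicator V)"
    and add: "\<And>f g. f \<in> L2 \<mu> \<Longrightarrow> g \<in> L2 \<mu> \<Longrightarrow> P f \<Longrightarrow> P g \<Longrightarrow> P (\<lambda>x. f x + g x)"
    and scale: "\<And>f c. f \<in> L2 \<mu> \<Longrightarrow> P f \<Longrightarrow> P (\<lambda>x. c * f x)"
    and approx: "\<And>f. f \<in> L2 \<mu> \<Longrightarrow>
      (\<And>\<epsilon>. \<epsilon> > 0 \<Longrightarrow> \<exists>g\<in>L2 \<mu>. P g \<and> l2norm \<mu> (\<lambda>x. g x - f x) < \<epsilon>) \<Longrightarrow> P f"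
  shows "P f"
proof (rule L2_induct_indicator[OF space_haar f])
  fix A assume A: "A \<in> sets \<mu>" "emeasure \<mu> A < \<infinity>"
  show "P (indicator A)"
  proof (rule approx[OF L2_indicator[OF A]])
    fix \<epsilon> :: real assume \<epsilon>: "\<epsilon> > 0"
    then have "0 < ennreal (\<epsilon>\<^sup>2)" by simp
    then obtain V where V: "open V" "A \<subseteq> V" "emeasure \<mu> (V - A) < ennreal (\<epsilon>\<^sup>2)"
      by (rule outer_regular[OF A(1)[unfolded sets_haar] A(2)])
    have Vs: "V \<in> sets \<mu>"
      using V(1) by (simp add: sets_haar)
    have "emeasure \<mu> V = emeasure \<mu> A + emeasure \<mu> (V - A)"
      using V A Vs by (subst plus_emeasure) (auto intro!: arg_cong[where f = "emeasure \<mu>"])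
    also have "\<dots> < \<infinity>"
      using A(2) V(3) by (metis ennreal_add_less_top ennreal_less_top infinity_ennreal_def order_less_trans)
    finally have fin: "emeasure \<mu> V < \<infinity>" .
    have eq: "(\<lambda>x. (cmod (indicator V x - indicator A x))\<^sup>2) = (indicator (V - A) :: _ \<Rightarrow> real)"
      using V(2) by (auto simp: indicator_def fun_eq_iff)
    have "measure \<mu> (V - A) < \<epsilon>\<^sup>2"
      unfolding measure_def using V(3)
      by (subst enn2real_less_iff) (auto intro: order.strict_trans[OF _ ennreal_less_top])
    then have "l2norm \<mu> (\<lambda>x. indicator V x - indicator A x) < sqrt (\<epsilon>\<^sup>2)"
      unfolding l2norm_def eq by (subst real_sqrt_less_iff) (use A Vs in simp)
    then show "\<exists>g\<in>L2 \<mu>. P g \<and> l2norm \<mu> (\<lambda>x. g x - indicator A x) < \<epsilon>"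
      using L2_indicator[OF Vs fin] opn[OF V(1) fin] \<epsilon> by auto
  qed
qed (use add scale approx in blast)+

text \<open>Gram-Schmidt is applied to the indicators of finite-measure finite unions of base sets,
  a countable family whose closed span is all of L^2.\<close>

lemma complete_orthonormal_exists: obtains b where "complete_orthonormal \<mu> b"
proof -
  obtain B :: "'g set set" where B: "countable B" "topological_basis B"
    using ex_countable_basis by blast
  \<comment> \<open>Finite unions are included so that every open set of finite measure is an
    increasing limit of members of \<open>D\<close>.\<close>
  define D where "D = {V. (\<exists>F. finite F \<and> F \<subseteq> B \<and> V = \<Union>F) \<and> emeasure \<mu> V < \<infinity>}"
  have "D \<subseteq> Union ` {F. finite F \<and> F \<subseteq> B}"
    by (auto simp: D_def)
  then have cD: "countable D"
    using countable_Collect_finite_subset[OF B(1)] by (meson countable_image countable_subset)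
  have "{} \<in> D"
    unfolding D_def by (auto intro!: exI[of _ "{}"])
  then have D_ne: "D \<noteq> {}" by blast
  have D_open: "open V" if "V \<in> D" for V
    using that B(2) unfolding D_def by (auto intro!: open_Union topological_basis_open)
  define d :: "nat \<Rightarrow> 'g \<Rightarrow> complex" where "d n = indicator (from_nat_into D n)" for n
  have d: "d n \<in> L2 \<mu>" for n
    using from_nat_into[OF D_ne, of n] D_open unfolding d_def
    by (intro L2_indicator) (auto simp: sets_haar D_def)
  note on = orthonormal_gram_schmidt[where d = d, OF d]
  let ?P = "\<lambda>f. (\<lambda>n. l2norm \<mu> (residual \<mu> (gram_schmidt \<mu> d) n f)) \<longlonglongrightarrow> 0"
  have "?P f" if "f \<in> L2 \<mu>" for f
    using that
  proof (rule L2_induct_open)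
    fix V :: "'g set" assume V: "open V" "emeasure \<mu> V < \<infinity>"
    have VL: "(indicator V :: 'g \<Rightarrow> complex) \<in> L2 \<mu>"
      using V by (intro L2_indicator) (auto simp: sets_haar)
    obtain F where F: "F \<subseteq> B" "V = \<Union>F"
      using B(2) V(1) by (metis topological_basis_def)
    \<comment> \<open>The set \<open>{}\<close> is inserted to cover the case that \<open>F\<close>
      is empty; since it need not belong to \<open>B\<close>, it is removed again when
      \<open>W n\<close> is shown to lie in \<open>D\<close>.\<close>
    define W where "W n = (\<Union>i\<le>n. from_nat_into (insert {} F) i)" for n :: nat
    have cF: "countable (insert {} F)"
      using F(1) B(1) countable_subset by (metis countable_insert_eq)
    have mem: "from_nat_into (insert {} F) i \<in> insert {} F" for i
      by (rule from_nat_into) simp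
    have WV: "W n \<subseteq> V" for n
      unfolding W_def F(2) using mem by blast
    have Wopen: "open (W n)" for n
      unfolding W_def using mem F(1) B(2) by (intro open_UN ballI) (metis insertE open_empty subsetD topological_basis_open)
    have W_UN: "(\<Union>n. W n) = V"
    proof
      show "V \<subseteq> (\<Union>n. W n)"
      proof
        fix x assume "x \<in> V"
        then obtain S where S: "S \<in> F" "x \<in> S"
          using F(2) by blast
        then obtain i where "from_nat_into (insert {} F) i = S"
          using from_nat_into_surj[OF cF, of S] by blast
        with S show "x \<in> (\<Union>n. W n)"
          unfolding W_def by auto
      qed
    qed (use WV in blast)
    have WD: "W n \<in> D" for n
    proof -
      have "emeasure \<mu> (W n) \<le> emeasure \<mu> V"
        using WV V by (intro emeasure_mono) (auto simp: sets_haar)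
      moreover have "W n = \<Union>((from_nat_into (insert {} F) ` {..n}) - {{}})"
        unfolding W_def by blast
      moreover have "(from_nat_into (insert {} F) ` {..n}) - {{}} \<subseteq> B"
        using mem F(1) by blast
      ultimately show ?thesis
        unfolding D_def using V(2) by (auto intro!: exI[of _ "(from_nat_into (insert {} F) ` {..n}) - {{}}"])
    qed
    have W_eq: "(\<lambda>x. indicator (W n) x * indicator V x) = (indicator (W n) :: 'g \<Rightarrow> complex)" for n
      using WV[of n] by (auto simp: indicator_def fun_eq_iff)
    have "(\<lambda>n. l2norm \<mu> (\<lambda>x. indicator (W n) x * indicator V x - indicator V x * indicator V x)) \<longlonglongrightarrow> 0"
    proof (rule L2_indicator_tendsto[OF VL])
      show "incseq W"
        unfolding W_def incseq_def by (auto intro: order_trans)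
    qed (use WV W_UN Wopen V in \<open>auto simp: sets_haar\<close>)
    then have lim: "(\<lambda>n. l2norm \<mu> (\<lambda>x. indicator (W n) x - indicator V x)) \<longlonglongrightarrow> 0"
      using W_eq by (simp add: fun_eq_iff indicator_inter_arith[symmetric])
    show "?P (indicator V)"
    proof (rule residual_tendsto_approx[OF on VL])
      fix \<epsilon> :: real assume "\<epsilon> > 0"
      from order_tendstoD(2)[OF lim this] obtain n where
        n: "l2norm \<mu> (\<lambda>x. indicator (W n) x - indicator V x) < \<epsilon>"
        by (auto simp: eventually_sequentially)
      obtain k where k: "from_nat_into D k = W n"
        using from_nat_into_surj[OF cD WD] by blast
      show "\<exists>g\<in>L2 \<mu>. ?P g \<and> l2norm \<mu> (\<lambda>x. g x - indicator V x) < \<epsilon>"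
        using n k d[of k] residual_gram_schmidt_tendsto[where d = d and k = k, OF d]
        by (intro bexI[of _ "d k"]) (auto simp: d_def)
    qed
  qed (rule residual_tendsto_add[OF on] residual_tendsto_scale residual_tendsto_approx[OF on]; assumption)+
  then show thesis
    using on that unfolding complete_orthonormal_def by blast
qed

section \<open>Translations and the Fourier algebra\<close>

lemma tendsto_mult_group:
  "(f \<longlongrightarrow> a) F \<Longrightarrow> (g \<longlongrightarrow> b) F \<Longrightarrow> ((\<lambda>x. f x \<odot> g x) \<longlongrightarrow> a \<odot> b) F"
  using isCont_tendsto_compose[of "(a, b)" "\<lambda>p. fst p \<odot> snd p" "\<lambda>x. (f x, g x)" F] continuous_mult_pair
  by (simp add: continuous_on_eq_continuous_at tendsto_Pair)

lemma L2_left_translation: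
  assumes "\<xi> \<in> L2 \<mu>"
  shows "(\<lambda>y. \<xi> (s \<odot> y)) \<in> L2 \<mu>"
proof -
  have [measurable]: "\<xi> \<in> borel_measurable borel"
    using L2_measurable[OF assms] by simp
  show ?thesis
    using integrable_left_translation[OF L2_integrable[OF assms]] unfolding L2_def by simp
qed

lemma ip_left_translation:
  assumes "\<xi> \<in> L2 \<mu>" "\<eta> \<in> L2 \<mu>"
  shows "ip \<mu> (\<lambda>y. \<xi> (s \<odot> y)) (\<lambda>y. \<eta> (s \<odot> y)) = ip \<mu> \<xi> \<eta>"
proof -
  have [measurable]: "\<xi> \<in> borel_measurable borel" "\<eta> \<in> borel_measurable borel"
    using assms[THEN L2_measurable] by simp_all
  show ?thesis
    unfolding ip_def by (rule integral_left_translation) measurable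
qed

lemma l2norm_left_translation:
  assumes "\<xi> \<in> L2 \<mu>"
  shows "l2norm \<mu> (\<lambda>y. \<xi> (s \<odot> y)) = l2norm \<mu> \<xi>"
  using ip_left_translation[OF assms assms] unfolding ip_self
  by (metis l2norm_nonneg of_real_eq_iff power2_eq_imp_eq)

text \<open>For the indicator of an open set all translates have the same norm, so norm convergence
  follows from convergence of the inner products with the limit. Those converge by domination: only
  points with \<open>s \<odot> y \<in> V\<close> contribute, and there openness gives
  \<open>x n \<odot> y \<in> V\<close> eventually.\<close>

lemma left_translation_tendsto:
  assumes "\<xi> \<in> L2 \<mu>" "x \<longlonglongrightarrow> s"
  shows "(\<lambda>n. l2norm \<mu> (\<lambda>y. \<xi> (x n \<odot> y) - \<xi> (s \<odot> y))) \<longlonglongrightarrow> 0"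
  using assms(1)
proof (rule L2_induct_open)
  fix V :: "'g set" assume V: "open V" "emeasure \<mu> V < \<infinity>"
  have VL: "(indicator V :: 'g \<Rightarrow> complex) \<in> L2 \<mu>"
    using V by (intro L2_indicator) (auto simp: sets_haar)
  have [measurable]: "V \<in> sets borel"
    using V by simp
  define I where "I n = (\<lambda>y. indicator V (x n \<odot> y) :: complex)" for n
  define J where "J = (\<lambda>y. indicator V (s \<odot> y) :: complex)"
  have L: "I n \<in> L2 \<mu>" "J \<in> L2 \<mu>" for n
    unfolding I_def J_def by (rule L2_left_translation[OF VL])+
  have norms: "l2norm \<mu> (I n) = l2norm \<mu> J" for n
    unfolding I_def J_def l2norm_left_translation[OF VL] ..
  have "(\<lambda>n. ip \<mu> (I n) J) \<longlonglongrightarrow> ip \<mu> J J"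
    unfolding ip_def
  proof (rule integral_dominated_convergence)
    show "integrable \<mu> (\<lambda>y. (cmod (J y))\<^sup>2)"
      by (rule L2_integrable[OF L(2)])
    show "AE y in \<mu>. norm (I n y * cnj (J y)) \<le> (cmod (J y))\<^sup>2" for n
      by (simp add: I_def J_def indicator_def)
    show "AE y in \<mu>. (\<lambda>n. I n y * cnj (J y)) \<longlonglongrightarrow> J y * cnj (J y)"
    proof (rule AE_I2)
      fix y
      show "(\<lambda>n. I n y * cnj (J y)) \<longlonglongrightarrow> J y * cnj (J y)"
      proof (cases "s \<odot> y \<in> V")
        case True
        have "(\<lambda>n. x n \<odot> y) \<longlonglongrightarrow> s \<odot> y"
          by (intro tendsto_mult_group assms tendsto_const)
        then have "\<forall>\<^sub>F n in sequentially. x n \<odot> y \<in> V"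
          using V(1) True by (rule topological_tendstoD)
        then have "\<forall>\<^sub>F n in sequentially. I n y * cnj (J y) = J y * cnj (J y)"
          by eventually_elim (simp add: I_def J_def True)
        then show ?thesis
          by (rule tendsto_eventually)
      qed (simp add: J_def)
    qed
  qed (use L in measurable)
  then have "(\<lambda>n. Re (ip \<mu> (I n) J)) \<longlonglongrightarrow> (l2norm \<mu> J)\<^sup>2"
    using tendsto_Re by (fastforce simp: ip_self)
  then have "(\<lambda>n. (l2norm \<mu> J)\<^sup>2 - 2 * Re (ip \<mu> (I n) J) + (l2norm \<mu> J)\<^sup>2) \<longlonglongrightarrow>
      (l2norm \<mu> J)\<^sup>2 - 2 * (l2norm \<mu> J)\<^sup>2 + (l2norm \<mu> J)\<^sup>2"
    by (intro tendsto_intros)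
  then have "(\<lambda>n. (l2norm \<mu> (\<lambda>y. I n y - J y))\<^sup>2) \<longlonglongrightarrow> 0"
    using L by (simp add: l2norm_diff_power2 norms)
  then have "(\<lambda>n. sqrt ((l2norm \<mu> (\<lambda>y. I n y - J y))\<^sup>2)) \<longlonglongrightarrow> sqrt 0"
    by (rule tendsto_real_sqrt)
  then show "(\<lambda>n. l2norm \<mu> (\<lambda>y. indicator V (x n \<odot> y) - indicator V (s \<odot> y))) \<longlonglongrightarrow> 0"
    by (simp add: I_def J_def)
next
  fix f g :: "'g \<Rightarrow> complex"
  assume fg: "f \<in> L2 \<mu>" "g \<in> L2 \<mu>"
    and lim: "(\<lambda>n. l2norm \<mu> (\<lambda>y. f (x n \<odot> y) - f (s \<odot> y))) \<longlonglongrightarrow> 0"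
      "(\<lambda>n. l2norm \<mu> (\<lambda>y. g (x n \<odot> y) - g (s \<odot> y))) \<longlonglongrightarrow> 0"
  show "(\<lambda>n. l2norm \<mu> (\<lambda>y. (f (x n \<odot> y) + g (x n \<odot> y)) - (f (s \<odot> y) + g (s \<odot> y)))) \<longlonglongrightarrow> 0"
  proof (rule tendsto_sandwich[OF _ _ tendsto_const])
    show "(\<lambda>n. l2norm \<mu> (\<lambda>y. f (x n \<odot> y) - f (s \<odot> y)) + l2norm \<mu> (\<lambda>y. g (x n \<odot> y) - g (s \<odot> y))) \<longlonglongrightarrow> 0"
      using tendsto_add[OF lim] by simp
    have "l2norm \<mu> (\<lambda>y. (f (x n \<odot> y) + g (x n \<odot> y)) - (f (s \<odot> y) + g (s \<odot> y)))
      \<le> l2norm \<mu> (\<lambda>y. f (x n \<odot> y) - f (s \<odot> y)) + l2norm \<mu> (\<lambda>y. g (x n \<odot> y) - g (s \<odot> y))" for n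
      using l2norm_triangle[OF L2_diff[OF fg(1)[THEN L2_left_translation] fg(1)[THEN L2_left_translation]]
          L2_diff[OF fg(2)[THEN L2_left_translation] fg(2)[THEN L2_left_translation]], of "x n" s "x n" s]
      by (simp add: add_diff_add)
    then show "\<forall>\<^sub>F n in sequentially. l2norm \<mu> (\<lambda>y. (f (x n \<odot> y) + g (x n \<odot> y)) - (f (s \<odot> y) + g (s \<odot> y)))
      \<le> l2norm \<mu> (\<lambda>y. f (x n \<odot> y) - f (s \<odot> y)) + l2norm \<mu> (\<lambda>y. g (x n \<odot> y) - g (s \<odot> y))"
      by simp
  qed simp
next
  fix f :: "'g \<Rightarrow> complex" and c
  assume "(\<lambda>n. l2norm \<mu> (\<lambda>y. f (x n \<odot> y) - f (s \<odot> y))) \<longlonglongrightarrow> 0"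
  then show "(\<lambda>n. l2norm \<mu> (\<lambda>y. c * f (x n \<odot> y) - c * f (s \<odot> y))) \<longlonglongrightarrow> 0"
    unfolding right_diff_distrib[symmetric] l2norm_scale by (rule tendsto_mult_right_zero)
next
  fix f assume f: "f \<in> L2 \<mu>"
    and approx: "\<And>\<epsilon>. \<epsilon> > 0 \<Longrightarrow> \<exists>g\<in>L2 \<mu>. (\<lambda>n. l2norm \<mu> (\<lambda>y. g (x n \<odot> y) - g (s \<odot> y))) \<longlonglongrightarrow> 0 \<and>
      l2norm \<mu> (\<lambda>x. g x - f x) < \<epsilon>"
  show "(\<lambda>n. l2norm \<mu> (\<lambda>y. f (x n \<odot> y) - f (s \<odot> y))) \<longlonglongrightarrow> 0"
  proof (rule tendstoI)
    fix \<epsilon> :: real assume "\<epsilon> > 0"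
    then obtain g where g: "g \<in> L2 \<mu>" "(\<lambda>n. l2norm \<mu> (\<lambda>y. g (x n \<odot> y) - g (s \<odot> y))) \<longlonglongrightarrow> 0"
        "l2norm \<mu> (\<lambda>x. g x - f x) < \<epsilon> / 3"
      using approx[of "\<epsilon> / 3"] by auto
    have "\<forall>\<^sub>F n in sequentially. l2norm \<mu> (\<lambda>y. g (x n \<odot> y) - g (s \<odot> y)) < \<epsilon> / 3"
      by (intro order_tendstoD(2)[OF g(2)]) (use \<open>\<epsilon> > 0\<close> in simp)
    then show "\<forall>\<^sub>F n in sequentially. dist (l2norm \<mu> (\<lambda>y. f (x n \<odot> y) - f (s \<odot> y))) 0 < \<epsilon>"
    proof eventually_elim
      case (elim n)
      note F = L2_left_translation[OF f] and G = L2_left_translation[OF g(1)]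
      have d: "l2norm \<mu> (\<lambda>y. g (r \<odot> y) - f (r \<odot> y)) = l2norm \<mu> (\<lambda>x. g x - f x)" for r
        using l2norm_left_translation[OF L2_diff[OF g(1) f], of r] .
      have "l2norm \<mu> (\<lambda>y. f (x n \<odot> y) - f (s \<odot> y))
          \<le> l2norm \<mu> (\<lambda>y. f (x n \<odot> y) - g (x n \<odot> y)) + l2norm \<mu> (\<lambda>y. g (x n \<odot> y) - f (s \<odot> y))"
        by (rule l2norm_triangle_diff[OF F G F])
      also have "l2norm \<mu> (\<lambda>y. g (x n \<odot> y) - f (s \<odot> y))
          \<le> l2norm \<mu> (\<lambda>y. g (x n \<odot> y) - g (s \<odot> y)) + l2norm \<mu> (\<lambda>y. g (s \<odot> y) - f (s \<odot> y))"
        by (rule l2norm_triangle_diff[OF G G F])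
      finally show ?case
        using elim g(3) d[of "x n"] d[of s] l2norm_minus_commute[of \<mu> "\<lambda>y. f (x n \<odot> y)" "\<lambda>y. g (x n \<odot> y)"]
        by simp
    qed
  qed
qed

section \<open>Coefficient functions and closedness of the support\<close>

lemma continuous_coefficient:
  assumes "\<xi> \<in> L2 \<mu>" "h \<in> L2 \<mu>"
  shows "continuous_on UNIV (\<lambda>s. ip \<mu> (\<lambda>y. \<xi> (s \<odot> y)) h)"
proof (rule continuous_on_sequentiallyI)
  fix x :: "nat \<Rightarrow> 'g" and s assume "x \<longlonglongrightarrow> s"
  then show "(\<lambda>n. ip \<mu> (\<lambda>y. \<xi> (x n \<odot> y)) h) \<longlonglongrightarrow> ip \<mu> (\<lambda>y. \<xi> (s \<odot> y)) h"
    using assms by (intro ip_tendsto_left left_translation_tendsto L2_left_translation)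
qed

lemma continuous_fourier_alg:
  assumes "u \<in> fourier_alg (\<odot>) iv \<mu>"
  shows "continuous_on UNIV u"
proof -
  obtain \<xi> \<eta> where \<xi>: "\<xi> \<in> L2 \<mu>" "\<eta> \<in> L2 \<mu>" "\<And>x. u x = ip \<mu> (\<lambda>y. \<xi> (iv x \<odot> y)) \<eta>"
    using assms by (auto simp: fourier_alg_def)
  have "u = (\<lambda>x. ip \<mu> (\<lambda>y. \<xi> (iv x \<odot> y)) \<eta>)"
    using \<xi>(3) by auto
  then show ?thesis
    using continuous_on_compose2[OF continuous_coefficient[OF \<xi>(1,2)] continuous_iv] by simp
qed

lemma closed_supp_G: "closed (supp_G (\<odot>) iv \<mu> U)"
proof -
  have "supp_G (\<odot>) iv \<mu> U = (\<Inter>u\<in>I_U (\<odot>) iv \<mu> U. {x. u x = 0})"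
    by (auto simp: supp_G_def)
  moreover have "closed {x. u x = 0}" if "u \<in> I_U (\<odot>) iv \<mu> U" for u
    using that continuous_fourier_alg by (intro closed_Collect_eq) (auto simp: I_U_def)
  ultimately show ?thesis
    by auto
qed

lemma closed_estar:
  assumes "closed E"
  shows "closed (estar (\<odot>) iv E)"
proof -
  have "estar (\<odot>) iv E = (\<lambda>p. snd p \<odot> iv (fst p)) -` E"
    by (auto simp: estar_def)
  then show ?thesis
    using assms by (auto intro!: closed_vimage continuous_intros)
qed

text \<open>Translating both vectors by \<open>t\<close> separates the variables. This Gram kernel
  form is what allows \<open>N(u)\<close> to be expanded in an orthonormal sequence and
  \<open>u\<close> to be read as an overlap measure.\<close>

lemma Nmap_coefficient:
  assumes \<xi>: "\<xi> \<in> L2 \<mu>" and \<eta>: "\<eta> \<in> L2 \<mu>" and u: "\<And>x. u x = ip \<mu> (\<lambda>y. \<xi> (iv x \<odot> y)) \<eta>"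
  shows "Nmap (\<odot>) iv u (s, t) = ip \<mu> (\<lambda>y. \<xi> (s \<odot> y)) (\<lambda>y. \<eta> (t \<odot> y))"
  using ip_left_translation[OF L2_left_translation[OF \<xi>] \<eta>, of "iv (t \<odot> iv s)" t]
  by (simp add: Nmap_def u inv_mult assoc)

text \<open>Near \<open>(s\<^sub>0, t\<^sub>0)\<close> the vectors \<open>\<xi>(s \<cdot>)\<close> and \<open>\<eta>(t \<cdot>)\<close> are almost constant, so \<open>N(u)\<close> is there the
  nonzero constant \<open>u(t\<^sub>0 s\<^sub>0\<^sup>-\<^sup>1)\<close> plus a multiplier of small norm. Hence any bound for \<open>T\<close> on a small
  rectangle improves by a factor \<open>1/2\<close>.\<close>

lemma schur_zero_halves_bound:
  assumes T: "bop \<mu> T" and \<xi>: "\<xi> \<in> L2 \<mu>" and \<eta>: "\<eta> \<in> L2 \<mu>"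
    and u: "\<And>x. u x = ip \<mu> (\<lambda>y. \<xi> (iv x \<odot> y)) \<eta>"
    and zero: "schur_zero \<mu> (Nmap (\<odot>) iv u) T"
    and W: "\<And>s. s \<in> W \<Longrightarrow> l2norm \<mu> (\<lambda>y. \<xi> (s \<odot> y) - \<xi> (s0 \<odot> y)) \<le> \<delta>"
    and Z: "\<And>t. t \<in> Z \<Longrightarrow> l2norm \<mu> (\<lambda>y. \<eta> (t \<odot> y) - \<eta> (t0 \<odot> y)) \<le> \<delta>"
    and \<delta>: "0 \<le> \<delta>" "\<delta> * (l2norm \<mu> \<xi> + l2norm \<mu> \<eta>) \<le> cmod (u (t0 \<odot> iv s0)) / 2"
    and c: "u (t0 \<odot> iv s0) \<noteq> 0"
    and D: "0 \<le> D" "\<And>f g. f \<in> L2 \<mu> \<Longrightarrow> g \<in> L2 \<mu> \<Longrightarrow> {x. f x \<noteq> 0} \<subseteq> W \<Longrightarrow> {x. g x \<noteq> 0} \<subseteq> Z \<Longrightarrow>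
      cmod (ip \<mu> (T f) g) \<le> D * l2norm \<mu> f * l2norm \<mu> g"
    and f: "f \<in> L2 \<mu>" "{x. f x \<noteq> 0} \<subseteq> W" and g: "g \<in> L2 \<mu>" "{x. g x \<noteq> 0} \<subseteq> Z"
  shows "cmod (ip \<mu> (T f) g) \<le> D / 2 * l2norm \<mu> f * l2norm \<mu> g"
proof -
  obtain b where b: "complete_orthonormal \<mu> b"
    by (rule complete_orthonormal_exists)
  have bL: "b i \<in> L2 \<mu>" for i
    by (rule complete_orthonormal_L2[OF b])
  have b1: "l2norm \<mu> (b i) \<le> 1" for i
    using complete_orthonormal_upto[OF b, of "Suc i"] by (auto simp: orthonormal_upto_def)
  \<comment> \<open>Coordinates of the translated vectors: Parseval gives \<open>N(u)(s, t)\<close>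
    as the sum of \<open>A \<xi> i s * cnj (A \<eta> i t)\<close>, and Bessel bounds their squares
    uniformly in the point.\<close>
  define A where "A \<zeta> i s = ip \<mu> (\<lambda>y. \<zeta> (s \<odot> y)) (b i)" for \<zeta> i s
  note tr = L2_left_translation
  have A_meas: "A \<zeta> i \<in> borel_measurable \<mu>" if "\<zeta> \<in> L2 \<mu>" for \<zeta> i
    using borel_measurable_continuous_onI[OF continuous_coefficient[OF that bL[of i]]]
    by (simp add: A_def[abs_def])
  have A_le: "cmod (A \<zeta> i s) \<le> l2norm \<mu> \<zeta>" if "\<zeta> \<in> L2 \<mu>" for \<zeta> i s
  proof -
    have "cmod (A \<zeta> i s) \<le> l2norm \<mu> \<zeta> * l2norm \<mu> (b i)"
      unfolding A_def using Cauchy_Schwarz_ip[OF tr[OF that] bL] l2norm_left_translation[OF that] by metis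
    also have "\<dots> \<le> l2norm \<mu> \<zeta> * 1"
      by (intro mult_left_mono b1) simp
    finally show ?thesis by simp
  qed
  have A_Bessel: "(\<Sum>i<n. (cmod (A \<zeta> i s))\<^sup>2) \<le> (l2norm \<mu> \<zeta>)\<^sup>2" if "\<zeta> \<in> L2 \<mu>" for \<zeta> s n
    using Bessel_inequality[OF complete_orthonormal_upto[OF b] tr[OF that]]
    by (simp add: A_def l2norm_left_translation[OF that])
  have A_diff_Bessel: "(\<Sum>i<n. (cmod (A \<zeta> i s - A \<zeta> i r))\<^sup>2) \<le> \<delta>\<^sup>2"
    if "\<zeta> \<in> L2 \<mu>" "l2norm \<mu> (\<lambda>y. \<zeta> (s \<odot> y) - \<zeta> (r \<odot> y)) \<le> \<delta>" for \<zeta> s r n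
  proof -
    have "(\<Sum>i<n. (cmod (A \<zeta> i s - A \<zeta> i r))\<^sup>2) \<le> (l2norm \<mu> (\<lambda>y. \<zeta> (s \<odot> y) - \<zeta> (r \<odot> y)))\<^sup>2"
      using Bessel_inequality[OF complete_orthonormal_upto[OF b] L2_diff[OF tr[OF that(1)] tr[OF that(1)]]]
      by (simp add: A_def ip_diff_left[OF tr[OF that(1)] tr[OF that(1)] bL])
    also have "\<dots> \<le> \<delta>\<^sup>2"
      using that(2) by (intro power_mono) auto
    finally show ?thesis .
  qed
  have Af: "(\<lambda>x. A \<zeta> i x * h x) \<in> L2 \<mu>" and Adf: "(\<lambda>x. (A \<zeta> i x - A \<zeta> i r) * h x) \<in> L2 \<mu>"
    if "\<zeta> \<in> L2 \<mu>" "h \<in> L2 \<mu>" for \<zeta> h i r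
  proof -
    show "(\<lambda>x. A \<zeta> i x * h x) \<in> L2 \<mu>"
      by (rule L2_mult_bounded[OF that(2) A_meas[OF that(1)] A_le[OF that(1)]])
    from L2_diff[OF this L2_scale[OF that(2), of "A \<zeta> i r"]]
    show "(\<lambda>x. (A \<zeta> i x - A \<zeta> i r) * h x) \<in> L2 \<mu>"
      by (simp add: left_diff_distrib)
  qed
  define F where "F i = (\<lambda>x. A \<xi> i x * f x)" for i
  define G where "G i = (\<lambda>x. A \<eta> i x * g x)" for i
  \<comment> \<open>The primed functions measure the deviation from the values at the centre; they
    are small because the translated vectors vary by at most \<open>\<delta>\<close> on
    \<open>W\<close> and \<open>Z\<close>.\<close>
  define F' where "F' i = (\<lambda>x. (A \<xi> i x - A \<xi> i s0) * f x)" for i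
  define G' where "G' i = (\<lambda>x. (A \<eta> i x - A \<eta> i t0) * g x)" for i
  have L: "F i \<in> L2 \<mu>" "G i \<in> L2 \<mu>" "F' i \<in> L2 \<mu>" "G' i \<in> L2 \<mu>" for i
    unfolding F_def G_def F'_def G'_def using Af Adf \<xi> \<eta> f(1) g(1) by blast+
  have F_sum: "(\<Sum>i<n. (l2norm \<mu> (F i))\<^sup>2) \<le> (l2norm \<mu> \<xi> * l2norm \<mu> f)\<^sup>2" for n
    unfolding F_def using Af[OF \<xi> f(1)] f(1) A_Bessel[OF \<xi>] by (rule sum_l2norm_mult_le)
  have G_sum: "(\<Sum>i<n. (l2norm \<mu> (G i))\<^sup>2) \<le> (l2norm \<mu> \<eta> * l2norm \<mu> g)\<^sup>2" for n
    unfolding G_def using Af[OF \<eta> g(1)] g(1) A_Bessel[OF \<eta>] by (rule sum_l2norm_mult_le)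
  have F'_sum: "(\<Sum>i<n. (l2norm \<mu> (F' i))\<^sup>2) \<le> (\<delta> * l2norm \<mu> f)\<^sup>2" for n
    unfolding F'_def using Adf[OF \<xi> f(1)] f(1)
  proof (rule sum_l2norm_mult_le)
    fix x assume "f x \<noteq> 0"
    with f(2) have "x \<in> W" by blast
    then show "(\<Sum>i<n. (cmod (A \<xi> i x - A \<xi> i s0))\<^sup>2) \<le> \<delta>\<^sup>2"
      by (intro A_diff_Bessel \<xi> W)
  qed
  have G'_sum: "(\<Sum>i<n. (l2norm \<mu> (G' i))\<^sup>2) \<le> (\<delta> * l2norm \<mu> g)\<^sup>2" for n
    unfolding G'_def using Adf[OF \<eta> g(1)] g(1)
  proof (rule sum_l2norm_mult_le)
    fix x assume "g x \<noteq> 0"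
    with g(2) have "x \<in> Z" by blast
    then show "(\<Sum>i<n. (cmod (A \<eta> i x - A \<eta> i t0))\<^sup>2) \<le> \<delta>\<^sup>2"
      by (intro A_diff_Bessel \<eta> Z)
  qed
  \<comment> \<open>The elementary tensor of \<open>f\<close> and \<open>g\<close>, padded with
    zeros to an infinite representation.\<close>
  define f0 where "f0 i = (if i = (0::nat) then f else (\<lambda>x. 0))" for i
  define g0 where "g0 i = (if i = (0::nat) then g else (\<lambda>x. 0))" for i
  have rep0: "tc_rep \<mu> f0 g0"
  proof -
    have "summable (\<lambda>i. (l2norm \<mu> (f0 i))\<^sup>2)" "summable (\<lambda>i. (l2norm \<mu> (g0 i))\<^sup>2)"
      by (rule summable_finite[of "{0}"]; simp add: f0_def g0_def l2norm_def)+
    then show ?thesis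
      using f(1) g(1) L2_zero by (auto simp: tc_rep_def f0_def g0_def)
  qed
  have rep: "tc_rep \<mu> F G"
  proof -
    have "summable (\<lambda>i. (l2norm \<mu> (F i))\<^sup>2)"
      by (rule summableI_nonneg_bounded[OF _ F_sum]) simp
    moreover have "summable (\<lambda>i. (l2norm \<mu> (G i))\<^sup>2)"
      by (rule summableI_nonneg_bounded[OF _ G_sum]) simp
    ultimately show ?thesis
      using L by (simp add: tc_rep_def)
  qed
  have sums_N: "(\<lambda>i. A \<xi> i s * cnj (A \<eta> i t)) sums Nmap (\<odot>) iv u (s, t)" for s t
    unfolding Nmap_coefficient[OF \<xi> \<eta> u] A_def by (rule Parseval_sums[OF b tr[OF \<xi>] tr[OF \<eta>]])
  have "Nmap (\<odot>) iv u p * tc_fun f0 g0 p = tc_fun F G p" for p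
  proof (cases p)
    case (Pair s t)
    have "(\<Sum>i. f0 i s * cnj (g0 i t)) = f s * cnj (g t)"
      by (subst suminf_finite[of "{0}"]) (auto simp: f0_def g0_def)
    moreover have "(\<lambda>i. A \<xi> i s * cnj (A \<eta> i t) * (f s * cnj (g t))) sums (Nmap (\<odot>) iv u (s, t) * (f s * cnj (g t)))"
      by (rule sums_mult2[OF sums_N])
    then have "(\<lambda>i. F i s * cnj (G i t)) sums (Nmap (\<odot>) iv u (s, t) * (f s * cnj (g t)))"
      by (simp add: F_def G_def mult_ac)
    ultimately show ?thesis
      unfolding tc_fun_def Pair by (simp add: sums_iff)
  qed
  then have "marg_null \<mu> {p. Nmap (\<odot>) iv u p * tc_fun f0 g0 p \<noteq> tc_fun F G p}"
    unfolding marg_null_def by (intro bexI[of _ "{}"]) auto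
  then have "tc_pair \<mu> T F G = 0"
    using zero rep rep0 unfolding schur_zero_def by blast
  then have sums0: "(\<lambda>i. ip \<mu> (T (F i)) (G i)) sums 0"
    using summable_ip_bop[OF T rep] unfolding tc_pair_def by (simp add: sums_iff)
  \<comment> \<open>The terms \<open>ip \<mu> (T (F i)) (G i)\<close> sum to 0, so \<open>r\<close>
    sums to the constant \<open>u (t0 \<odot> iv s0)\<close> times \<open>ip \<mu> (T f) g\<close>.
    Changing one factor at a time writes each \<open>r i\<close> through the small functions
    \<open>F' i\<close> and \<open>G' i\<close>.\<close>
  define r where "r i = A \<xi> i s0 * cnj (A \<eta> i t0) * ip \<mu> (T f) g - ip \<mu> (T (F i)) (G i)" for i
  have r_sums: "r sums (u (t0 \<odot> iv s0) * ip \<mu> (T f) g)"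
    using sums_diff[OF sums_mult2[OF sums_N[of s0 t0]] sums0, of "ip \<mu> (T f) g"]
    by (simp add: r_def[abs_def] Nmap_def)
  have r_eq: "r i = - (ip \<mu> (T (F' i)) (G i) + A \<xi> i s0 * ip \<mu> (T f) (G' i))" for i
  proof -
    have "F' i = (\<lambda>x. F i x - A \<xi> i s0 * f x)"
      by (simp add: F_def F'_def left_diff_distrib)
    then have 1: "ip \<mu> (T (F' i)) (G i) = ip \<mu> (T (F i)) (G i) - A \<xi> i s0 * ip \<mu> (T f) (G i)"
      using ip_bop_diff[OF T L(1)[of i] L2_scale[OF f(1)] L(2)[of i]] ip_bop_scale[OF T f(1) L(2)[of i]] by simp
    have "G' i = (\<lambda>x. G i x - A \<eta> i t0 * g x)"
      by (simp add: G_def G'_def left_diff_distrib)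
    then have 2: "ip \<mu> (T f) (G' i) = ip \<mu> (T f) (G i) - cnj (A \<eta> i t0) * ip \<mu> (T f) g"
      using ip_diff_right[OF L(2)[of i] L2_scale[OF g(1)] bop_L2[OF T f(1)]] by (simp add: ip_scale_right)
    show ?thesis
      by (simp add: r_def 1 2 algebra_simps)
  qed
  have supp: "{x. G i x \<noteq> 0} \<subseteq> Z" "{x. F' i x \<noteq> 0} \<subseteq> W" "{x. G' i x \<noteq> 0} \<subseteq> Z" for i
    using f(2) g(2) by (auto simp: G_def F'_def G'_def)
  have r_le: "cmod (r i) \<le> D * (l2norm \<mu> (F' i) * l2norm \<mu> (G i))
      + D * l2norm \<mu> f * (cmod (A \<xi> i s0) * l2norm \<mu> (G' i))" for i
  proof -
    have "cmod (r i) \<le> cmod (ip \<mu> (T (F' i)) (G i)) + cmod (A \<xi> i s0) * cmod (ip \<mu> (T f) (G' i))"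
      unfolding r_eq norm_minus_cancel by (metis norm_mult norm_triangle_ineq)
    also have "\<dots> \<le> D * l2norm \<mu> (F' i) * l2norm \<mu> (G i)
        + cmod (A \<xi> i s0) * (D * l2norm \<mu> f * l2norm \<mu> (G' i))"
      using D(2)[OF L(3) L(2) supp(2,1), of i i] D(2)[OF f(1) L(4) f(2) supp(3), of i]
      by (intro add_mono mult_left_mono) auto
    finally show ?thesis
      by (simp add: mult_ac)
  qed
  have "(\<Sum>i<n. cmod (r i)) \<le> D * (cmod (u (t0 \<odot> iv s0)) / 2) * l2norm \<mu> f * l2norm \<mu> g" for n
  proof -
    have "(\<Sum>i<n. cmod (r i)) \<le> (\<Sum>i<n. D * (l2norm \<mu> (F' i) * l2norm \<mu> (G i))
      + D * l2norm \<mu> f * (cmod (A \<xi> i s0) * l2norm \<mu> (G' i)))"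
      by (rule sum_mono[OF r_le])
    also have "\<dots> = D * (\<Sum>i<n. l2norm \<mu> (F' i) * l2norm \<mu> (G i))
      + D * l2norm \<mu> f * (\<Sum>i<n. cmod (A \<xi> i s0) * l2norm \<mu> (G' i))"
      by (simp add: sum.distrib sum_distrib_left)
    \<comment> \<open>Each sum pairs one deviation of size \<open>\<delta>\<close> with one full
      vector, which yields the factor
      \<open>\<delta> * (l2norm \<mu> \<xi> + l2norm \<mu> \<eta>)\<close> of the
      hypothesis.\<close>
    also have "\<dots> \<le> D * ((\<delta> * l2norm \<mu> f) * (l2norm \<mu> \<eta> * l2norm \<mu> g))
      + D * l2norm \<mu> f * (l2norm \<mu> \<xi> * (\<delta> * l2norm \<mu> g))"
      using \<delta>(1) D(1) F'_sum G_sum G'_sum A_Bessel[OF \<xi>]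
      by (intro add_mono mult_left_mono Cauchy_Schwarz_sum_le) auto
    also have "\<dots> = (\<delta> * (l2norm \<mu> \<xi> + l2norm \<mu> \<eta>)) * (D * l2norm \<mu> f * l2norm \<mu> g)"
      by (simp add: algebra_simps)
    also have "\<dots> \<le> (cmod (u (t0 \<odot> iv s0)) / 2) * (D * l2norm \<mu> f * l2norm \<mu> g)"
      using D(1) by (intro mult_right_mono \<delta>(2)) auto
    finally show ?thesis
      by (simp add: mult_ac)
  qed
  then have "cmod (\<Sum>i<n. r i) \<le> D * (cmod (u (t0 \<odot> iv s0)) / 2) * l2norm \<mu> f * l2norm \<mu> g" for n
    by (rule order_trans[OF norm_sum])
  then have "cmod (u (t0 \<odot> iv s0) * ip \<mu> (T f) g) \<le> D * (cmod (u (t0 \<odot> iv s0)) / 2) * l2norm \<mu> f * l2norm \<mu> g"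
    using tendsto_norm[OF r_sums[unfolded sums_def]] by (intro LIMSEQ_le_const2) auto
  then have "cmod (u (t0 \<odot> iv s0)) * cmod (ip \<mu> (T f) g)
      \<le> cmod (u (t0 \<odot> iv s0)) * (D / 2 * l2norm \<mu> f * l2norm \<mu> g)"
    by (simp add: norm_mult mult_ac)
  then show ?thesis
    using c by simp
qed

text \<open>First countability turns sequential continuity of translation into a statement about
  neighbourhoods.\<close>

lemma translation_neighbourhood:
  assumes "\<xi> \<in> L2 \<mu>" "0 < \<delta>"
  obtains W where "open W" "s0 \<in> W" "\<And>s. s \<in> W \<Longrightarrow> l2norm \<mu> (\<lambda>y. \<xi> (s \<odot> y) - \<xi> (s0 \<odot> y)) \<le> \<delta>"
proof -
  have "\<forall>\<^sub>F s in nhds s0. l2norm \<mu> (\<lambda>y. \<xi> (s \<odot> y) - \<xi> (s0 \<odot> y)) < \<delta>"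
    unfolding eventually_nhds_iff_sequentially
    using order_tendstoD(2)[OF left_translation_tendsto[OF assms(1)] assms(2)] by blast
  then show thesis
    unfolding eventually_nhds using that by (metis less_imp_le)
qed

text \<open>The rectangle is fixed once; on it the halving step can be iterated from the operator
  bound \<open>C\<close>, so every bound \<open>C / 2 ^ k\<close> holds and the pairing is zero. The
  induction ranges over all pairs supported in \<open>W\<close> and \<open>Z\<close>, since the
  halving step uses the old bound for other functions than \<open>f\<close> and
  \<open>g\<close>.\<close>

lemma schur_zero_vanishes_near:
  assumes T: "bop \<mu> T" and u: "u \<in> fourier_alg (\<odot>) iv \<mu>"
    and zero: "schur_zero \<mu> (Nmap (\<odot>) iv u) T" and c: "u (t0 \<odot> iv s0) \<noteq> 0"
  obtains W Z where "open W" "open Z" "s0 \<in> W" "t0 \<in> Z" "vanishes_on \<mu> T W Z"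
proof -
  obtain \<xi> \<eta> where \<xi>: "\<xi> \<in> L2 \<mu>" and \<eta>: "\<eta> \<in> L2 \<mu>" and u: "\<And>x. u x = ip \<mu> (\<lambda>y. \<xi> (iv x \<odot> y)) \<eta>"
    using u by (auto simp: fourier_alg_def)
  \<comment> \<open>The summand 1 keeps the denominator positive; \<open>\<delta>\<close> is chosen
    to meet the smallness condition of the halving step.\<close>
  define \<delta> where "\<delta> = cmod (u (t0 \<odot> iv s0)) / (2 * (l2norm \<mu> \<xi> + l2norm \<mu> \<eta> + 1))"
  have pos: "l2norm \<mu> \<xi> + l2norm \<mu> \<eta> + 1 > 0"
    by (simp add: add_nonneg_pos)
  have \<delta>: "0 < \<delta>"
    using c pos by (simp add: \<delta>_def)
  have "\<delta> * (l2norm \<mu> \<xi> + l2norm \<mu> \<eta>) \<le> \<delta> * (l2norm \<mu> \<xi> + l2norm \<mu> \<eta> + 1)"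
    using \<delta> by simp
  also have "\<dots> = cmod (u (t0 \<odot> iv s0)) / 2"
    using pos by (simp add: \<delta>_def field_simps)
  finally have \<delta>': "\<delta> * (l2norm \<mu> \<xi> + l2norm \<mu> \<eta>) \<le> cmod (u (t0 \<odot> iv s0)) / 2" .
  obtain W where W: "open W" "s0 \<in> W" "\<And>s. s \<in> W \<Longrightarrow> l2norm \<mu> (\<lambda>y. \<xi> (s \<odot> y) - \<xi> (s0 \<odot> y)) \<le> \<delta>"
    using translation_neighbourhood[OF \<xi> \<delta>] by blast
  obtain Z where Z: "open Z" "t0 \<in> Z" "\<And>t. t \<in> Z \<Longrightarrow> l2norm \<mu> (\<lambda>y. \<eta> (t \<odot> y) - \<eta> (t0 \<odot> y)) \<le> \<delta>"
    using translation_neighbourhood[OF \<eta> \<delta>] by blast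
  obtain C where C: "C \<ge> 0" "\<And>f. f \<in> L2 \<mu> \<Longrightarrow> l2norm \<mu> (T f) \<le> C * l2norm \<mu> f"
    using bop_bounded[OF T] by blast
  have bound: "cmod (ip \<mu> (T f) g) \<le> C / 2 ^ k * l2norm \<mu> f * l2norm \<mu> g"
    if "f \<in> L2 \<mu>" "g \<in> L2 \<mu>" "{x. f x \<noteq> 0} \<subseteq> W" "{x. g x \<noteq> 0} \<subseteq> Z" for f g k
    using that
  proof (induction k arbitrary: f g)
    case 0
    then show ?case
      using ip_bop_bound[OF T C(2)] by simp
  next
    case (Suc k)
    have "cmod (ip \<mu> (T f) g) \<le> C / 2 ^ k / 2 * l2norm \<mu> f * l2norm \<mu> g"
      using C(1) by (intro schur_zero_halves_bound[OF T \<xi> \<eta> u zero W(3) Z(3) less_imp_le[OF \<delta>] \<delta>' c _ Suc.IH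
            Suc.prems(1,3,2,4)]) auto
    then show ?case
      by (simp add: mult.commute)
  qed
  have "vanishes_on \<mu> T W Z"
    unfolding vanishes_on_def
  proof safe
    fix f g assume f: "f \<in> L2 \<mu>" and g: "g \<in> L2 \<mu>"
    let ?f = "\<lambda>x. indicator W x * f x" and ?g = "\<lambda>x. indicator Z x * g x"
    have "cmod (ip \<mu> (T ?f) ?g) \<le> C / 2 ^ k * l2norm \<mu> ?f * l2norm \<mu> ?g" for k
      using W(1) Z(1) f g by (intro bound L2_indicator_mult) (auto simp: sets_haar indicator_def)
    moreover have "(\<lambda>k. C / 2 ^ k * l2norm \<mu> ?f * l2norm \<mu> ?g) \<longlonglongrightarrow> 0"
      using tendsto_mult_left_zero[OF tendsto_mult_right_zero[OF LIMSEQ_inverse_realpow_zero[of 2]],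
          of C "l2norm \<mu> ?f * l2norm \<mu> ?g"] by (simp add: divide_inverse mult.assoc)
    ultimately have "cmod (ip \<mu> (T ?f) ?g) \<le> 0"
      by (intro LIMSEQ_le_const) auto
    then show "ip \<mu> (T ?f) ?g = 0" by simp
  qed
  then show thesis
    using that W Z by blast
qed

text \<open>Two finite subcovers, as in the tube lemma: for fixed \<open>s\<close> a finite
  intersection of the sets \<open>W t\<close> is a neighbourhood that works against all of
  \<open>L\<close>, and finitely many such neighbourhoods cover \<open>K\<close>.\<close>

lemma vanishes_on_compact:
  assumes T: "bop \<mu> T" and K: "compact K" and L: "compact L"
    and local: "\<And>s t. s \<in> K \<Longrightarrow> t \<in> L \<Longrightarrow>
      \<exists>W Z. open W \<and> open Z \<and> s \<in> W \<and> t \<in> Z \<and> vanishes_on \<mu> T W Z"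
  shows "vanishes_on \<mu> T K L"
proof -
  have "\<exists>W. open W \<and> s \<in> W \<and> vanishes_on \<mu> T W L" if s: "s \<in> K" for s
  proof -
    obtain W Z where WZ: "\<And>t. t \<in> L \<Longrightarrow> open (W t) \<and> open (Z t) \<and> s \<in> W t \<and> t \<in> Z t \<and> vanishes_on \<mu> T (W t) (Z t)"
      using local[OF s] by metis
    have "L \<subseteq> (\<Union>t\<in>L. Z t)"
      using WZ by blast
    then obtain D where D: "D \<subseteq> L" "finite D" "L \<subseteq> (\<Union>t\<in>D. Z t)"
      using compactE_image[OF L, of L Z] WZ by metis
    define V where "V = (\<Inter>t\<in>D. W t)"
    have V: "open V" "s \<in> V"
      using WZ D by (auto simp: V_def)
    have "vanishes_on \<mu> T V (\<Union>t\<in>D. Z t)"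
    proof (rule vanishes_on_UN_right[OF T D(2)])
      fix t assume t: "t \<in> D"
      with D(1) WZ have WZt: "open (Z t)" "vanishes_on \<mu> T (W t) (Z t)"
        by blast+
      then show "Z t \<in> sets \<mu> \<and> vanishes_on \<mu> T V (Z t)"
        using vanishes_on_mono[OF WZt(2), of V "Z t"] V(1) t by (auto simp: sets_haar V_def)
    qed (use V(1) in \<open>simp add: sets_haar\<close>)
    then have "vanishes_on \<mu> T V L"
      by (rule vanishes_on_mono) (use D V(1) L in \<open>auto simp: borel_compact sets_haar\<close>)
    with V show ?thesis by blast
  qed
  then obtain W where W: "\<And>s. s \<in> K \<Longrightarrow> open (W s) \<and> s \<in> W s \<and> vanishes_on \<mu> T (W s) L"
    by metis
  have "K \<subseteq> (\<Union>s\<in>K. W s)"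
    using W by blast
  then obtain D where D: "D \<subseteq> K" "finite D" "K \<subseteq> (\<Union>s\<in>D. W s)"
    using compactE_image[OF K, of K W] W by metis
  have "vanishes_on \<mu> T (\<Union>s\<in>D. W s) L"
    using D W L by (intro vanishes_on_UN_left[OF T D(2)]) (auto simp: sets_haar borel_compact)
  then show ?thesis
    by (rule vanishes_on_mono) (use D K L in \<open>auto simp: compact_in_sets\<close>)
qed

lemma subset_Mmax_estar_supp:
  assumes U: "\<And>T. T \<in> U \<Longrightarrow> bop \<mu> T"
  shows "U \<subseteq> Mmax \<mu> (estar (\<odot>) iv (supp_G (\<odot>) iv \<mu> U))"
proof
  fix T assume TU: "T \<in> U"
  then have T: "bop \<mu> T"
    by (rule U)
  have "vanishes_on \<mu> T A B"
    if A: "A \<in> sets borel" and B: "B \<in> sets borel"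
      and disj: "(A \<times> B) \<inter> estar (\<odot>) iv (supp_G (\<odot>) iv \<mu> U) = {}" for A B
  proof -
    obtain K where K: "\<And>n::nat. compact (K n)" "incseq K" "\<And>n. K n \<subseteq> A" "A - (\<Union>n. K n) \<in> null_sets \<mu>"
      using inner_regular[OF A] by blast
    obtain L where L: "\<And>n::nat. compact (L n)" "incseq L" "\<And>n. L n \<subseteq> B" "B - (\<Union>n. L n) \<in> null_sets \<mu>"
      using inner_regular[OF B] by blast
    have "vanishes_on \<mu> T (K n) (L k)" for n k
    proof (rule vanishes_on_compact[OF T K(1) L(1)])
      fix s t assume "s \<in> K n" "t \<in> L k"
      with K(3) L(3) disj have "(s, t) \<notin> estar (\<odot>) iv (supp_G (\<odot>) iv \<mu> U)"
        by blast
      then obtain u where u: "u \<in> I_U (\<odot>) iv \<mu> U" "u (t \<odot> iv s) \<noteq> 0"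
        by (auto simp: estar_def supp_G_def)
      then have "u \<in> fourier_alg (\<odot>) iv \<mu>" "schur_zero \<mu> (Nmap (\<odot>) iv u) T"
        using TU by (auto simp: I_U_def)
      from schur_zero_vanishes_near[OF T this u(2)]
      show "\<exists>W Z. open W \<and> open Z \<and> s \<in> W \<and> t \<in> Z \<and> vanishes_on \<mu> T W Z"
        by metis
    qed
    then show ?thesis
      using K L A B by (intro vanishes_on_incseq[OF T, of K A L B]) (auto simp: borel_compact sets_haar)
  qed
  then show "T \<in> Mmax \<mu> (estar (\<odot>) iv (supp_G (\<odot>) iv \<mu> U))"
    using T vanishes_on_iff_AE[OF T] unfolding Mmax_def by (auto simp: sets_haar)
qed

section \<open>A density theorem for left Haar measure\<close>

lemma inv_unit [simp]: "iv e = e"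
  using left_unit[of "iv e"] right_inv[of e] by metis

lemma inv_mult_inv: "iv (iv x \<odot> y) = iv y \<odot> x"
  by (simp add: inv_mult)

lemma symmetric_neighbourhood:
  assumes "open V0" "e \<in> V0"
  obtains V where "open V" "e \<in> V" "V \<subseteq> V0" "\<And>y. iv y \<in> V \<longleftrightarrow> y \<in> V" "emeasure \<mu> V < \<infinity>"
proof -
  obtain W K where W: "open W" "compact K" "e \<in> W" "W \<subseteq> K"
    using compact_neighbourhood by blast
  define V where "V = (V0 \<inter> W) \<inter> iv -` (V0 \<inter> W)"
  have "emeasure \<mu> V \<le> emeasure \<mu> K"
    using W by (intro emeasure_mono compact_in_sets) (auto simp: V_def)
  also have "\<dots> < \<infinity>"
    using W(2) by (rule emeasure_compact_finite)
  finally have "emeasure \<mu> V < \<infinity>" .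
  moreover have "open V"
    unfolding V_def using assms W by (intro open_Int open_vimage continuous_iv)
  ultimately show thesis
    using that[of V] assms W by (auto simp: V_def)
qed

text \<open>The substitution \<open>z = s y\<close> turns the integral into
  \<open>\<integral>\<^bsub>z \<notin> K\<^esub> \<mu>(K \<inter> z V\<^sup>-\<^sup>1) dz\<close>, which only involves left translates, so no modular function appears.\<close>

lemma nn_integral_exit_le:
  assumes K: "compact K" and \<epsilon>: "0 < \<epsilon>"
  obtains V0 where "open V0" "e \<in> V0"
    "\<And>V. open V \<Longrightarrow> V \<subseteq> V0 \<Longrightarrow> (\<And>y. iv y \<in> V \<longleftrightarrow> y \<in> V) \<Longrightarrow>
      (\<integral>\<^sup>+s. indicator K s * emeasure \<mu> {y \<in> V. s \<odot> y \<notin> K} \<partial>\<mu>) \<le> \<epsilon> * emeasure \<mu> V"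
proof -
  have [measurable]: "K \<in> sets borel"
    using K by (rule borel_compact)
  obtain V' where V': "open V'" "K \<subseteq> V'" "emeasure \<mu> (V' - K) < \<epsilon>"
    using outer_regular[OF \<open>K \<in> sets borel\<close> emeasure_compact_finite[OF K] \<epsilon>] by metis
  have [measurable]: "V' \<in> sets borel"
    using V' by simp
  have opn: "open ((\<lambda>p. snd p \<odot> fst p) -` V')"
    using V'(1) by (intro open_vimage continuous_intros)
  have sub: "{e} \<times> K \<subseteq> (\<lambda>p. snd p \<odot> fst p) -` V'"
    using V'(2) by auto
  \<comment> \<open>Compactness of \<open>K\<close> gives one neighbourhood of \<open>e\<close>
    whose right multiplications keep all of \<open>K\<close> inside \<open>V'\<close>.\<close>
  obtain V0 where V0: "e \<in> V0" "open V0" "V0 \<times> K \<subseteq> (\<lambda>p. snd p \<odot> fst p) -` V'"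
    using Elementary_Topology.tube_lemma[OF K opn sub] by blast
  show thesis
  proof (rule that[OF V0(2,1)])
    fix V assume V: "open V" "V \<subseteq> V0" and sym: "\<And>y. iv y \<in> V \<longleftrightarrow> y \<in> V"
    have [measurable]: "V \<in> sets borel"
      using V by simp
    have "(\<integral>\<^sup>+s. indicator K s * emeasure \<mu> {y \<in> V. s \<odot> y \<notin> K} \<partial>\<mu>)
        = (\<integral>\<^sup>+s. \<integral>\<^sup>+y. indicator K s * indicator V y * indicator (- K) (s \<odot> y) \<partial>\<mu> \<partial>\<mu>)"
    proof (rule nn_integral_cong)
      fix s
      have "{y \<in> V. s \<odot> y \<notin> K} \<in> sets \<mu>"
        by measurable
      then have "indicator K s * emeasure \<mu> {y \<in> V. s \<odot> y \<notin> K}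
          = (\<integral>\<^sup>+y. indicator K s * indicator {y \<in> V. s \<odot> y \<notin> K} y \<partial>\<mu>)"
        by (simp add: nn_integral_cmult_indicator)
      also have "\<dots> = (\<integral>\<^sup>+y. indicator K s * indicator V y * indicator (- K) (s \<odot> y) \<partial>\<mu>)"
        by (intro nn_integral_cong) (auto simp: indicator_def)
      finally show "indicator K s * emeasure \<mu> {y \<in> V. s \<odot> y \<notin> K}
          = (\<integral>\<^sup>+y. indicator K s * indicator V y * indicator (- K) (s \<odot> y) \<partial>\<mu>)" .
    qed
    also have "\<dots> = (\<integral>\<^sup>+s. \<integral>\<^sup>+z. indicator K s * indicator V (iv s \<odot> z) * indicator (- K) z \<partial>\<mu> \<partial>\<mu>)"
    proof (rule nn_integral_cong)
      fix s
      show "(\<integral>\<^sup>+y. indicator K s * indicator V y * indicator (- K) (s \<odot> y) \<partial>\<mu>)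
          = (\<integral>\<^sup>+z. indicator K s * indicator V (iv s \<odot> z) * indicator (- K) z \<partial>\<mu>)"
        using nn_integral_left_translation[of "\<lambda>z. indicator K s * indicator V (iv s \<odot> z) * indicator (- K) z" s]
        by simp
    qed
    also have "\<dots> \<le> (\<integral>\<^sup>+s. \<integral>\<^sup>+z. indicator (V' - K) z * indicator V (iv z \<odot> s) \<partial>\<mu> \<partial>\<mu>)"
    proof (intro nn_integral_mono)
      fix s z
      have "z \<in> V'" if "s \<in> K" "iv s \<odot> z \<in> V"
      proof -
        have "(iv s \<odot> z, s) \<in> V0 \<times> K"
          using that V(2) by blast
        with V0(3) show ?thesis by auto
      qed
      \<comment> \<open>Symmetry of \<open>V\<close> exchanges the roles of \<open>s\<close> and
        \<open>z\<close>, so the later integration over \<open>s\<close> is over a left translate of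
        \<open>V\<close> and gives \<open>emeasure \<mu> V\<close>.\<close>
      moreover have "iv z \<odot> s \<in> V" if "iv s \<odot> z \<in> V"
        using that sym[of "iv s \<odot> z"] by (simp add: inv_mult_inv)
      ultimately show "indicator K s * indicator V (iv s \<odot> z) * indicator (- K) z
          \<le> (indicator (V' - K) z * indicator V (iv z \<odot> s) :: ennreal)"
        by (auto simp: indicator_def)
    qed
    also have "\<dots> = (\<integral>\<^sup>+z. \<integral>\<^sup>+s. indicator (V' - K) z * indicator V (iv z \<odot> s) \<partial>\<mu> \<partial>\<mu>)"
      by (rule Fubini') measurable
    also have "\<dots> = (\<integral>\<^sup>+z. indicator (V' - K) z * emeasure \<mu> V \<partial>\<mu>)"
    proof (rule nn_integral_cong)
      fix z
      have "(\<integral>\<^sup>+s. indicator (V' - K) z * indicator V (iv z \<odot> s) \<partial>\<mu>)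
          = indicator (V' - K) z * (\<integral>\<^sup>+s. indicator V (iv z \<odot> s) \<partial>\<mu>)"
        by (rule nn_integral_cmult) measurable
      also have "(\<integral>\<^sup>+s. indicator V (iv z \<odot> s) \<partial>\<mu>) = (\<integral>\<^sup>+s. indicator V s \<partial>\<mu>)"
        by (rule nn_integral_left_translation) measurable
      also have "\<dots> = emeasure \<mu> V"
        by (simp add: sets_haar)
      finally show "(\<integral>\<^sup>+s. indicator (V' - K) z * indicator V (iv z \<odot> s) \<partial>\<mu>)
          = indicator (V' - K) z * emeasure \<mu> V" .
    qed
    also have "\<dots> = emeasure \<mu> V * emeasure \<mu> (V' - K)"
      by (subst mult.commute, subst nn_integral_cmult_indicator) (auto simp: sets_haar)
    also have "\<dots> \<le> emeasure \<mu> V * \<epsilon>"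
      using V'(3) by (intro mult_left_mono) auto
    finally show "(\<integral>\<^sup>+s. indicator K s * emeasure \<mu> {y \<in> V. s \<odot> y \<notin> K} \<partial>\<mu>) \<le> \<epsilon> * emeasure \<mu> V"
      by (simp add: mult.commute)
  qed
qed

text \<open>Markov's inequality for the points of \<open>K\<close> from which at least half of
  \<open>V\<close> leads out of \<open>K\<close>. Positivity and finiteness of
  \<open>emeasure \<mu> V\<close> allow it to be cancelled.\<close>

lemma emeasure_exit_half_le:
  assumes K: "K \<in> sets borel" and V: "open V" "e \<in> V" "emeasure \<mu> V < \<infinity>"
    and le: "(\<integral>\<^sup>+s. indicator K s * emeasure \<mu> {y \<in> V. s \<odot> y \<notin> K} \<partial>\<mu>) \<le> \<epsilon> * emeasure \<mu> V"
  shows "{s \<in> K. emeasure \<mu> V \<le> 2 * emeasure \<mu> {y \<in> V. s \<odot> y \<notin> K}} \<in> sets \<mu>" (is "?X \<in> _")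
    and "emeasure \<mu> {s \<in> K. emeasure \<mu> V \<le> 2 * emeasure \<mu> {y \<in> V. s \<odot> y \<notin> K}} \<le> 2 * \<epsilon>"
proof -
  note [measurable] = K
  have [measurable]: "V \<in> sets borel"
    using V by simp
  have "emeasure \<mu> {y \<in> V. s \<odot> y \<notin> K} = (\<integral>\<^sup>+y. indicator V y * indicator (- K) (s \<odot> y) \<partial>\<mu>)" for s
  proof -
    have "{y \<in> V. s \<odot> y \<notin> K} \<in> sets \<mu>"
      by measurable
    then have "emeasure \<mu> {y \<in> V. s \<odot> y \<notin> K} = (\<integral>\<^sup>+y. indicator {y \<in> V. s \<odot> y \<notin> K} y \<partial>\<mu>)"
      by simp
    also have "\<dots> = (\<integral>\<^sup>+y. indicator V y * indicator (- K) (s \<odot> y) \<partial>\<mu>)"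
      by (intro nn_integral_cong) (auto simp: indicator_def)
    finally show ?thesis .
  qed
  then have [measurable]: "(\<lambda>s. emeasure \<mu> {y \<in> V. s \<odot> y \<notin> K}) \<in> borel_measurable \<mu>"
    by simp
  show X [measurable]: "?X \<in> sets \<mu>"
    by measurable
  have "emeasure \<mu> V * emeasure \<mu> ?X = (\<integral>\<^sup>+s. emeasure \<mu> V * indicator ?X s \<partial>\<mu>)"
    by (simp add: nn_integral_cmult_indicator)
  also have "\<dots> \<le> (\<integral>\<^sup>+s. 2 * (indicator K s * emeasure \<mu> {y \<in> V. s \<odot> y \<notin> K}) \<partial>\<mu>)"
    by (intro nn_integral_mono) (auto simp: indicator_def)
  also have "\<dots> = 2 * (\<integral>\<^sup>+s. indicator K s * emeasure \<mu> {y \<in> V. s \<odot> y \<notin> K} \<partial>\<mu>)"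
    by (rule nn_integral_cmult) measurable
  also have "\<dots> \<le> 2 * (\<epsilon> * emeasure \<mu> V)"
    using le by (rule mult_left_mono) simp
  finally have "emeasure \<mu> V * emeasure \<mu> ?X \<le> emeasure \<mu> V * (2 * \<epsilon>)"
    by (simp add: mult_ac)
  moreover have "emeasure \<mu> V \<noteq> 0" "emeasure \<mu> V \<noteq> top"
    using V emeasure_open_pos[OF V(1,2)] by auto
  ultimately show "emeasure \<mu> ?X \<le> 2 * \<epsilon>"
    by (simp add: ennreal_mult_le_mult_iff)
qed

text \<open>Borel-Cantelli plays the role of Lebesgue density. Off one null set, a common small
  neighbourhood of \<open>e\<close> is carried more than half into \<open>K\<close> by
  \<open>s\<close> and more than half into \<open>L\<close> by \<open>t\<close>, so the two parts of
  the neighbourhood meet in positive measure.\<close>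

lemma overlap_positive:
  assumes K: "compact K" and L: "compact L"
  shows "marg_null \<mu> {(s, t). s \<in> K \<and> t \<in> L \<and> emeasure \<mu> {y. s \<odot> y \<in> K \<and> t \<odot> y \<in> L} = 0}"
proof -
  have Kb [measurable]: "K \<in> sets borel" and Lb [measurable]: "L \<in> sets borel"
    using K L by (auto intro: borel_compact)
  \<comment> \<open>A geometric sequence makes the exceptional sets, of measure at most
    \<open>2 * \<epsilon> n\<close>, summable.\<close>
  define \<epsilon> where "\<epsilon> n = ennreal ((1 / 2) ^ n)" for n :: nat
  have \<epsilon>: "0 < \<epsilon> n" for n
    by (simp add: \<epsilon>_def)
  \<comment> \<open>One neighbourhood must serve \<open>K\<close> and \<open>L\<close> at once,
    because the two parts have to be compared inside the same set.\<close>
  define small where "small n V \<longleftrightarrow> open V \<and> e \<in> V \<and> emeasure \<mu> V < \<infinity> \<and>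
      (\<integral>\<^sup>+s. indicator K s * emeasure \<mu> {y \<in> V. s \<odot> y \<notin> K} \<partial>\<mu>) \<le> \<epsilon> n * emeasure \<mu> V \<and>
      (\<integral>\<^sup>+s. indicator L s * emeasure \<mu> {y \<in> V. s \<odot> y \<notin> L} \<partial>\<mu>) \<le> \<epsilon> n * emeasure \<mu> V" for n V
  have "\<exists>V. small n V" for n
  proof -
    obtain V1 where V1: "open V1" "e \<in> V1"
      "\<And>V. open V \<Longrightarrow> V \<subseteq> V1 \<Longrightarrow> (\<And>y. iv y \<in> V \<longleftrightarrow> y \<in> V) \<Longrightarrow>
        (\<integral>\<^sup>+s. indicator K s * emeasure \<mu> {y \<in> V. s \<odot> y \<notin> K} \<partial>\<mu>) \<le> \<epsilon> n * emeasure \<mu> V"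
      using nn_integral_exit_le[OF K \<epsilon>[of n]] by blast
    obtain V2 where V2: "open V2" "e \<in> V2"
      "\<And>V. open V \<Longrightarrow> V \<subseteq> V2 \<Longrightarrow> (\<And>y. iv y \<in> V \<longleftrightarrow> y \<in> V) \<Longrightarrow>
        (\<integral>\<^sup>+s. indicator L s * emeasure \<mu> {y \<in> V. s \<odot> y \<notin> L} \<partial>\<mu>) \<le> \<epsilon> n * emeasure \<mu> V"
      using nn_integral_exit_le[OF L \<epsilon>[of n]] by blast
    obtain V where V: "open V" "e \<in> V" "V \<subseteq> V1 \<inter> V2" "\<And>y. iv y \<in> V \<longleftrightarrow> y \<in> V" "emeasure \<mu> V < \<infinity>"
      using symmetric_neighbourhood[of "V1 \<inter> V2"] V1(1,2) V2(1,2) by blast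
    then have "V \<subseteq> V1" "V \<subseteq> V2"
      by blast+
    with V V1(3)[of V] V2(3)[of V] have "small n V"
      unfolding small_def by blast
    then show ?thesis ..
  qed
  then obtain V where "\<And>n. small n (V n)"
    by metis
  then have V: "\<And>n. open (V n)" "\<And>n. e \<in> V n" "\<And>n. emeasure \<mu> (V n) < \<infinity>"
    and VK: "\<And>n. (\<integral>\<^sup>+s. indicator K s * emeasure \<mu> {y \<in> V n. s \<odot> y \<notin> K} \<partial>\<mu>) \<le> \<epsilon> n * emeasure \<mu> (V n)"
    and VL: "\<And>n. (\<integral>\<^sup>+s. indicator L s * emeasure \<mu> {y \<in> V n. s \<odot> y \<notin> L} \<partial>\<mu>) \<le> \<epsilon> n * emeasure \<mu> (V n)"
    by (simp_all add: small_def)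
  have Vb [measurable]: "V n \<in> sets borel" for n
    using V(1) by simp
  define X where "X A n = {s \<in> A. emeasure \<mu> (V n) \<le> 2 * emeasure \<mu> {y \<in> V n. s \<odot> y \<notin> A}}" for A n
  have AE: "AE s in \<mu>. \<forall>\<^sub>F n in sequentially. s \<notin> X A n"
    if s: "\<And>n. X A n \<in> sets \<mu>" and le: "\<And>n. emeasure \<mu> (X A n) \<le> 2 * \<epsilon> n" for A
  proof -
    have le': "emeasure \<mu> (X A n) \<le> ennreal (2 * (1 / 2) ^ n)" for n
      using le[of n] by (simp add: \<epsilon>_def ennreal_mult)
    have "AE s in \<mu>. \<forall>\<^sub>F n in sequentially. s \<in> space \<mu> - X A n"
    proof (rule borel_cantelli_AE1[OF s])
      show "emeasure \<mu> (X A n) < \<infinity>" for n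
        using le'[of n] by (simp add: order_le_less_trans)
      have "measure \<mu> (X A n) \<le> 2 * (1 / 2) ^ n" for n
        unfolding measure_def using le'[of n] by (intro enn2real_leI) auto
      moreover have "summable (\<lambda>n. 2 * (1 / 2 :: real) ^ n)"
        by (intro summable_mult summable_geometric) simp
      ultimately show "summable (\<lambda>n. measure \<mu> (X A n))"
        using summable_comparison_test'[of "\<lambda>n. 2 * (1 / 2 :: real) ^ n" 0 "\<lambda>n. measure \<mu> (X A n)"] by simp
    qed
    then show ?thesis by simp
  qed
  have "AE s in \<mu>. (\<forall>\<^sub>F n in sequentially. s \<notin> X K n) \<and> (\<forall>\<^sub>F n in sequentially. s \<notin> X L n)"
    unfolding AE_conj_iff
  proof
    show "AE s in \<mu>. \<forall>\<^sub>F n in sequentially. s \<notin> X K n"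
      by (rule AE; unfold X_def; rule emeasure_exit_half_le[OF Kb V VK])
    show "AE s in \<mu>. \<forall>\<^sub>F n in sequentially. s \<notin> X L n"
      by (rule AE; unfold X_def; rule emeasure_exit_half_le[OF Lb V VL])
  qed
  then obtain Y where "{s \<in> space \<mu>. \<not> ((\<forall>\<^sub>F n in sequentially. s \<notin> X K n) \<and>
      (\<forall>\<^sub>F n in sequentially. s \<notin> X L n))} \<subseteq> Y" "emeasure \<mu> Y = 0" "Y \<in> sets \<mu>"
    by (rule AE_E)
  then have Y: "Y \<in> null_sets \<mu>"
    and Y': "\<And>s. s \<notin> Y \<Longrightarrow> (\<forall>\<^sub>F n in sequentially. s \<notin> X K n) \<and> (\<forall>\<^sub>F n in sequentially. s \<notin> X L n)"
    by auto
  have "emeasure \<mu> {y. s \<odot> y \<in> K \<and> t \<odot> y \<in> L} \<noteq> 0"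
    if st: "s \<in> K" "t \<in> L" "s \<notin> Y" "t \<notin> Y" for s t
  proof
    assume 0: "emeasure \<mu> {y. s \<odot> y \<in> K \<and> t \<odot> y \<in> L} = 0"
    have "\<forall>\<^sub>F n in sequentially. s \<notin> X K n \<and> t \<notin> X L n"
      using Y'[OF st(3)] Y'[OF st(4)] by (auto intro: eventually_conj)
    then obtain n where n: "s \<notin> X K n" "t \<notin> X L n"
      by (auto simp: eventually_sequentially)
    define p where "p = emeasure \<mu> {y \<in> V n. s \<odot> y \<notin> K}"
    define q where "q = emeasure \<mu> {y \<in> V n. t \<odot> y \<notin> L}"
    have meas: "{y \<in> V n. s \<odot> y \<notin> K} \<in> sets \<mu>" "{y \<in> V n. t \<odot> y \<notin> L} \<in> sets \<mu>"
        "{y. s \<odot> y \<in> K \<and> t \<odot> y \<in> L} \<in> sets \<mu>"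
      by measurable
    have "emeasure \<mu> (V n) \<le> emeasure \<mu> (({y \<in> V n. s \<odot> y \<notin> K} \<union> {y \<in> V n. t \<odot> y \<notin> L})
        \<union> {y. s \<odot> y \<in> K \<and> t \<odot> y \<in> L})"
      using meas by (intro emeasure_mono) auto
    also have "\<dots> \<le> p + q + 0"
      unfolding p_def q_def 0[symmetric] using meas
      by (intro order_trans[OF emeasure_subadditive] add_mono) auto
    finally have le: "emeasure \<mu> (V n) \<le> p + q" by simp
    \<comment> \<open>Each exit part is strictly less than half, whereas a null overlap would force
      the two parts to cover the whole neighbourhood up to measure zero.\<close>
    have "2 * p < emeasure \<mu> (V n)" "2 * q < emeasure \<mu> (V n)"
      using n st by (auto simp: X_def p_def q_def)
    then have "2 * p + 2 * q < emeasure \<mu> (V n) + emeasure \<mu> (V n)"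
      by (rule add_strict_mono)
    also have "\<dots> \<le> (p + q) + (p + q)"
      by (intro add_mono le)
    also have "\<dots> = 2 * p + 2 * q"
      by (simp only: mult_2 add_ac)
    finally show False by simp
  qed
  then show ?thesis
    unfolding marg_null_def using Y by (intro bexI[of _ Y]) blast+
qed

section \<open>The multipliers of compact rectangles\<close>

lemma integrable_product:
  fixes F G :: "'g \<Rightarrow> complex"
  assumes F: "integrable \<mu> F" and G: "integrable \<mu> G"
  shows "integrable (\<mu> \<Otimes>\<^sub>M \<mu>) (\<lambda>(s, t). F s * G t)"
    and "(\<integral>p. (\<lambda>(s, t). F s * G t) p \<partial>(\<mu> \<Otimes>\<^sub>M \<mu>)) = (\<integral>s. F s \<partial>\<mu>) * (\<integral>t. G t \<partial>\<mu>)"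
    and "(\<integral>p. norm ((\<lambda>(s, t). F s * G t) p) \<partial>(\<mu> \<Otimes>\<^sub>M \<mu>)) = (\<integral>s. norm (F s) \<partial>\<mu>) * (\<integral>t. norm (G t) \<partial>\<mu>)"
proof -
  have [measurable]: "F \<in> borel_measurable \<mu>" "G \<in> borel_measurable \<mu>"
    using F G by auto
  show int: "integrable (\<mu> \<Otimes>\<^sub>M \<mu>) (\<lambda>(s, t). F s * G t)"
  proof (rule Fubini_integrable)
    show "integrable \<mu> (\<lambda>x. \<integral>y. norm (case (x, y) of (s, t) \<Rightarrow> F s * G t) \<partial>\<mu>)"
      using F by (simp add: norm_mult)
  qed (use G in auto)
  show "(\<integral>p. (\<lambda>(s, t). F s * G t) p \<partial>(\<mu> \<Otimes>\<^sub>M \<mu>)) = (\<integral>s. F s \<partial>\<mu>) * (\<integral>t. G t \<partial>\<mu>)"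
    by (subst integral_fst[OF int, symmetric]) simp
  have "integrable (\<mu> \<Otimes>\<^sub>M \<mu>) (\<lambda>p. norm ((\<lambda>(s, t). F s * G t) p))"
    using int by (rule integrable_norm)
  then have "integrable (\<mu> \<Otimes>\<^sub>M \<mu>) (\<lambda>(s, t). norm (F s) * norm (G t))"
    by (simp add: case_prod_beta' norm_mult)
  from integral_fst[OF this]
  show "(\<integral>p. norm ((\<lambda>(s, t). F s * G t) p) \<partial>(\<mu> \<Otimes>\<^sub>M \<mu>)) = (\<integral>s. norm (F s) \<partial>\<mu>) * (\<integral>t. norm (G t) \<partial>\<mu>)"
    by (simp add: case_prod_beta' norm_mult)
qed

lemma tc_fun_measurable:
  assumes "tc_rep \<mu> f g"
  shows "tc_fun f g \<in> borel_measurable (\<mu> \<Otimes>\<^sub>M \<mu>)"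
proof -
  have [measurable]: "f i \<in> borel_measurable \<mu>" "g i \<in> borel_measurable \<mu>" for i
    using assms L2_measurable by (auto simp: tc_rep_def)
  show ?thesis
    unfolding tc_fun_def by measurable
qed

lemma AE_product_marg_null:
  assumes "marg_null \<mu> {p. \<not> P p}"
  shows "AE p in \<mu> \<Otimes>\<^sub>M \<mu>. P p"
proof -
  obtain X where X: "X \<in> null_sets \<mu>" "{p. \<not> P p} \<subseteq> (X \<times> UNIV) \<union> (UNIV \<times> X)"
    using assms by (auto simp: marg_null_def)
  have "X \<times> space \<mu> \<in> null_sets (\<mu> \<Otimes>\<^sub>M \<mu>)" "space \<mu> \<times> X \<in> null_sets (\<mu> \<Otimes>\<^sub>M \<mu>)"
    using X(1) by (auto intro!: times_in_null_sets1 times_in_null_sets2)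
  then have "(X \<times> UNIV) \<union> (UNIV \<times> X) \<in> null_sets (\<mu> \<Otimes>\<^sub>M \<mu>)"
    by (intro null_sets.Un) simp_all
  then show ?thesis
    by (rule AE_I') (use X(2) in auto)
qed

text \<open>This is what makes a pairing with a rank one kernel depend only on the function
  \<open>tc_fun f g\<close> and not on the sequences representing it. Cauchy-Schwarz in each
  variable bounds the L^1 norms of the terms, which permits termwise integration.\<close>

lemma tc_fun_integral_sums:
  assumes fg: "tc_rep \<mu> f g" and \<phi>: "\<phi> \<in> L2 \<mu>" and \<psi>: "\<psi> \<in> L2 \<mu>"
    and w [measurable]: "w \<in> borel_measurable (\<mu> \<Otimes>\<^sub>M \<mu>)" and wB: "\<And>p. cmod (w p) \<le> B"
  shows "(\<lambda>i. \<integral>p. w p * (\<lambda>(s, t). (f i s * cnj (\<phi> s)) * (\<psi> t * cnj (g i t))) p \<partial>(\<mu> \<Otimes>\<^sub>M \<mu>))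
    sums (\<integral>p. w p * tc_fun f g p * (\<lambda>(s, t). cnj (\<phi> s) * \<psi> t) p \<partial>(\<mu> \<Otimes>\<^sub>M \<mu>))"
proof -
  have L: "f i \<in> L2 \<mu>" "g i \<in> L2 \<mu>" for i
    using fg by (auto simp: tc_rep_def)
  note [measurable] = L2_measurable[OF L(1)] L2_measurable[OF L(2)] L2_measurable[OF \<phi>] L2_measurable[OF \<psi>]
    tc_fun_measurable[OF fg]
  define H where "H i = (\<lambda>(s, t). (f i s * cnj (\<phi> s)) * (\<psi> t * cnj (g i t)))" for i
  have H_int: "integrable (\<mu> \<Otimes>\<^sub>M \<mu>) (H i)" for i
    unfolding H_def by (rule integrable_product(1)[OF integrable_ip[OF L(1) \<phi>] integrable_ip[OF \<psi> L(2)]])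
  have H_norm: "(\<integral>p. norm (H i p) \<partial>(\<mu> \<Otimes>\<^sub>M \<mu>)) \<le> (l2norm \<mu> \<phi> * l2norm \<mu> \<psi>) * (l2norm \<mu> (f i) * l2norm \<mu> (g i))" for i
  proof -
    have "(\<integral>p. norm (H i p) \<partial>(\<mu> \<Otimes>\<^sub>M \<mu>))
        = (\<integral>s. cmod (f i s) * cmod (\<phi> s) \<partial>\<mu>) * (\<integral>t. cmod (\<psi> t) * cmod (g i t) \<partial>\<mu>)"
      unfolding H_def using integrable_product(3)[OF integrable_ip[OF L(1)[of i] \<phi>] integrable_ip[OF \<psi> L(2)[of i]]]
      by (simp add: norm_mult)
    also have "\<dots> \<le> (l2norm \<mu> (f i) * l2norm \<mu> \<phi>) * (l2norm \<mu> \<psi> * l2norm \<mu> (g i))"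
      by (intro mult_mono Cauchy_Schwarz_integral L \<phi> \<psi>) auto
    finally show ?thesis
      by (simp add: mult_ac)
  qed
  have B: "0 \<le> B"
    using wB[of undefined] norm_ge_zero order_trans by blast
  have wH_int: "integrable (\<mu> \<Otimes>\<^sub>M \<mu>) (\<lambda>p. w p * H i p)" for i
  proof (rule Bochner_Integration.integrable_bound)
    show "integrable (\<mu> \<Otimes>\<^sub>M \<mu>) (\<lambda>p. of_real B * H i p)"
      using H_int by simp
    show "AE p in \<mu> \<Otimes>\<^sub>M \<mu>. norm (w p * H i p) \<le> norm (of_real B * H i p)"
      using wB B by (simp add: norm_mult mult_right_mono)
  qed (use H_int in measurable)
  have wH_sum: "summable (\<lambda>i. \<integral>p. norm (w p * H i p) \<partial>(\<mu> \<Otimes>\<^sub>M \<mu>))"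
  proof (rule summable_comparison_test')
    show "summable (\<lambda>i. (B * (l2norm \<mu> \<phi> * l2norm \<mu> \<psi>)) * (l2norm \<mu> (f i) * l2norm \<mu> (g i)))"
      by (intro summable_mult tc_rep_product_bound fg)
    fix i
    have "(\<integral>p. norm (w p * H i p) \<partial>(\<mu> \<Otimes>\<^sub>M \<mu>)) \<le> (\<integral>p. B * norm (H i p) \<partial>(\<mu> \<Otimes>\<^sub>M \<mu>))"
      using wB by (intro integral_mono integrable_norm wH_int integrable_mult_right H_int)
        (simp add: norm_mult mult_right_mono)
    also have "\<dots> = B * (\<integral>p. norm (H i p) \<partial>(\<mu> \<Otimes>\<^sub>M \<mu>))"
      by simp
    also have "\<dots> \<le> B * ((l2norm \<mu> \<phi> * l2norm \<mu> \<psi>) * (l2norm \<mu> (f i) * l2norm \<mu> (g i)))"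
      by (intro mult_left_mono H_norm B)
    finally show "norm (\<integral>p. norm (w p * H i p) \<partial>(\<mu> \<Otimes>\<^sub>M \<mu>))
        \<le> (B * (l2norm \<mu> \<phi> * l2norm \<mu> \<psi>)) * (l2norm \<mu> (f i) * l2norm \<mu> (g i))"
      by (simp add: mult_ac)
  qed
  have AE: "AE p in \<mu> \<Otimes>\<^sub>M \<mu>. summable (\<lambda>i. norm (w p * H i p))"
    by (rule AE_summable_norm[OF wH_int wH_sum])
  have "(\<integral>p. (\<Sum>i. w p * H i p) \<partial>(\<mu> \<Otimes>\<^sub>M \<mu>))
      = (\<integral>p. w p * tc_fun f g p * (\<lambda>(s, t). cnj (\<phi> s) * \<psi> t) p \<partial>(\<mu> \<Otimes>\<^sub>M \<mu>))"
  proof (rule integral_cong_AE)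
    show "AE p in \<mu> \<Otimes>\<^sub>M \<mu>. (\<Sum>i. w p * H i p) = w p * tc_fun f g p * (\<lambda>(s, t). cnj (\<phi> s) * \<psi> t) p"
      using AE
    proof eventually_elim
      case (elim p)
      obtain s t where p: "p = (s, t)"
        by (cases p)
      define c where "c = w p * (cnj (\<phi> s) * \<psi> t)"
      have eq: "w p * H i p = c * (f i s * cnj (g i t))" for i
        by (simp add: H_def p c_def mult_ac)
      have "(\<Sum>i. c * (f i s * cnj (g i t))) = c * (\<Sum>i. f i s * cnj (g i t))"
      \<comment> \<open>Only the series multiplied by \<open>c\<close> is known to converge. For
        \<open>c = 0\<close> both sides are 0 whatever default value \<open>suminf\<close> has;
        otherwise \<open>c\<close> can be divided out.\<close>
      proof (cases "c = 0")
        case False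
        have "summable (\<lambda>i. c * (f i s * cnj (g i t)))"
          using elim unfolding eq by (rule summable_norm_cancel)
        then have "summable (\<lambda>i. f i s * cnj (g i t))"
          using False by (simp add: summable_cmult_iff)
        then show ?thesis
          by (rule suminf_mult)
      qed simp
      then show ?case
        unfolding eq by (simp add: tc_fun_def p c_def mult_ac)
    qed
  next
    have [measurable]: "H i \<in> borel_measurable (\<mu> \<Otimes>\<^sub>M \<mu>)" for i
      using H_int by auto
    show "(\<lambda>p. \<Sum>i. w p * H i p) \<in> borel_measurable (\<mu> \<Otimes>\<^sub>M \<mu>)"
      by measurable
  qed measurable
  with sums_integral[OF wH_int AE wH_sum] show ?thesis
    by (simp add: H_def)
qed

section \<open>Averaging over right translates of compact sets\<close>

lemma integrable_right_translate_indicator: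
  assumes K: "compact K" and h: "integrable \<mu> h"
  shows "integrable \<mu> (\<lambda>s. indicator K (s \<odot> y) * h s :: complex)"
proof (rule Bochner_Integration.integrable_bound[OF h])
  have [measurable]: "K \<in> sets borel"
    using K by (rule borel_compact)
  show "(\<lambda>s. indicator K (s \<odot> y) * h s) \<in> borel_measurable \<mu>"
    using h by measurable
qed (auto simp: indicator_def)

lemma integrable_left_translate_indicator:
  assumes K: "compact K"
  shows "integrable \<mu> (\<lambda>y. indicator K (s \<odot> y) :: real)"
    and "(\<integral>y. indicator K (s \<odot> y) \<partial>\<mu>) = measure \<mu> K"
proof -
  have K': "K \<in> sets \<mu>" "K \<in> sets borel"
    using K by (auto simp: sets_haar borel_compact)
  have int: "integrable \<mu> (indicator K :: 'g \<Rightarrow> real)"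
    using K' emeasure_compact_finite[OF K] by simp
  show "integrable \<mu> (\<lambda>y. indicator K (s \<odot> y) :: real)"
    using integrable_left_translation[OF int] .
  show "(\<integral>y. indicator K (s \<odot> y) \<partial>\<mu>) = measure \<mu> K"
    using integral_left_translation[of "indicator K :: 'g \<Rightarrow> real" s] K' by simp
qed

lemma overlap_le:
  assumes K: "compact K" and L: "compact L"
  shows "integrable \<mu> (\<lambda>y. indicator K (s \<odot> y) * indicator L (t \<odot> y) :: real)"
    and "(\<integral>y. indicator K (s \<odot> y) * indicator L (t \<odot> y) \<partial>\<mu>) \<le> measure \<mu> K"
proof -
  have [measurable]: "K \<in> sets borel" "L \<in> sets borel"
    using K L by (auto intro: borel_compact)
  show int: "integrable \<mu> (\<lambda>y. indicator K (s \<odot> y) * indicator L (t \<odot> y) :: real)"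
    by (rule Bochner_Integration.integrable_bound[OF integrable_left_translate_indicator(1)[OF K, of s]])
      (auto simp: indicator_def)
  have "(\<integral>y. indicator K (s \<odot> y) * indicator L (t \<odot> y) \<partial>\<mu>) \<le> (\<integral>y. (indicator K (s \<odot> y) :: real) \<partial>\<mu>)"
    by (rule integral_mono[OF int integrable_left_translate_indicator(1)[OF K]]) (auto simp: indicator_def)
  then show "(\<integral>y. indicator K (s \<odot> y) * indicator L (t \<odot> y) \<partial>\<mu>) \<le> measure \<mu> K"
    using integrable_left_translate_indicator(2)[OF K] by simp
qed

text \<open>The integration over \<open>y\<close> is done first: for fixed \<open>s\<close> it only
  sees a left translate of \<open>K\<close>. The result supplies an integrable majorant when
  cut-offs by right translates of \<open>K\<close> are averaged.\<close>

lemma integral_l2norm_right_translate: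
  assumes K: "compact K" and f: "f \<in> L2 \<mu>"
  shows "integrable \<mu> (\<lambda>y. (l2norm \<mu> (\<lambda>s. indicator K (s \<odot> y) * f s))\<^sup>2)"
    and "(\<integral>y. (l2norm \<mu> (\<lambda>s. indicator K (s \<odot> y) * f s))\<^sup>2 \<partial>\<mu>) = measure \<mu> K * (l2norm \<mu> f)\<^sup>2"
proof -
  have [measurable]: "K \<in> sets borel" "f \<in> borel_measurable \<mu>"
    using K f by (auto intro: borel_compact L2_measurable)
  define h :: "'g \<Rightarrow> 'g \<Rightarrow> real" where "h s y = indicator K (s \<odot> y) * (cmod (f s))\<^sup>2" for s y
  have h_y: "(\<integral>y. h s y \<partial>\<mu>) = measure \<mu> K * (cmod (f s))\<^sup>2" for s
    unfolding h_def by (simp add: integrable_left_translate_indicator(2)[OF K])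
  have norm_h: "norm (h s y) = h s y" for s y
    by (simp add: h_def)
  have h_int: "integrable (\<mu> \<Otimes>\<^sub>M \<mu>) (case_prod h)"
  proof (rule Fubini_integrable)
    show "case_prod h \<in> borel_measurable (\<mu> \<Otimes>\<^sub>M \<mu>)"
      unfolding h_def by measurable
    show "integrable \<mu> (\<lambda>s. \<integral>y. norm (case (s, y) of (s, y) \<Rightarrow> h s y) \<partial>\<mu>)"
      using L2_integrable[OF f] by (simp add: norm_h h_y del: real_norm_def)
    show "AE s in \<mu>. integrable \<mu> (\<lambda>y. case (s, y) of (s, y) \<Rightarrow> h s y)"
      unfolding h_def using integrable_left_translate_indicator(1)[OF K] by simp
  qed
  have h_s: "(\<integral>s. h s y \<partial>\<mu>) = (l2norm \<mu> (\<lambda>s. indicator K (s \<odot> y) * f s))\<^sup>2" for y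
    unfolding l2norm_power2 h_def
    by (intro Bochner_Integration.integral_cong) (auto simp: indicator_def)
  show "integrable \<mu> (\<lambda>y. (l2norm \<mu> (\<lambda>s. indicator K (s \<odot> y) * f s))\<^sup>2)"
    using integrable_snd[OF h_int] unfolding h_s .
  show "(\<integral>y. (l2norm \<mu> (\<lambda>s. indicator K (s \<odot> y) * f s))\<^sup>2 \<partial>\<mu>) = measure \<mu> K * (l2norm \<mu> f)\<^sup>2"
    using Fubini_integral[OF h_int] L2_integrable[OF f] unfolding h_s h_y by (simp add: l2norm_power2)
qed

text \<open>Fubini in three variables, for product kernels. The uniform bound
  \<open>measure \<mu> K\<close> on the overlaps gives absolute integrability, and for each fixed
  \<open>y\<close> the kernel splits into a product again.\<close>

lemma overlap_integral:
  assumes K: "compact K" and L: "compact L" and F: "integrable \<mu> F" and G: "integrable \<mu> G"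
    and w: "\<And>s t. w (s, t) = (\<integral>y. indicator K (s \<odot> y) * indicator L (t \<odot> y) \<partial>\<mu> :: complex)"
  shows "integrable \<mu> (\<lambda>y. (\<integral>s. indicator K (s \<odot> y) * F s \<partial>\<mu>) * (\<integral>t. indicator L (t \<odot> y) * G t \<partial>\<mu>))"
    and "(\<integral>p. w p * (\<lambda>(s, t). F s * G t) p \<partial>(\<mu> \<Otimes>\<^sub>M \<mu>))
      = (\<integral>y. (\<integral>s. indicator K (s \<odot> y) * F s \<partial>\<mu>) * (\<integral>t. indicator L (t \<odot> y) * G t \<partial>\<mu>) \<partial>\<mu>)"
proof -
  interpret P: pair_sigma_finite "\<mu> \<Otimes>\<^sub>M \<mu>" \<mu> ..
  have [measurable]: "K \<in> sets borel" "L \<in> sets borel" "F \<in> borel_measurable \<mu>" "G \<in> borel_measurable \<mu>"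
    using K L F G by (auto intro: borel_compact)
  define FG where "FG p = F (fst p) * G (snd p)" for p
  have FG_int: "integrable (\<mu> \<Otimes>\<^sub>M \<mu>) FG"
    using integrable_product(1)[OF F G] by (simp add: FG_def[abs_def] case_prod_beta')
  have [measurable]: "FG \<in> borel_measurable (\<mu> \<Otimes>\<^sub>M \<mu>)"
    using FG_int by auto
  define h :: "'g \<times> 'g \<Rightarrow> 'g \<Rightarrow> complex" where
    "h p y = (indicator K (fst p \<odot> y) * indicator L (snd p \<odot> y)) * FG p" for p y
  have h_norm: "(\<integral>y. norm (h p y) \<partial>\<mu>)
      = (\<integral>y. indicator K (fst p \<odot> y) * indicator L (snd p \<odot> y) \<partial>\<mu>) * norm (FG p)" for p
  proof -
    have "(\<lambda>y. norm (h p y)) = (\<lambda>y. (indicator K (fst p \<odot> y) * indicator L (snd p \<odot> y)) * norm (FG p))"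
      by (auto simp: h_def indicator_def fun_eq_iff)
    then show ?thesis by simp
  qed
  have ind_int: "integrable \<mu> (\<lambda>y. indicator K (s \<odot> y) * indicator L (t \<odot> y) :: complex)" for s t
    by (rule Bochner_Integration.integrable_bound[OF overlap_le(1)[OF K L, of s t]]) (auto simp: indicator_def)
  have h_int: "integrable ((\<mu> \<Otimes>\<^sub>M \<mu>) \<Otimes>\<^sub>M \<mu>) (case_prod h)"
  proof (rule P.Fubini_integrable)
    show meas [measurable]: "case_prod h \<in> borel_measurable ((\<mu> \<Otimes>\<^sub>M \<mu>) \<Otimes>\<^sub>M \<mu>)"
      unfolding h_def by measurable
    show "integrable (\<mu> \<Otimes>\<^sub>M \<mu>) (\<lambda>p. \<integral>y. norm (case (p, y) of (p, y) \<Rightarrow> h p y) \<partial>\<mu>)"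
    proof (rule Bochner_Integration.integrable_bound)
      show "integrable (\<mu> \<Otimes>\<^sub>M \<mu>) (\<lambda>p. measure \<mu> K * norm (FG p))"
        using FG_int by simp
      show "(\<lambda>p. \<integral>y. norm (case (p, y) of (p, y) \<Rightarrow> h p y) \<partial>\<mu>) \<in> borel_measurable (\<mu> \<Otimes>\<^sub>M \<mu>)"
        by measurable
      show "AE p in \<mu> \<Otimes>\<^sub>M \<mu>. norm (\<integral>y. norm (case (p, y) of (p, y) \<Rightarrow> h p y) \<partial>\<mu>)
          \<le> norm (measure \<mu> K * norm (FG p))"
        using overlap_le(2)[OF K L] by (simp add: h_norm mult_right_mono del: mult_le_cancel_right)
    qed
    show "AE p in \<mu> \<Otimes>\<^sub>M \<mu>. integrable \<mu> (\<lambda>y. case (p, y) of (p, y) \<Rightarrow> h p y)"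
      unfolding h_def using ind_int by simp
  qed
  have h_p: "(\<integral>p. h p y \<partial>(\<mu> \<Otimes>\<^sub>M \<mu>))
      = (\<integral>s. indicator K (s \<odot> y) * F s \<partial>\<mu>) * (\<integral>t. indicator L (t \<odot> y) * G t \<partial>\<mu>)" for y
    using integrable_product(2)[OF integrable_right_translate_indicator[OF K F, of y]
        integrable_right_translate_indicator[OF L G, of y]]
    by (simp add: h_def FG_def case_prod_beta' mult_ac)
  have h_y: "(\<integral>y. h p y \<partial>\<mu>) = w p * (\<lambda>(s, t). F s * G t) p" for p
    using w[of "fst p" "snd p"] by (simp add: h_def FG_def case_prod_beta')
  show "integrable \<mu> (\<lambda>y. (\<integral>s. indicator K (s \<odot> y) * F s \<partial>\<mu>) * (\<integral>t. indicator L (t \<odot> y) * G t \<partial>\<mu>))"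
    using P.integrable_snd[OF h_int] unfolding h_p .
  show "(\<integral>p. w p * (\<lambda>(s, t). F s * G t) p \<partial>(\<mu> \<Otimes>\<^sub>M \<mu>))
      = (\<integral>y. (\<integral>s. indicator K (s \<odot> y) * F s \<partial>\<mu>) * (\<integral>t. indicator L (t \<odot> y) * G t \<partial>\<mu>) \<partial>\<mu>)"
    using P.Fubini_integral[OF h_int] unfolding h_p h_y by simp
qed

text \<open>Formally \<open>\<langle>T, w h\<rangle> = \<integral> \<langle>T, \<chi>\<^bsub>K y\<^sup>-\<^sup>1\<^esub> \<times> \<chi>\<^bsub>L y\<^sup>-\<^sup>1\<^esub> h\<rangle> dy = 0\<close>. The exchange is an honest Fubini
  only for operators with a kernel, so \<open>T\<close> is first replaced by \<open>T P\<^sub>n\<close>, with \<open>P\<^sub>n\<close> the projections of an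
  orthonormal basis.\<close>

lemma schur_zero_overlap:
  assumes T: "bop \<mu> T" and K: "compact K" and L: "compact L"
    and van: "\<And>y. vanishes_on \<mu> T {s. s \<odot> y \<in> K} {t. t \<odot> y \<in> L}"
    and w: "\<And>s t. w (s, t) = (\<integral>y. indicator K (s \<odot> y) * indicator L (t \<odot> y) \<partial>\<mu> :: complex)"
  shows "schur_zero \<mu> w T"
  unfolding schur_zero_def
proof (intro allI impI, elim conjE)
  fix f g f' g'
  assume rep: "tc_rep \<mu> f g" and rep': "tc_rep \<mu> f' g'"
    and null: "marg_null \<mu> {p. w p * tc_fun f g p \<noteq> tc_fun f' g' p}"
  have [measurable]: "K \<in> sets borel" "L \<in> sets borel"
    using K L by (auto intro: borel_compact)
  have w_meas [measurable]: "w \<in> borel_measurable (\<mu> \<Otimes>\<^sub>M \<mu>)"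
  proof -
    have "w = (\<lambda>p. \<integral>y. indicator K (fst p \<odot> y) * indicator L (snd p \<odot> y) \<partial>\<mu>)"
      using w by auto
    then show ?thesis by simp
  qed
  have w_le: "cmod (w p) \<le> measure \<mu> K" for p
  proof -
    have "cmod (w p) \<le> (\<integral>y. norm (indicator K (fst p \<odot> y) * indicator L (snd p \<odot> y) :: complex) \<partial>\<mu>)"
      using w[of "fst p" "snd p"] integral_norm_bound by (metis prod.collapse)
    also have "\<dots> = (\<integral>y. indicator K (fst p \<odot> y) * indicator L (snd p \<odot> y) \<partial>\<mu>)"
      by (intro Bochner_Integration.integral_cong) (auto simp: indicator_def)
    also have "\<dots> \<le> measure \<mu> K"
      by (rule overlap_le(2)[OF K L])
    finally show ?thesis .
  qed
  obtain b where b: "complete_orthonormal \<mu> b"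
    by (rule complete_orthonormal_exists)
  have bL: "b j \<in> L2 \<mu>" for j
    by (rule complete_orthonormal_L2[OF b])
  have TbL: "T (b j) \<in> L2 \<mu>" for j
    by (rule bop_L2[OF T bL])
  obtain C where C: "C \<ge> 0" "\<And>f. f \<in> L2 \<mu> \<Longrightarrow> l2norm \<mu> (T f) \<le> C * l2norm \<mu> f"
    using bop_bounded[OF T] by blast
  have fL: "f i \<in> L2 \<mu>" and gL: "g i \<in> L2 \<mu>" and f'L: "f' i \<in> L2 \<mu>" and g'L: "g' i \<in> L2 \<mu>" for i
    using rep rep' by (auto simp: tc_rep_def)
  define fK where "fK i y = (\<lambda>s. indicator K (s \<odot> y) * f i s)" for i y
  define gL' where "gL' i y = (\<lambda>t. indicator L (t \<odot> y) * g i t)" for i y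
  have fK_L2: "fK i y \<in> L2 \<mu>" and gL_L2: "gL' i y \<in> L2 \<mu>" for i y
    unfolding fK_def gL'_def using fL gL
    by (auto intro!: L2_mult_bounded[where C = 1] simp: indicator_def)
  define P where "P n h = (\<lambda>x. \<Sum>j<n. ip \<mu> h (b j) * b j x)" for n :: nat and h
  have P_L2: "P n h \<in> L2 \<mu>" for n h
    unfolding P_def using bL by (rule projection_L2)
  have P_T: "ip \<mu> (T (P n h)) k = (\<Sum>j<n. ip \<mu> h (b j) * ip \<mu> (T (b j)) k)" if "k \<in> L2 \<mu>" for n h k
    unfolding P_def by (rule ip_bop_projection[OF T bL that])
  have P_lim: "(\<lambda>n. ip \<mu> (T (P n h)) k) \<longlonglongrightarrow> ip \<mu> (T h) k" if "h \<in> L2 \<mu>" "k \<in> L2 \<mu>" for h k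
    by (rule ip_bop_tendsto_left[OF T P_L2 that]) (unfold P_def, rule projection_tendsto[OF b that(1)])
  have P_bound: "cmod (ip \<mu> (T (P n h)) k) \<le> 2 * C * ((l2norm \<mu> h)\<^sup>2 + (l2norm \<mu> k)\<^sup>2)"
    if h: "h \<in> L2 \<mu>" and k: "k \<in> L2 \<mu>" for n h k
  proof -
    have "cmod (ip \<mu> (T (P n h)) k) \<le> C * l2norm \<mu> (P n h) * l2norm \<mu> k"
      by (rule ip_bop_bound[OF T C(2) P_L2 k])
    also have "\<dots> \<le> C * (2 * l2norm \<mu> h) * l2norm \<mu> k"
      unfolding P_def using C(1) l2norm_projection_le[OF b h] by (intro mult_right_mono mult_left_mono) auto
    also have "\<dots> = 2 * C * (l2norm \<mu> h * l2norm \<mu> k)"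
      by simp
    also have "\<dots> \<le> 2 * C * ((l2norm \<mu> h)\<^sup>2 + (l2norm \<mu> k)\<^sup>2)"
    proof (rule mult_left_mono)
      have "0 \<le> l2norm \<mu> h * l2norm \<mu> k" by simp
      then show "l2norm \<mu> h * l2norm \<mu> k \<le> (l2norm \<mu> h)\<^sup>2 + (l2norm \<mu> k)\<^sup>2"
        using sum_squares_bound[of "l2norm \<mu> h" "l2norm \<mu> k"] by linarith
    qed (use C in simp)
    finally show ?thesis .
  qed
  \<comment> \<open>The pairing of \<open>tc_fun f' g'\<close> with the kernel of the
    \<open>j\<close>-th rank one piece of \<open>T\<close>. It is evaluated once through
    \<open>f'\<close>, \<open>g'\<close> and once through \<open>f\<close>, \<open>g\<close> with
    the multiplier \<open>w\<close>.\<close>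
  define I where "I j = (\<integral>p. tc_fun f' g' p * (\<lambda>(s, t). cnj (b j s) * T (b j) t) p \<partial>(\<mu> \<Otimes>\<^sub>M \<mu>))" for j
  have I1: "(\<lambda>i. ip \<mu> (f' i) (b j) * ip \<mu> (T (b j)) (g' i)) sums I j" for j
  proof -
    have "(\<integral>p. 1 * (\<lambda>(s, t). (f' i s * cnj (b j s)) * (T (b j) t * cnj (g' i t))) p \<partial>(\<mu> \<Otimes>\<^sub>M \<mu>))
        = ip \<mu> (f' i) (b j) * ip \<mu> (T (b j)) (g' i)" for i
      using integrable_product(2)[OF integrable_ip[OF f'L[of i] bL[of j]] integrable_ip[OF TbL[of j] g'L[of i]]]
      unfolding ip_def by simp
    with tc_fun_integral_sums[OF rep' bL[of j] TbL[of j], of "\<lambda>p. 1" 1] show ?thesis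
      by (simp add: I_def)
  qed
  have fg_int: "integrable \<mu> (\<lambda>y. ip \<mu> (fK i y) (b j) * ip \<mu> (T (b j)) (gL' i y))"
    and fg_eq: "(\<integral>p. w p * (\<lambda>(s, t). (f i s * cnj (b j s)) * (T (b j) t * cnj (g i t))) p \<partial>(\<mu> \<Otimes>\<^sub>M \<mu>))
      = (\<integral>y. ip \<mu> (fK i y) (b j) * ip \<mu> (T (b j)) (gL' i y) \<partial>\<mu>)" for i j
  proof -
    have cnj_ind: "cnj (indicator L x) = indicator L x" for x
      by (simp add: indicator_def)
    have "ip \<mu> (fK i y) (b j) = (\<integral>s. indicator K (s \<odot> y) * (f i s * cnj (b j s)) \<partial>\<mu>)"
      and "ip \<mu> (T (b j)) (gL' i y) = (\<integral>t. indicator L (t \<odot> y) * (T (b j) t * cnj (g i t)) \<partial>\<mu>)" for y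
      by (simp_all add: ip_def fK_def gL'_def cnj_ind mult_ac)
    then show "integrable \<mu> (\<lambda>y. ip \<mu> (fK i y) (b j) * ip \<mu> (T (b j)) (gL' i y))"
      and "(\<integral>p. w p * (\<lambda>(s, t). (f i s * cnj (b j s)) * (T (b j) t * cnj (g i t))) p \<partial>(\<mu> \<Otimes>\<^sub>M \<mu>))
      = (\<integral>y. ip \<mu> (fK i y) (b j) * ip \<mu> (T (b j)) (gL' i y) \<partial>\<mu>)"
      using overlap_integral[OF K L integrable_ip[OF fL[of i] bL[of j]] integrable_ip[OF TbL[of j] gL[of i]] w]
      by simp_all
  qed
  \<comment> \<open>The hypothesis that \<open>w\<close> times \<open>tc_fun f g\<close> equals
    \<open>tc_fun f' g'\<close> off a marginally null set enters here, under the product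
    integral.\<close>
  have I2: "(\<lambda>i. \<integral>y. ip \<mu> (fK i y) (b j) * ip \<mu> (T (b j)) (gL' i y) \<partial>\<mu>) sums I j" for j
  proof -
    have [measurable]: "b j \<in> borel_measurable \<mu>" "T (b j) \<in> borel_measurable \<mu>"
        "tc_fun f g \<in> borel_measurable (\<mu> \<Otimes>\<^sub>M \<mu>)" "tc_fun f' g' \<in> borel_measurable (\<mu> \<Otimes>\<^sub>M \<mu>)"
      using bL TbL rep rep' by (auto intro: L2_measurable tc_fun_measurable)
    have "AE p in \<mu> \<Otimes>\<^sub>M \<mu>. w p * tc_fun f g p = tc_fun f' g' p"
      using null by (rule AE_product_marg_null)
    then have "AE p in \<mu> \<Otimes>\<^sub>M \<mu>. w p * tc_fun f g p * (\<lambda>(s, t). cnj (b j s) * T (b j) t) p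
        = tc_fun f' g' p * (\<lambda>(s, t). cnj (b j s) * T (b j) t) p"
      by eventually_elim simp
    then have "(\<integral>p. w p * tc_fun f g p * (\<lambda>(s, t). cnj (b j s) * T (b j) t) p \<partial>(\<mu> \<Otimes>\<^sub>M \<mu>)) = I j"
      unfolding I_def by (intro integral_cong_AE) measurable
    with tc_fun_integral_sums[OF rep bL[of j] TbL[of j] w_meas w_le] show ?thesis
      unfolding fg_eq by simp
  qed
  define S where "S i n = ip \<mu> (T (P n (f' i))) (g' i)" for i n
  define R where "R i n = (\<integral>y. ip \<mu> (T (P n (fK i y))) (gL' i y) \<partial>\<mu>)" for i n
  have "(\<lambda>i. S i n) sums (\<Sum>j<n. I j)" for n
    unfolding S_def P_T[OF g'L] by (intro sums_sum I1)
  moreover have "(\<lambda>i. R i n) sums (\<Sum>j<n. I j)" for n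
    unfolding R_def P_T[OF gL_L2]
    by (subst Bochner_Integration.integral_sum) (auto intro!: fg_int sums_sum I2)
  ultimately have SR: "(\<Sum>i. S i n) = (\<Sum>i. R i n)" for n
    by (simp add: sums_iff)
  have S_lim: "(\<lambda>n. \<Sum>i. S i n) \<longlonglongrightarrow> (\<Sum>i. ip \<mu> (T (f' i)) (g' i))"
  proof (rule suminf_dominated_tendsto)
    show "(\<lambda>n. S i n) \<longlonglongrightarrow> ip \<mu> (T (f' i)) (g' i)" for i
      unfolding S_def by (rule P_lim[OF f'L g'L])
    show "norm (S i n) \<le> 2 * C * ((l2norm \<mu> (f' i))\<^sup>2 + (l2norm \<mu> (g' i))\<^sup>2)" for i n
      unfolding S_def by (rule P_bound[OF f'L g'L])
    show "summable (\<lambda>i. 2 * C * ((l2norm \<mu> (f' i))\<^sup>2 + (l2norm \<mu> (g' i))\<^sup>2))"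
      using rep' by (intro summable_mult summable_add) (auto simp: tc_rep_def)
  qed
  \<comment> \<open>A majorant independent of \<open>n\<close>: it is integrable in \<open>y\<close>
    for dominated convergence, and its integrals are summable in \<open>i\<close> for the exchange
    of limit and series.\<close>
  define W where "W i y = 2 * C * ((l2norm \<mu> (fK i y))\<^sup>2 + (l2norm \<mu> (gL' i y))\<^sup>2)" for i y
  have W_int: "integrable \<mu> (W i)" for i
    unfolding W_def fK_def gL'_def
    by (intro integrable_mult_right Bochner_Integration.integrable_add
        integral_l2norm_right_translate(1) K L fL gL)
  have W_eq: "(\<integral>y. W i y \<partial>\<mu>) = 2 * C * (measure \<mu> K * (l2norm \<mu> (f i))\<^sup>2 + measure \<mu> L * (l2norm \<mu> (g i))\<^sup>2)" for i
    unfolding W_def fK_def gL'_def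
    using integral_l2norm_right_translate[OF K fL] integral_l2norm_right_translate[OF L gL] by simp
  have R_meas: "(\<lambda>y. ip \<mu> (T (P n (fK i y))) (gL' i y)) \<in> borel_measurable \<mu>" for n i
    unfolding P_T[OF gL_L2] using fg_int by (intro borel_measurable_sum) auto
  have R_bound: "cmod (ip \<mu> (T (P n (fK i y))) (gL' i y)) \<le> W i y" for n i y
    unfolding W_def by (rule P_bound[OF fK_L2 gL_L2])
  have R_lim: "(\<lambda>n. \<Sum>i. R i n) \<longlonglongrightarrow> (\<Sum>i. 0)"
  proof (rule suminf_dominated_tendsto)
    fix i
    have zero: "ip \<mu> (T (fK i y)) (gL' i y) = 0" for y
    proof -
      have "fK i y = (\<lambda>s. indicator {s. s \<odot> y \<in> K} s * f i s)" "gL' i y = (\<lambda>t. indicator {t. t \<odot> y \<in> L} t * g i t)"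
        by (auto simp: fK_def gL'_def indicator_def fun_eq_iff)
      then show ?thesis
        using van[of y] fL[of i] gL[of i] unfolding vanishes_on_def by simp
    qed
    have "(\<lambda>n. R i n) \<longlonglongrightarrow> (\<integral>y. 0 \<partial>\<mu>)"
      unfolding R_def
    proof (rule integral_dominated_convergence[OF _ R_meas W_int])
      show "AE y in \<mu>. (\<lambda>n. ip \<mu> (T (P n (fK i y))) (gL' i y)) \<longlonglongrightarrow> 0"
      proof (rule AE_I2)
        fix y
        show "(\<lambda>n. ip \<mu> (T (P n (fK i y))) (gL' i y)) \<longlonglongrightarrow> 0"
          using P_lim[OF fK_L2[of i y] gL_L2[of i y]] unfolding zero[of y] .
      qed
    qed (use R_bound in auto)
    then show "(\<lambda>n. R i n) \<longlonglongrightarrow> 0" by simp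
    fix n
    have "norm (R i n) \<le> (\<integral>y. norm (ip \<mu> (T (P n (fK i y))) (gL' i y)) \<partial>\<mu>)"
      unfolding R_def by (rule integral_norm_bound)
    also have "\<dots> \<le> (\<integral>y. W i y \<partial>\<mu>)"
    proof (rule integral_mono[OF _ W_int R_bound])
      show "integrable \<mu> (\<lambda>y. norm (ip \<mu> (T (P n (fK i y))) (gL' i y)))"
        using fg_int unfolding P_T[OF gL_L2] by (intro integrable_norm Bochner_Integration.integrable_sum)
    qed
    finally show "norm (R i n) \<le> (\<integral>y. W i y \<partial>\<mu>)" .
  next
    show "summable (\<lambda>i. \<integral>y. W i y \<partial>\<mu>)"
      unfolding W_eq using rep by (intro summable_mult summable_add) (auto simp: tc_rep_def)
  qed
  show "tc_pair \<mu> T f' g' = 0"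
    unfolding tc_pair_def using LIMSEQ_unique[OF S_lim] R_lim by (simp add: SR)
qed

section \<open>The support\<close>

text \<open>Right translates of L^2 functions would bring in the modular function. The argument is
  therefore run for bounded functions cut off to a compact set, whose translates are square
  integrable for trivial reasons, and only null sets are translated. Truncation then gives all of
  L^2.\<close>

lemma vanishes_on_right_translate:
  assumes T: "bop \<mu> T" and T': "bop \<mu> (\<lambda>\<xi> x. T (\<lambda>y. \<xi> (y \<odot> iv r)) (x \<odot> r))"
    and K: "compact K" and L: "compact L"
    and van: "vanishes_on \<mu> (\<lambda>\<xi> x. T (\<lambda>y. \<xi> (y \<odot> iv r)) (x \<odot> r)) K L"
  shows "vanishes_on \<mu> T {s. s \<odot> iv r \<in> K} {t. t \<odot> iv r \<in> L}" (is "vanishes_on \<mu> T ?A ?B")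
proof -
  have [measurable]: "K \<in> sets borel" "L \<in> sets borel"
    using K L by (auto intro: borel_compact)
  have A: "?A \<in> sets \<mu>" and B: "?B \<in> sets \<mu>"
    by measurable
  have indK: "(indicator K :: 'g \<Rightarrow> complex) \<in> L2 \<mu>"
    using emeasure_compact_finite[OF K] K by (intro L2_indicator) (auto simp: compact_in_sets)
  have bounded: "ip \<mu> (T (\<lambda>x. indicator ?A x * f x)) (\<lambda>x. indicator ?B x * g x) = 0"
    if f: "f \<in> borel_measurable \<mu>" "\<And>x. cmod (f x) \<le> c" for f g c
  proof -
    have [measurable]: "f \<in> borel_measurable borel"
      using f(1) by simp
    \<comment> \<open>Translating \<open>\<xi>\<close> back by \<open>iv r\<close> recovers
      \<open>f\<close> on \<open>?A\<close>.\<close>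
    define \<xi> where "\<xi> = (\<lambda>x. f (x \<odot> r) * indicator K x)"
    have \<xi>: "\<xi> \<in> L2 \<mu>"
      unfolding \<xi>_def by (rule L2_mult_bounded[OF indK _ f(2)]) measurable
    have "(\<lambda>y. indicator K (y \<odot> iv r) * \<xi> (y \<odot> iv r)) = (\<lambda>x. indicator ?A x * f x)"
      by (auto simp: \<xi>_def indicator_def fun_eq_iff assoc)
    moreover have "AE x in \<mu>. indicator L x * T (\<lambda>y. indicator K (y \<odot> iv r) * \<xi> (y \<odot> iv r)) (x \<odot> r) = 0"
      using van \<xi> unfolding vanishes_on_iff_AE[OF T' compact_in_sets[OF K] compact_in_sets[OF L]] by blast
    ultimately have "AE x in \<mu>. indicator L x * T (\<lambda>x. indicator ?A x * f x) (x \<odot> r) = 0"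
      by simp
    then have "AE x in \<mu>. indicator L (x \<odot> iv r) * T (\<lambda>x. indicator ?A x * f x) (x \<odot> iv r \<odot> r) = 0"
      by (rule AE_right_translation)
    then have "AE x in \<mu>. T (\<lambda>x. indicator ?A x * f x) x * cnj (indicator ?B x * g x) = 0"
      by eventually_elim (auto simp: indicator_def assoc split: if_splits)
    then show ?thesis
      unfolding ip_def by (rule integral_eq_zero_AE)
  qed
  show ?thesis
    unfolding vanishes_on_def
  proof (intro ballI)
    fix f g assume f: "f \<in> L2 \<mu>" and g: "g \<in> L2 \<mu>"
    have [measurable]: "f \<in> borel_measurable \<mu>"
      using f by (rule L2_measurable)
    define F where "F n = {x. cmod (f x) \<le> real n}" for n :: nat
    have F [measurable]: "F n \<in> sets \<mu>" for n
    proof -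
      have "{x \<in> space \<mu>. cmod (f x) \<le> real n} \<in> sets \<mu>"
        by measurable
      then show ?thesis by (simp add: F_def)
    qed
    have lim: "(\<lambda>n. l2norm \<mu> (\<lambda>x. indicator (?A \<inter> F n) x * f x - indicator ?A x * f x)) \<longlonglongrightarrow> 0"
    proof (rule L2_indicator_tendsto[OF f])
      show "incseq (\<lambda>n. ?A \<inter> F n)"
        by (auto simp: incseq_def F_def intro: order_trans)
      have "?A - (\<Union>n. ?A \<inter> F n) = {}"
        using real_arch_simple by (auto simp: F_def)
      then show "?A - (\<Union>n. ?A \<inter> F n) \<in> null_sets \<mu>"
        by (metis null_sets.empty_sets)
    qed (use A F in auto)
    have "ip \<mu> (T (\<lambda>x. indicator (?A \<inter> F n) x * f x)) (\<lambda>x. indicator ?B x * g x) = 0" for n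
    proof -
      have "(\<lambda>x. indicator (?A \<inter> F n) x * f x) = (\<lambda>x. indicator ?A x * (indicator (F n) x * f x))"
        by (auto simp: indicator_def)
      moreover have "(\<lambda>x. indicator (F n) x * f x) \<in> borel_measurable \<mu>"
        by measurable
      moreover have "cmod (indicator (F n) x * f x) \<le> real n" for x
        by (auto simp: indicator_def F_def)
      ultimately show ?thesis
        using bounded[of "\<lambda>x. indicator (F n) x * f x" "real n" g] by simp
    qed
    then show "ip \<mu> (T (\<lambda>x. indicator ?A x * f x)) (\<lambda>x. indicator ?B x * g x) = 0"
      using ip_bop_tendsto_left[OF T L2_indicator_mult[OF f] L2_indicator_mult[OF f A] L2_indicator_mult[OF g B] lim] A F
      by (simp add: LIMSEQ_const_iff sets.Int)
  qed
qed

text \<open>The witness in \<open>I\<^sub>U\<close> is \<open>u(x) = \<langle>\<lambda>\<^sub>x \<chi>\<^sub>K, \<chi>\<^sub>L\<rangle>\<close>, for which \<open>N(u)(s, t) = \<mu>(s\<^sup>-\<^sup>1 K \<inter> t\<^sup>-\<^sup>1 L)\<close>.\<close>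

lemma marg_null_estar_supp_compact:
  assumes U: "\<And>T. T \<in> U \<Longrightarrow> bop \<mu> T"
    and inv: "\<And>T r. T \<in> U \<Longrightarrow> (\<lambda>\<xi> x. T (\<lambda>y. \<xi> (y \<odot> iv r)) (x \<odot> r)) \<in> U"
    and K: "compact K" and L: "compact L" and van: "\<And>T. T \<in> U \<Longrightarrow> vanishes_on \<mu> T K L"
  shows "marg_null \<mu> (estar (\<odot>) iv (supp_G (\<odot>) iv \<mu> U) \<inter> K \<times> L)"
proof -
  have [measurable]: "K \<in> sets borel" "L \<in> sets borel"
    using K L by (auto intro: borel_compact)
  have ind: "(indicator K :: 'g \<Rightarrow> complex) \<in> L2 \<mu>" "(indicator L :: 'g \<Rightarrow> complex) \<in> L2 \<mu>"
    using emeasure_compact_finite[OF K] emeasure_compact_finite[OF L] K L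
    by (auto intro!: L2_indicator simp: compact_in_sets)
  define u :: "'g \<Rightarrow> complex" where "u x = ip \<mu> (\<lambda>y. indicator K (iv x \<odot> y)) (indicator L)" for x
  have N: "Nmap (\<odot>) iv u (s, t) = (\<integral>y. indicator K (s \<odot> y) * indicator L (t \<odot> y) \<partial>\<mu>)" for s t
  proof -
    have "cnj (indicator L x) = indicator L x" for x
      by (simp add: indicator_def)
    then show ?thesis
      unfolding Nmap_coefficient[OF ind u_def] ip_def by simp
  qed
  have "u \<in> fourier_alg (\<odot>) iv \<mu>"
    unfolding fourier_alg_def using ind u_def by blast
  moreover have "schur_zero \<mu> (Nmap (\<odot>) iv u) T" if T: "T \<in> U" for T
  proof (rule schur_zero_overlap[OF U[OF T] K L _ N])
    fix y
    show "vanishes_on \<mu> T {s. s \<odot> y \<in> K} {t. t \<odot> y \<in> L}"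
      using vanishes_on_right_translate[OF U[OF T] U[OF inv[OF T]] K L van[OF inv[OF T]], of "iv y"] by simp
  qed
  ultimately have "u \<in> I_U (\<odot>) iv \<mu> U"
    by (simp add: I_U_def)
  then have zero: "Nmap (\<odot>) iv u (s, t) = 0" if "(s, t) \<in> estar (\<odot>) iv (supp_G (\<odot>) iv \<mu> U)" for s t
    using that by (auto simp: estar_def supp_G_def Nmap_def)
  have "emeasure \<mu> {y. s \<odot> y \<in> K \<and> t \<odot> y \<in> L} = 0"
    if "(s, t) \<in> estar (\<odot>) iv (supp_G (\<odot>) iv \<mu> U)" for s t
  proof -
    let ?S = "{y. s \<odot> y \<in> K \<and> t \<odot> y \<in> L}"
    have S: "?S \<in> sets \<mu>"
      by measurable
    have eq: "(\<lambda>y. indicator K (s \<odot> y) * indicator L (t \<odot> y)) = (indicator ?S :: 'g \<Rightarrow> real)"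
      by (auto simp: indicator_def fun_eq_iff)
    have int: "integrable \<mu> (indicator ?S :: 'g \<Rightarrow> real)"
      using overlap_le(1)[OF K L, of s t] unfolding eq .
    have "(\<integral>y. indicator K (s \<odot> y) * indicator L (t \<odot> y) \<partial>\<mu>) = complex_of_real (\<integral>y. indicator ?S y \<partial>\<mu>)"
      unfolding integral_complex_of_real[symmetric]
      by (intro Bochner_Integration.integral_cong) (auto simp: indicator_def)
    then have "measure \<mu> ?S = 0"
      using zero[OF that] S unfolding N by simp
    \<comment> \<open>Finiteness matters because \<open>measure\<close> also takes the value 0 on
      sets of infinite measure.\<close>
    moreover have "emeasure \<mu> ?S < \<infinity>"
      using int S by (simp add: integrable_indicator_iff)
    ultimately show ?thesis
      by (simp add: emeasure_eq_ennreal_measure)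
  qed
  then show ?thesis
    by (intro marg_null_subset[OF overlap_positive[OF K L]]) auto
qed

text \<open>What the compact rectangles miss lies in two strips over null sets, which are marginally
  null.\<close>

lemma marg_null_estar_supp_rectangle:
  assumes U: "\<And>T. T \<in> U \<Longrightarrow> bop \<mu> T"
    and inv: "\<And>T r. T \<in> U \<Longrightarrow> (\<lambda>\<xi> x. T (\<lambda>y. \<xi> (y \<odot> iv r)) (x \<odot> r)) \<in> U"
    and A: "A \<in> sets borel" and B: "B \<in> sets borel" and van: "\<And>T. T \<in> U \<Longrightarrow> vanishes_on \<mu> T A B"
  shows "marg_null \<mu> (estar (\<odot>) iv (supp_G (\<odot>) iv \<mu> U) \<inter> A \<times> B)"
proof -
  let ?E = "estar (\<odot>) iv (supp_G (\<odot>) iv \<mu> U)"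
  obtain K where K: "\<And>n::nat. compact (K n)" "incseq K" "\<And>n. K n \<subseteq> A" "A - (\<Union>n. K n) \<in> null_sets \<mu>"
    using inner_regular[OF A] by blast
  obtain L where L: "\<And>n::nat. compact (L n)" "incseq L" "\<And>n. L n \<subseteq> B" "B - (\<Union>n. L n) \<in> null_sets \<mu>"
    using inner_regular[OF B] by blast
  have "marg_null \<mu> (?E \<inter> K n \<times> L k)" for n k
  proof (rule marg_null_estar_supp_compact[OF U inv K(1) L(1)])
    fix T assume "T \<in> U"
    from van[OF this] show "vanishes_on \<mu> T (K n) (L k)"
      by (rule vanishes_on_mono) (use K L in \<open>auto simp: compact_in_sets\<close>)
  qed
  then have "marg_null \<mu> (\<Union>(n, k)\<in>UNIV. ?E \<inter> K n \<times> L k)"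
    by (intro marg_null_UN) auto
  moreover have "marg_null \<mu> ((A - (\<Union>n. K n)) \<times> UNIV)" "marg_null \<mu> (UNIV \<times> (B - (\<Union>n. L n)))"
    unfolding marg_null_def using K(4) L(4) by blast+
  ultimately have "marg_null \<mu> ((\<Union>(n, k)\<in>UNIV. ?E \<inter> K n \<times> L k) \<union>
      ((A - (\<Union>n. K n)) \<times> UNIV \<union> UNIV \<times> (B - (\<Union>n. L n))))"
    by (intro marg_null_Un)
  then show ?thesis
    by (rule marg_null_subset) auto
qed

lemma omega_support_estar_supp:
  assumes U: "\<And>T. T \<in> U \<Longrightarrow> bop \<mu> T"
    and inv: "\<And>T r. T \<in> U \<Longrightarrow> (\<lambda>\<xi> x. T (\<lambda>y. \<xi> (y \<odot> iv r)) (x \<odot> r)) \<in> U"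
  shows "omega_support \<mu> U (estar (\<odot>) iv (supp_G (\<odot>) iv \<mu> U))" (is "omega_support \<mu> U ?E")
  unfolding omega_support_def
proof (intro conjI allI impI)
  show "omega_closed \<mu> ?E"
    by (intro omega_closed_closed closed_estar closed_supp_G)
  show "U \<subseteq> Mmax \<mu> ?E"
    using U by (rule subset_Mmax_estar_supp)
  fix \<Omega> assume "omega_closed \<mu> \<Omega> \<and> U \<subseteq> Mmax \<mu> \<Omega>"
  then have \<Omega>: "omega_closed \<mu> \<Omega>" "U \<subseteq> Mmax \<mu> \<Omega>"
    by auto
  from \<Omega>(1) obtain A B :: "nat \<Rightarrow> 'g set" where AB: "\<And>n. A n \<in> sets borel" "\<And>n. B n \<in> sets borel"
    and equiv: "marg_equiv \<mu> (- \<Omega>) (\<Union>n. A n \<times> B n)"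
    unfolding omega_closed_def omega_open_def by blast
  obtain X where X: "X \<in> null_sets \<mu>"
    "(- \<Omega> - (\<Union>n. A n \<times> B n)) \<union> ((\<Union>n. A n \<times> B n) - - \<Omega>) \<subseteq> X \<times> UNIV \<union> UNIV \<times> X"
    using equiv unfolding marg_equiv_def marg_null_def by blast
  have Xb: "X \<in> sets borel"
    using X(1) by (auto simp: sets_haar)
  \<comment> \<open>\<open>Mmax\<close> speaks only of rectangles truly disjoint from
    \<open>\<Omega>\<close>, while the given ones avoid it up to the strips over \<open>X\<close>.
    Removing \<open>X\<close> from both sides makes them disjoint.\<close>
  have null: "marg_null \<mu> (?E \<inter> (A n - X) \<times> (B n - X))" for n
  proof (rule marg_null_estar_supp_rectangle[OF U inv])
    show s: "A n - X \<in> sets borel" "B n - X \<in> sets borel"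
      using AB Xb by auto
    fix T assume T: "T \<in> U"
    have "(A n - X) \<times> (B n - X) \<inter> \<Omega> = {}"
      using X(2) by blast
    then show "vanishes_on \<mu> T (A n - X) (B n - X)"
      using \<Omega>(2) T s vanishes_on_iff_AE[OF U[OF T], of "A n - X" "B n - X"]
      unfolding Mmax_def by (auto simp: sets_haar)
  qed
  have "marg_null \<mu> ((\<Union>n. ?E \<inter> (A n - X) \<times> (B n - X)) \<union> (X \<times> UNIV \<union> UNIV \<times> X))"
    using X(1) by (intro marg_null_Un marg_null_UN null) (auto simp: marg_null_def)
  then show "marg_null \<mu> (?E - \<Omega>)"
    by (rule marg_null_subset) (use X(2) in blast)
qed

end

theorem theorem3p6:
  fixes m :: "'g::{t2_space, second_countable_topology} \<Rightarrow> 'g \<Rightarrow> 'g"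
    and iv :: "'g \<Rightarrow> 'g"
    and \<mu> :: "'g measure"
    and U :: "'g op set"
  assumes "lc_group m iv"
    and "left_haar m \<mu>"
    and "op_subspace \<mu> U"
    and "wstar_closed \<mu> U"
    and "jointly_invariant m iv \<mu> U"
  shows "(\<exists>\<Omega>. omega_support \<mu> U \<Omega>) \<and>
         (\<forall>\<Omega>. omega_support \<mu> U \<Omega> \<longrightarrow> marg_equiv \<mu> \<Omega> (estar m iv (supp_G m iv \<mu> U))) \<and>
         (\<forall>\<Omega>. omega_support \<mu> U \<Omega> \<longrightarrow> (\<exists>F. closed F \<and> marg_equiv \<mu> \<Omega> F))"
proof -
  obtain e where e: "\<And>x. m e x = x \<and> m x e = x \<and> m (iv x) x = e \<and> m x (iv x) = e"
    using assms(1) unfolding lc_group_def by blast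
  interpret haar_group m iv e \<mu>
    using assms(1,2) e by unfold_locales (auto simp: lc_group_def)
  let ?E = "estar m iv (supp_G m iv \<mu> U)"
  have supp: "omega_support \<mu> U ?E"
    using assms(3,5) by (intro omega_support_estar_supp) (auto simp: op_subspace_def jointly_invariant_def)
  moreover have "marg_equiv \<mu> \<Omega> ?E" if "omega_support \<mu> U \<Omega>" for \<Omega>
    using that supp by (rule omega_support_unique)
  moreover have "closed ?E"
    by (intro closed_estar closed_supp_G)
  ultimately show ?thesis
    by blast
qed

end
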